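(* Let $\Lambda_c$ be the conifold algebra. In $\Lambda_c$ the elements $$x=X^2,\qquad y=Y^2,\qquad z=\tfrac12(XY+YX)$$ are algebraically independent central elements, and $\Lambda_c$ is a free module over the central subalgebra $C=\mathbb{C}[x,y,z]$ with basis $$\Lambda_c=C.1\oplus C.X\oplus C.Y\oplus C.Z\oplus C.XY\oplus C.XZ\oplus C.YZ\oplus C.XYZ .$$ In fact, the conifold algebra is a skew group algebra $$\Lambda_c\simeq\mathbb{C}[z,X][Y,\sigma,\delta]\,\#\,\mathbb{Z}/2\mathbb{Z}$$ for some automorphism $\sigma$ and $\sigma$-derivation $\delta$ of the commutative polynomial ring $\mathbb{C}[z,X]$. In particular, $\Lambda_c$ is a regular algebra of dimension three.
   Context: The conifold algebra is $$\Lambda_c=\frac{\mathbb{C}\langle X,Y,Z\rangle}{(Z^2-1,\ XZ+ZX,\ YZ+ZY,\ [X^2,Y],\ [Y^2,X])},\qquad [A,B]=AB-BA.$$ For a ring $B$ with automorphism $\sigma$ and $\sigma$-derivation $\delta$, the Ore extension $B[Y,\sigma,\delta]$ is the free left $B$-module on the powers of $Y$ with multiplication determined by $Yb=\sigma(b)Y+\delta(b)$ for $b\in B$. For a finite group $G$ acting on an algebra $S$ by algebra automorphisms, the skew group algebra $S\#G$ is $\bigoplus_{g\in G}S\,g$ with $g s=g(s)\,g$. "Regular of dimension three" is understood as: of global dimension $3$. *)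

theory Defs
  imports
    "HOL-Algebra.Algebra"
    "HOL-Algebra.Algebraic_Closure_Type"
    "HOL-Library.Poly_Mapping"
    "HOL-Library.Extended_Nat"
    "HOL-Computational_Algebra.Polynomial"
begin

section \<open>The conifold algebra\<close>

datatype generator = gen_X | gen_Y | gen_Z

text \<open>The free monoid, written additively so that the type \<open>word \<Rightarrow>\<^sub>0 complex\<close> of
  finitely supported functions with convolution product is the free algebra
  \<open>\<complex>\<langle>X,Y,Z\<rangle>\<close>.\<close>

datatype word = Word (letters: "generator list")

instantiation word :: monoid_add
begin

definition zero_word :: word where "0 = Word []"

definition plus_word :: "word \<Rightarrow> word \<Rightarrow> word" where
  "u + v = Word (letters u @ letters v)"

instance by standard (auto simp: zero_word_def plus_word_def)

end

type_synonym free_alg = "word \<Rightarrow>\<^sub>0 complex"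

definition free_X :: free_alg where "free_X = Poly_Mapping.single (Word [gen_X]) 1"
definition free_Y :: free_alg where "free_Y = Poly_Mapping.single (Word [gen_Y]) 1"
definition free_Z :: free_alg where "free_Z = Poly_Mapping.single (Word [gen_Z]) 1"

definition commutator :: "'a::ring_1 \<Rightarrow> 'a \<Rightarrow> 'a" where
  "commutator a b = a * b - b * a"

definition conifold_relations :: "free_alg set" where
  "conifold_relations =
     {free_Z^2 - 1, free_X * free_Z + free_Z * free_X, free_Y * free_Z + free_Z * free_Y,
      commutator (free_X^2) free_Y, commutator (free_Y^2) free_X}"

definition conifold_ideal :: "free_alg set" where
  "conifold_ideal = Idl\<^bsub>ring_of_type_algebra\<^esub> conifold_relations"

definition conifold :: "free_alg set ring" where
  "conifold = ring_of_type_algebra Quot conifold_ideal"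

definition conifold_class :: "free_alg \<Rightarrow> free_alg set" where
  "conifold_class p = conifold_ideal +>\<^bsub>ring_of_type_algebra\<^esub> p"

definition conifold_scal :: "complex \<Rightarrow> free_alg set" where
  "conifold_scal c = conifold_class (Poly_Mapping.single 0 c)"

definition conifold_X :: "free_alg set" where "conifold_X = conifold_class free_X"
definition conifold_Y :: "free_alg set" where "conifold_Y = conifold_class free_Y"
definition conifold_Z :: "free_alg set" where "conifold_Z = conifold_class free_Z"

definition conifold_x :: "free_alg set" where
  "conifold_x = conifold_X [^]\<^bsub>conifold\<^esub> (2::nat)"

definition conifold_y :: "free_alg set" where
  "conifold_y = conifold_Y [^]\<^bsub>conifold\<^esub> (2::nat)"

definition conifold_z :: "free_alg set" where
  "conifold_z = conifold_scal (1/2) \<otimes>\<^bsub>conifold\<^esub>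
     (conifold_X \<otimes>\<^bsub>conifold\<^esub> conifold_Y \<oplus>\<^bsub>conifold\<^esub> conifold_Y \<otimes>\<^bsub>conifold\<^esub> conifold_X)"

text \<open>The subalgebra generated by \<open>x\<close>, \<open>y\<close>, \<open>z\<close>.\<close>

definition conifold_C :: "free_alg set set" where
  "conifold_C = generate_ring conifold (range conifold_scal \<union> {conifold_x, conifold_y, conifold_z})"


section \<open>Central elements, algebraic independence, bases\<close>

text \<open>A \<open>\<complex>\<close>-algebra is given by a ring \<open>R\<close> together with its structure map
  \<open>s :: complex \<Rightarrow> _\<close>, sending a scalar \<open>c\<close> to \<open>c \<cdot> 1\<close>.\<close>

definition ring_center :: "('a, 'b) ring_scheme \<Rightarrow> 'a set" where
  "ring_center R = {a \<in> carrier R. \<forall>b\<in>carrier R. a \<otimes>\<^bsub>R\<^esub> b = b \<otimes>\<^bsub>R\<^esub> a}"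

text \<open>A polynomial in three variables is given by its finitely many nonzero coefficients,
  indexed by exponent triples.\<close>

definition poly3_eval ::
  "('a, 'b) ring_scheme \<Rightarrow> (complex \<Rightarrow> 'a) \<Rightarrow> 'a \<Rightarrow> 'a \<Rightarrow> 'a \<Rightarrow> (nat \<times> nat \<times> nat \<Rightarrow>\<^sub>0 complex) \<Rightarrow> 'a"
  where
  "poly3_eval R s a b c p =
     (\<Oplus>\<^bsub>R\<^esub>m\<in>Poly_Mapping.keys p. case m of (i, j, k) \<Rightarrow>
        s (Poly_Mapping.lookup p m) \<otimes>\<^bsub>R\<^esub> (a [^]\<^bsub>R\<^esub> i \<otimes>\<^bsub>R\<^esub> b [^]\<^bsub>R\<^esub> j \<otimes>\<^bsub>R\<^esub> c [^]\<^bsub>R\<^esub> k))"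

definition algebraically_independent3 ::
  "('a, 'b) ring_scheme \<Rightarrow> (complex \<Rightarrow> 'a) \<Rightarrow> 'a \<Rightarrow> 'a \<Rightarrow> 'a \<Rightarrow> bool" where
  "algebraically_independent3 R s a b c \<longleftrightarrow>
     (\<forall>p. poly3_eval R s a b c p = \<zero>\<^bsub>R\<^esub> \<longrightarrow> p = 0)"

definition regular_module :: "('a, 'b) ring_scheme \<Rightarrow> ('a, 'a) module" where
  "regular_module R = \<lparr>carrier = carrier R, monoid.mult = monoid.mult R, one = \<one>\<^bsub>R\<^esub>,
     ring.zero = \<zero>\<^bsub>R\<^esub>, add = add R, module.smult = monoid.mult R\<rparr>"

definition module_basis :: "('a, 'b) ring_scheme \<Rightarrow> ('a, 'm, 'c) module_scheme \<Rightarrow> 'm list \<Rightarrow> bool" where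
  "module_basis R M bs \<longleftrightarrow> set bs \<subseteq> carrier M \<and>
     (\<forall>m\<in>carrier M. \<exists>!c. c \<in> {..<length bs} \<rightarrow>\<^sub>E carrier R \<and>
        m = (\<Oplus>\<^bsub>M\<^esub>i\<in>{..<length bs}. c i \<odot>\<^bsub>M\<^esub> bs ! i))"


section \<open>Ore extensions and skew group algebras\<close>

definition algebra_iso ::
  "('a, 'c) ring_scheme \<Rightarrow> (complex \<Rightarrow> 'a) \<Rightarrow> ('b, 'd) ring_scheme \<Rightarrow> (complex \<Rightarrow> 'b) \<Rightarrow> ('a \<Rightarrow> 'b) set"
  where
  "algebra_iso R s S t = {f \<in> ring_iso R S. \<forall>c. f (s c) = t c}"

definition sigma_derivation ::
  "('a, 'b) ring_scheme \<Rightarrow> (complex \<Rightarrow> 'a) \<Rightarrow> ('a \<Rightarrow> 'a) \<Rightarrow> ('a \<Rightarrow> 'a) \<Rightarrow> bool" where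
  "sigma_derivation B s \<sigma> \<delta> \<longleftrightarrow>
     \<delta> \<in> carrier B \<rightarrow> carrier B \<and>
     (\<forall>a\<in>carrier B. \<forall>b\<in>carrier B. \<delta> (a \<oplus>\<^bsub>B\<^esub> b) = \<delta> a \<oplus>\<^bsub>B\<^esub> \<delta> b) \<and>
     (\<forall>a\<in>carrier B. \<forall>b\<in>carrier B. \<delta> (a \<otimes>\<^bsub>B\<^esub> b) = \<sigma> a \<otimes>\<^bsub>B\<^esub> \<delta> b \<oplus>\<^bsub>B\<^esub> \<delta> a \<otimes>\<^bsub>B\<^esub> b) \<and>
     (\<forall>c. \<forall>b\<in>carrier B. \<delta> (s c \<otimes>\<^bsub>B\<^esub> b) = s c \<otimes>\<^bsub>B\<^esub> \<delta> b)"

text \<open>The underlying left \<open>B\<close>-module of \<open>B[Y,\<sigma>,\<delta>]\<close> is the one of the polynomial ring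
  \<^term>\<open>UP B\<close>. Left multiplication by \<open>Y\<close> maps
  \<open>\<Sum> b\<^sub>n Y\<^sup>n\<close> to \<open>\<Sum> (\<sigma> b\<^sub>n) Y\<^sup>n\<^sup>+\<^sup>1 + (\<delta> b\<^sub>n) Y\<^sup>n\<close>, and the product of
  \<open>\<Sum> p\<^sub>i Y\<^sup>i\<close> with \<open>q\<close> is \<open>\<Sum> p\<^sub>i (Y\<^sup>i q)\<close>.\<close>

definition ore_left_mult_Y ::
  "('a, 'b) ring_scheme \<Rightarrow> ('a \<Rightarrow> 'a) \<Rightarrow> ('a \<Rightarrow> 'a) \<Rightarrow> (nat \<Rightarrow> 'a) \<Rightarrow> nat \<Rightarrow> 'a" where
  "ore_left_mult_Y B \<sigma> \<delta> q =
     (\<lambda>n. (case n of 0 \<Rightarrow> \<zero>\<^bsub>B\<^esub> | Suc k \<Rightarrow> \<sigma> (q k)) \<oplus>\<^bsub>B\<^esub> \<delta> (q n))"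

definition ore_extension ::
  "('a, 'b) ring_scheme \<Rightarrow> ('a \<Rightarrow> 'a) \<Rightarrow> ('a \<Rightarrow> 'a) \<Rightarrow> ('a, nat \<Rightarrow> 'a) up_ring" where
  "ore_extension B \<sigma> \<delta> = (UP B)\<lparr>monoid.mult := \<lambda>p\<in>up B. \<lambda>q\<in>up B. \<lambda>n.
     \<Oplus>\<^bsub>B\<^esub>i\<in>{i. p i \<noteq> \<zero>\<^bsub>B\<^esub>}. p i \<otimes>\<^bsub>B\<^esub> (ore_left_mult_Y B \<sigma> \<delta> ^^ i) q n\<rparr>"

definition ore_const :: "('a, 'b) ring_scheme \<Rightarrow> 'a \<Rightarrow> nat \<Rightarrow> 'a" where
  "ore_const B b = up_ring.monom (UP B) b 0"

definition ore_Y :: "('a, 'b) ring_scheme \<Rightarrow> nat \<Rightarrow> 'a" where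
  "ore_Y B = up_ring.monom (UP B) \<one>\<^bsub>B\<^esub> 1"

definition algebra_action ::
  "('g, 'c) monoid_scheme \<Rightarrow> ('a, 'b) ring_scheme \<Rightarrow> (complex \<Rightarrow> 'a) \<Rightarrow> ('g \<Rightarrow> 'a \<Rightarrow> 'a) \<Rightarrow> bool" where
  "algebra_action G S s \<alpha> \<longleftrightarrow>
     group_action G (carrier S) \<alpha> \<and> (\<forall>g\<in>carrier G. \<alpha> g \<in> algebra_iso S s S s)"

text \<open>The function \<open>a\<close> stands for \<open>\<Sum> (a g) g\<close>, the sum being over the finite group \<open>G\<close>;
  \<open>\<alpha>\<close> is the action of \<open>G\<close> on \<open>S\<close>.\<close>

definition skew_group_ring ::
  "('a, 'b) ring_scheme \<Rightarrow> ('g, 'c) monoid_scheme \<Rightarrow> ('g \<Rightarrow> 'a \<Rightarrow> 'a) \<Rightarrow> ('g \<Rightarrow> 'a) ring" where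
  "skew_group_ring S G \<alpha> = \<lparr>
     carrier = carrier G \<rightarrow>\<^sub>E carrier S,
     monoid.mult = \<lambda>a b. \<lambda>k\<in>carrier G.
       \<Oplus>\<^bsub>S\<^esub>g\<in>carrier G. a g \<otimes>\<^bsub>S\<^esub> \<alpha> g (b (inv\<^bsub>G\<^esub> g \<otimes>\<^bsub>G\<^esub> k)),
     one = \<lambda>k\<in>carrier G. if k = \<one>\<^bsub>G\<^esub> then \<one>\<^bsub>S\<^esub> else \<zero>\<^bsub>S\<^esub>,
     ring.zero = \<lambda>k\<in>carrier G. \<zero>\<^bsub>S\<^esub>,
     add = \<lambda>a b. \<lambda>k\<in>carrier G. a k \<oplus>\<^bsub>S\<^esub> b k\<rparr>"

definition skew_incl :: "('a, 'b) ring_scheme \<Rightarrow> ('g, 'c) monoid_scheme \<Rightarrow> 'a \<Rightarrow> 'g \<Rightarrow> 'a" where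
  "skew_incl S G s = (\<lambda>k\<in>carrier G. if k = \<one>\<^bsub>G\<^esub> then s else \<zero>\<^bsub>S\<^esub>)"

text \<open>\<open>\<complex>[z,X]\<close> as \<open>\<complex>[z][X]\<close>.\<close>

abbreviation poly_zX :: "complex poly poly ring" where
  "poly_zX \<equiv> ring_of_type_algebra"

definition zX_scal :: "complex \<Rightarrow> complex poly poly" where "zX_scal c = [:[:c:]:]"
definition zX_z :: "complex poly poly" where "zX_z = [:[:0, 1:]:]"
definition zX_X :: "complex poly poly" where "zX_X = [:0, 1:]"


section \<open>Global dimension\<close>

text \<open>The locale \<^locale>\<open>module\<close> requires a commutative base ring. As there, the fields
  \<^const>\<open>mult\<close> and \<^const>\<open>monoid.one\<close> of a module record play no role.\<close>

locale left_module = R?: ring R + M?: abelian_group M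
  for R :: "('a, 'b) ring_scheme" (structure) and M :: "('a, 'm, 'd) module_scheme" (structure) +
  assumes smult_closed: "\<lbrakk>a \<in> carrier R; x \<in> carrier M\<rbrakk> \<Longrightarrow> a \<odot>\<^bsub>M\<^esub> x \<in> carrier M"
    and smult_l_distr: "\<lbrakk>a \<in> carrier R; b \<in> carrier R; x \<in> carrier M\<rbrakk> \<Longrightarrow>
      (a \<oplus>\<^bsub>R\<^esub> b) \<odot>\<^bsub>M\<^esub> x = a \<odot>\<^bsub>M\<^esub> x \<oplus>\<^bsub>M\<^esub> b \<odot>\<^bsub>M\<^esub> x"
    and smult_r_distr: "\<lbrakk>a \<in> carrier R; x \<in> carrier M; y \<in> carrier M\<rbrakk> \<Longrightarrow>
      a \<odot>\<^bsub>M\<^esub> (x \<oplus>\<^bsub>M\<^esub> y) = a \<odot>\<^bsub>M\<^esub> x \<oplus>\<^bsub>M\<^esub> a \<odot>\<^bsub>M\<^esub> y"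
    and smult_assoc: "\<lbrakk>a \<in> carrier R; b \<in> carrier R; x \<in> carrier M\<rbrakk> \<Longrightarrow>
      (a \<otimes>\<^bsub>R\<^esub> b) \<odot>\<^bsub>M\<^esub> x = a \<odot>\<^bsub>M\<^esub> (b \<odot>\<^bsub>M\<^esub> x)"
    and smult_one: "x \<in> carrier M \<Longrightarrow> \<one>\<^bsub>R\<^esub> \<odot>\<^bsub>M\<^esub> x = x"

definition left_module_hom ::
  "('a, 'b) ring_scheme \<Rightarrow> ('a, 'm, 'c) module_scheme \<Rightarrow> ('a, 'n, 'd) module_scheme \<Rightarrow> ('m \<Rightarrow> 'n) set"
  where
  "left_module_hom R M N = {h \<in> carrier M \<rightarrow> carrier N.
     (\<forall>x\<in>carrier M. \<forall>y\<in>carrier M. h (x \<oplus>\<^bsub>M\<^esub> y) = h x \<oplus>\<^bsub>N\<^esub> h y) \<and>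
     (\<forall>a\<in>carrier R. \<forall>x\<in>carrier M. h (a \<odot>\<^bsub>M\<^esub> x) = a \<odot>\<^bsub>N\<^esub> h x)}"

definition free_left_module :: "('a, 'b) ring_scheme \<Rightarrow> 'i set \<Rightarrow> ('a, 'i \<Rightarrow> 'a) module" where
  "free_left_module R I = \<lparr>
     carrier = {f \<in> I \<rightarrow>\<^sub>E carrier R. finite {i \<in> I. f i \<noteq> \<zero>\<^bsub>R\<^esub>}},
     monoid.mult = undefined, one = undefined,
     ring.zero = \<lambda>i\<in>I. \<zero>\<^bsub>R\<^esub>,
     add = \<lambda>f g. \<lambda>i\<in>I. f i \<oplus>\<^bsub>R\<^esub> g i,
     module.smult = \<lambda>a f. \<lambda>i\<in>I. a \<otimes>\<^bsub>R\<^esub> f i\<rparr>"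

text \<open>A projective module is a direct summand of a free module. It is then a direct summand of the
  free module on its own underlying set, so index sets \<open>I\<close> in the type of \<open>P\<close> suffice.\<close>

definition projective_left_module :: "('a, 'b) ring_scheme \<Rightarrow> ('a, 'p, 'c) module_scheme \<Rightarrow> bool" where
  "projective_left_module R P \<longleftrightarrow> left_module R P \<and>
     (\<exists>(I :: 'p set) j r. j \<in> left_module_hom R P (free_left_module R I) \<and>
        r \<in> left_module_hom R (free_left_module R I) P \<and>
        (\<forall>x\<in>carrier P. r (j x) = x))"

text \<open>A projective resolution
  \<open>\<dots> \<rightarrow> P\<^sub>2 \<rightarrow> P\<^sub>1 \<rightarrow> P\<^sub>0 \<rightarrow> M \<rightarrow> 0\<close> with differentials \<open>d i :: P\<^sub>i\<^sub>+\<^sub>1 \<rightarrow> P\<^sub>i\<close> and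
  augmentation \<open>e\<close>.\<close>

definition projective_resolution ::
  "('a, 'b) ring_scheme \<Rightarrow> ('a, 'm, 'c) module_scheme \<Rightarrow> (nat \<Rightarrow> ('a, 'p) module) \<Rightarrow>
     (nat \<Rightarrow> 'p \<Rightarrow> 'p) \<Rightarrow> ('p \<Rightarrow> 'm) \<Rightarrow> bool" where
  "projective_resolution R M P d e \<longleftrightarrow>
     (\<forall>i. projective_left_module R (P i)) \<and>
     (\<forall>i. d i \<in> left_module_hom R (P (Suc i)) (P i)) \<and>
     e \<in> left_module_hom R (P 0) M \<and>
     e ` carrier (P 0) = carrier M \<and>
     d 0 ` carrier (P 1) = {x \<in> carrier (P 0). e x = \<zero>\<^bsub>M\<^esub>} \<and>
     (\<forall>i. d (Suc i) ` carrier (P (Suc (Suc i))) = {x \<in> carrier (P (Suc i)). d i x = \<zero>\<^bsub>P i\<^esub>})"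

text \<open>The modules in the resolution have their elements in the type \<open>('m \<times> 'a) list\<close>. This is no
  restriction: this type is infinite and at least as large as \<open>M\<close> and \<open>R\<close>, so it has room for
  the free modules and syzygies of a free resolution of \<open>M\<close>, and by Schanuel's lemma the shortest
  length of a projective resolution is read off from any such resolution. The infimum over the
  empty set is \<open>\<infinity>\<close>.\<close>

definition projective_dimension :: "('a, 'b) ring_scheme \<Rightarrow> ('a, 'm) module \<Rightarrow> enat" where
  "projective_dimension R M =
     Inf {enat n | n. \<exists>(P :: nat \<Rightarrow> ('a, ('m \<times> 'a) list) module) d e.
       projective_resolution R M P d e \<and> (\<forall>i>n. carrier (P i) = {\<zero>\<^bsub>P i\<^esub>})}"

text \<open>The supremum of the projective dimensions of all left modules. A formula cannot quantify over
  types, so the modules range over those with elements in \<open>'m + 'a\<close>; the parameter \<open>'m\<close> is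
  to be left as a free type variable, so that a statement about
  \<open>left_global_dimension TYPE('m) R\<close> covers modules on every type. The summand \<open>'a\<close>
  makes room for all cyclic modules even if \<open>'m\<close> is small.\<close>

definition left_global_dimension :: "'m itself \<Rightarrow> ('a, 'b) ring_scheme \<Rightarrow> enat" where
  "left_global_dimension _ R =
     (SUP M\<in>{M :: ('a, 'm + 'a) module. left_module R M}. projective_dimension R M)"

definition opposite_ring :: "'a ring \<Rightarrow> 'a ring" where
  "opposite_ring R = R\<lparr>monoid.mult := \<lambda>a b. b \<otimes>\<^bsub>R\<^esub> a\<rparr>"

definition right_global_dimension :: "'m itself \<Rightarrow> 'a ring \<Rightarrow> enat" where
  "right_global_dimension t R = left_global_dimension t (opposite_ring R)"

end

theory Submission
  imports Defs "HOL-Library.Product_Plus" "HOL-Library.Nat_Bijection"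
begin

text \<open>
  Write \<open>S = \<complex>[z,X][Y,\<sigma>,\<delta>]\<close> with \<open>\<sigma> X = - X\<close> and \<open>\<delta> X = 2z\<close>, i.e. \<open>Y X = - X Y + 2z\<close>. For a vector
  space \<open>W\<close> with an involution \<open>Z\<close>, polynomials in \<open>z, X, Y\<close> with coefficients in \<open>W\<close> form a
  \<open>\<Lambda>\<^sub>c\<close>-module \<open>F W = S \<otimes> W\<close>. For \<open>W = \<complex>[Z]/(Z\<^sup>2 - 1)\<close> this gives a map from \<open>\<Lambda>\<^sub>c\<close> to \<open>F W\<close>; it is
  injective because the action of an element on any module factors through its image. Hence every
  element has a unique normal form \<open>\<Sum> c z\<^sup>i X\<^sup>j Y\<^sup>k Z\<^sup>l\<close>, from which the statements about the center,
  the basis and the skew group algebra are read off.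

  For a \<open>\<Lambda>\<^sub>c\<close>-module \<open>W\<close> let \<open>D\<^sub>X, D\<^sub>Y, D\<^sub>z\<close> be the \<open>S\<close>-linear maps \<open>s \<otimes> w \<mapsto> s X \<otimes> w - s \<otimes> X w\<close> etc. of
  \<open>F W\<close>, and \<open>E\<^sub>X, E\<^sub>Y\<close> those with a plus sign. As \<open>D\<^sub>X E\<^sub>Y + D\<^sub>Y E\<^sub>X = 2 D\<^sub>z\<close>, there is a complex
  \<open>0 \<rightarrow> F W \<rightarrow> (F W)\<^sup>3 \<rightarrow> (F W)\<^sup>3 \<rightarrow> F W \<rightarrow> W \<rightarrow> 0\<close> of Chevalley--Eilenberg type for the Heisenberg
  superalgebra \<open>[X,Y] = 2z\<close>. It is exact since all these maps are monic in one of the variables, and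
  its terms are projective by averaging over \<open>Z\<close>. So all projective dimensions are at most three.
  For the trivial module \<open>\<complex>\<close> the leftmost map takes values in the augmentation ideal, so it does not
  split and the projective dimension is three. Reversing words identifies \<open>\<Lambda>\<^sub>c\<close> with its opposite.
\<close>

section \<open>Polynomials in \<open>z, X, Y\<close> with vector coefficients\<close>

text \<open>Two obstacles shape the proof. The operator calculus wants coefficients in a type of
  class \<open>ab_group_add\<close>, while projective dimension speaks of modules on carriers inside
  a prescribed type. So a module becomes a retract \<open>pr\<close> of a space of finitely
  supported functions, and the terms of its resolution are coded as lists. This costs little,
  because the complex is natural in W: \<open>lift3 pr\<close> commutes with the boundaries, and
  exactness passes to the fixed points. The other obstacle is associativity. S is never made into a
  ring beforehand: left and right multiplications are separate operators whose commutation is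
  checked on coefficients. The final isomorphism is multiplicative because right multiplication is
  linear over the conifold algebra and a linear map is determined by the image of 1. In the normal
  form z^i X^j Y^k w the variable Y stands next to w, so it is evaluated first and divided out
  first.\<close>

text \<open>The variables of \<open>'w poly3\<close> are, from the innermost to the outermost, \<open>z\<close>, \<open>X\<close> and \<open>Y\<close>, and
  \<open>c3 f k j i\<close> is the coefficient \<open>w\<close> of \<open>z\<^sup>i X\<^sup>j Y\<^sup>k \<otimes> w\<close> in \<open>S \<otimes> W\<close>. The operators \<open>left_X\<close>, \<open>right_X\<close>,
  \<dots> below multiply the factor in \<open>S\<close> from the left and from the right, using
  \<open>Y X\<^sup>j = (-1)\<^sup>j X\<^sup>j Y + 2 z X\<^sup>j\<^sup>-\<^sup>1\<close> and \<open>Y\<^sup>k X = (-1)\<^sup>k X Y\<^sup>k + 2 z Y\<^sup>k\<^sup>-\<^sup>1\<close>, the last terms being absent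
  for even \<open>j\<close> and \<open>k\<close>.\<close>

type_synonym 'w poly3 = "'w poly poly poly"

definition c3 :: "'w::zero poly3 \<Rightarrow> nat \<Rightarrow> nat \<Rightarrow> nat \<Rightarrow> 'w" where
  "c3 f k j i = coeff (coeff (coeff f k) j) i"

lemma poly3_eqI: "(\<And>k j i. c3 f k j i = c3 g k j i) \<Longrightarrow> f = g"
  unfolding c3_def by (intro poly_eqI)

lemma c3_zero [simp]: "c3 0 k j i = 0"
  by (simp add: c3_def)

lemma c3_add [simp]: "c3 (f + g) k j i = c3 f k j i + c3 (g :: 'w::ab_group_add poly3) k j i"
  by (simp add: c3_def)

lemma c3_diff [simp]: "c3 (f - g) k j i = c3 f k j i - c3 (g :: 'w::ab_group_add poly3) k j i"
  by (simp add: c3_def)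

lemma c3_uminus [simp]: "c3 (- f) k j i = - c3 (f :: 'w::ab_group_add poly3) k j i"
  by (simp add: c3_def)

lemma c3_sum: "c3 (sum F A) k j i = (\<Sum>a\<in>A. c3 (F a :: 'w::ab_group_add poly3) k j i)"
  by (simp add: c3_def coeff_sum)

definition lift3 :: "('v::zero \<Rightarrow> 'w::zero) \<Rightarrow> 'v poly3 \<Rightarrow> 'w poly3" where
  "lift3 h = map_poly (map_poly (map_poly h))"

lemma c3_lift3: "h 0 = 0 \<Longrightarrow> c3 (lift3 h f) k j i = h (c3 f k j i)"
  by (simp add: c3_def lift3_def coeff_map_poly)

definition const3 :: "'w::zero \<Rightarrow> 'w poly3" where
  "const3 w = [:[:[:w:]:]:]"

lemma c3_const3: "c3 (const3 w) k j i = (if k = 0 \<and> j = 0 \<and> i = 0 then w else 0)"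
  by (auto simp: c3_def const3_def coeff_pCons split: nat.split)

text \<open>Substitution of minus the variable. On polynomials in X over the polynomials in z it is
  the automorphism \<open>\<sigma>\<close>; applied to the outer variable it yields the sign (-1)^k
  in Y^k X.\<close>

definition alternate :: "'a::ab_group_add poly \<Rightarrow> 'a poly" where
  "alternate p = Abs_poly (\<lambda>j. if even j then coeff p j else - coeff p j)"

lemma coeff_alternate: "coeff (alternate p) j = (if even j then coeff p j else - coeff p j)"
  unfolding alternate_def by (subst coeff_Abs_poly[where n = "degree p"]) (auto simp: coeff_eq_0)

text \<open>For \<open>t = twice_z\<close> this is \<open>\<delta>\<close>: the powers X^j with j
  even commute with Y, and each odd power contributes 2z X^(j-1).\<close>

definition odd_shift :: "('a::zero \<Rightarrow> 'a) \<Rightarrow> 'a poly \<Rightarrow> 'a poly" where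
  "odd_shift t p = Abs_poly (\<lambda>j. if even j then t (coeff p (Suc j)) else 0)"

lemma coeff_odd_shift:
  "t 0 = 0 \<Longrightarrow> coeff (odd_shift t p) j = (if even j then t (coeff p (Suc j)) else 0)"
  unfolding odd_shift_def by (subst coeff_Abs_poly[where n = "degree p"]) (auto simp: coeff_eq_0)

definition twice_z :: "'w::ab_group_add poly \<Rightarrow> 'w poly" where
  "twice_z p = pCons 0 (p + p)"

lemma twice_z_zero [simp]: "twice_z 0 = 0"
  by (simp add: twice_z_def)

definition left_z :: "'w::ab_group_add poly3 \<Rightarrow> 'w poly3" where
  "left_z = map_poly (map_poly (pCons 0))"

definition left_X :: "'w::ab_group_add poly3 \<Rightarrow> 'w poly3" where
  "left_X = map_poly (pCons 0)"

definition left_Y :: "'w::ab_group_add poly3 \<Rightarrow> 'w poly3" where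
  "left_Y f = pCons 0 (map_poly alternate f) + map_poly (odd_shift twice_z) f"

definition right_X :: "'w::ab_group_add poly3 \<Rightarrow> 'w poly3" where
  "right_X f = alternate (left_X f) + odd_shift (map_poly twice_z) f"

definition right_Y :: "'w::ab_group_add poly3 \<Rightarrow> 'w poly3" where
  "right_Y = pCons 0"

text \<open>The automorphism X -> -X, Y -> -Y, z -> z of S, which is conjugation by Z in the
  conifold algebra.\<close>

definition flip_XY :: "'w::ab_group_add poly3 \<Rightarrow> 'w poly3" where
  "flip_XY f = alternate (map_poly alternate f)"

lemma alternate_zero [simp]: "alternate 0 = 0"
  by (rule poly_eqI) (simp add: coeff_alternate)

lemma odd_shift_zero [simp]: "t 0 = 0 \<Longrightarrow> odd_shift t 0 = 0"
  by (rule poly_eqI) (simp add: coeff_odd_shift)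

lemma c3_left_z: "c3 (left_z f) k j i = (case i of 0 \<Rightarrow> 0 | Suc i' \<Rightarrow> c3 f k j i')"
  by (simp add: c3_def left_z_def coeff_map_poly coeff_pCons split: nat.split)

lemma c3_left_X: "c3 (left_X f) k j i = (case j of 0 \<Rightarrow> 0 | Suc j' \<Rightarrow> c3 f k j' i)"
  by (simp add: c3_def left_X_def coeff_map_poly coeff_pCons split: nat.split)

lemma c3_right_Y: "c3 (right_Y f) k j i = (case k of 0 \<Rightarrow> 0 | Suc k' \<Rightarrow> c3 f k' j i)"
  by (simp add: c3_def right_Y_def coeff_pCons split: nat.split)

lemma c3_left_Y: "c3 (left_Y f) k j i =
    (case k of 0 \<Rightarrow> 0 | Suc k' \<Rightarrow> if even j then c3 f k' j i else - c3 f k' j i) +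
    (if even j then case i of 0 \<Rightarrow> 0 | Suc i' \<Rightarrow> c3 f k (Suc j) i' + c3 f k (Suc j) i' else 0)"
  by (auto simp: c3_def left_Y_def coeff_map_poly coeff_pCons coeff_alternate coeff_odd_shift
      twice_z_def split: nat.split)

lemma c3_right_X: "c3 (right_X f) k j i =
    (case j of 0 \<Rightarrow> 0 | Suc j' \<Rightarrow> if even k then c3 f k j' i else - c3 f k j' i) +
    (if even k then case i of 0 \<Rightarrow> 0 | Suc i' \<Rightarrow> c3 f (Suc k) j i' + c3 f (Suc k) j i' else 0)"
  by (auto simp: c3_def right_X_def left_X_def coeff_map_poly coeff_pCons coeff_alternate
      coeff_odd_shift twice_z_def split: nat.split)

lemma c3_flip_XY: "c3 (flip_XY f) k j i = (if even (k + j) then c3 f k j i else - c3 f k j i)"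
  by (auto simp: c3_def flip_XY_def coeff_map_poly coeff_alternate)

lemmas c3_simps = c3_left_z c3_left_X c3_right_Y c3_left_Y c3_right_X c3_flip_XY

lemma ops_add:
  fixes f g :: "'w::ab_group_add poly3"
  shows left_z_add: "left_z (f + g) = left_z f + left_z g"
    and left_X_add: "left_X (f + g) = left_X f + left_X g"
    and left_Y_add: "left_Y (f + g) = left_Y f + left_Y g"
    and right_X_add: "right_X (f + g) = right_X f + right_X g"
    and right_Y_add: "right_Y (f + g) = right_Y f + right_Y g"
    and flip_XY_add: "flip_XY (f + g) = flip_XY f + flip_XY g"
  by (intro poly3_eqI; simp add: c3_simps algebra_simps split: nat.split)+

lemma ops_minus:
  fixes f :: "'w::ab_group_add poly3"
  shows left_X_minus: "left_X (- f) = - left_X f"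
    and left_Y_minus: "left_Y (- f) = - left_Y f"
  by (intro poly3_eqI; simp add: c3_simps algebra_simps split: nat.split)+

lemma ops_diff:
  fixes f g :: "'w::ab_group_add poly3"
  shows left_z_diff: "left_z (f - g) = left_z f - left_z g"
    and left_X_diff: "left_X (f - g) = left_X f - left_X g"
    and left_Y_diff: "left_Y (f - g) = left_Y f - left_Y g"
    and right_X_diff: "right_X (f - g) = right_X f - right_X g"
    and right_Y_diff: "right_Y (f - g) = right_Y f - right_Y g"
    and flip_XY_diff: "flip_XY (f - g) = flip_XY f - flip_XY g"
  by (intro poly3_eqI; simp add: c3_simps algebra_simps split: nat.split)+

text \<open>The left operators satisfy the relations of S, the right ones the opposite relations,
  and the two families commute (for \<open>right_X\<close> and \<open>left_Y\<close> see the next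
  lemma), which is the associativity of S. All is compared coefficient by coefficient, without a
  product on \<open>poly3\<close>.\<close>

lemma left_right_relations:
  fixes f :: "'w::ab_group_add poly3"
  shows left_YX: "left_Y (left_X f) = - left_X (left_Y f) + (left_z f + left_z f)"
    and left_Xz: "left_X (left_z f) = left_z (left_X f)"
    and left_Yz: "left_Y (left_z f) = left_z (left_Y f)"
    and left_YYX: "left_Y (left_Y (left_X f)) = left_X (left_Y (left_Y f))"
    and left_XXY: "left_X (left_X (left_Y f)) = left_Y (left_X (left_X f))"
    and flip_flip: "flip_XY (flip_XY f) = f"
    and flip_left_z: "flip_XY (left_z f) = left_z (flip_XY f)"
    and flip_left_X: "flip_XY (left_X f) = - left_X (flip_XY f)"
    and flip_left_Y: "flip_XY (left_Y f) = - left_Y (flip_XY f)"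
    and flip_right_X: "flip_XY (right_X f) = - right_X (flip_XY f)"
    and flip_right_Y: "flip_XY (right_Y f) = - right_Y (flip_XY f)"
    and right_X_left_z: "right_X (left_z f) = left_z (right_X f)"
    and right_Y_left_z: "right_Y (left_z f) = left_z (right_Y f)"
    and right_X_left_X: "right_X (left_X f) = left_X (right_X f)"
    and right_Y_left_X: "right_Y (left_X f) = left_X (right_Y f)"
    and right_Y_left_Y: "right_Y (left_Y f) = left_Y (right_Y f)"
    and right_XY: "right_X (right_Y f) = - right_Y (right_X f) + (left_z f + left_z f)"
  by (intro poly3_eqI; simp add: c3_simps algebra_simps split: nat.split)+

lemma right_X_left_Y: "right_X (left_Y f) = left_Y (right_X f)"
  by (intro poly3_eqI) (simp add: c3_simps algebra_simps split: nat.split)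

lemma lift3_ops:
  fixes f :: "'v::ab_group_add poly3" and h :: "'v \<Rightarrow> 'w::ab_group_add"
  assumes h: "additive h"
  shows lift3_left_z: "lift3 h (left_z f) = left_z (lift3 h f)"
    and lift3_left_X: "lift3 h (left_X f) = left_X (lift3 h f)"
    and lift3_left_Y: "lift3 h (left_Y f) = left_Y (lift3 h f)"
    and lift3_right_X: "lift3 h (right_X f) = right_X (lift3 h f)"
    and lift3_right_Y: "lift3 h (right_Y f) = right_Y (lift3 h f)"
    and lift3_flip: "lift3 h (flip_XY f) = flip_XY (lift3 h f)"
    and lift3_const: "lift3 h (const3 w) = const3 (h w)"
    and lift3_add: "lift3 h (f + g) = lift3 h f + lift3 h g"
    and lift3_zero: "lift3 h 0 = 0"
    and lift3_minus: "lift3 h (- f) = - lift3 h f"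
    and lift3_diff: "lift3 h (f - g) = lift3 h f - lift3 h g"
proof -
  note [simp] = additive.zero[OF h] additive.add[OF h] additive.diff[OF h] additive.minus[OF h]
  show "lift3 h (left_z f) = left_z (lift3 h f)" "lift3 h (left_X f) = left_X (lift3 h f)"
    "lift3 h (left_Y f) = left_Y (lift3 h f)" "lift3 h (right_X f) = right_X (lift3 h f)"
    "lift3 h (right_Y f) = right_Y (lift3 h f)" "lift3 h (flip_XY f) = flip_XY (lift3 h f)"
    "lift3 h (const3 w) = const3 (h w)" "lift3 h (f + g) = lift3 h f + lift3 h g" "lift3 h 0 = 0"
    "lift3 h (- f) = - lift3 h f" "lift3 h (f - g) = lift3 h f - lift3 h g"
    by (intro poly3_eqI; simp add: c3_simps c3_lift3 c3_const3 algebra_simps split: nat.split)+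
qed

lemma lift3_comp:
  "h 0 = 0 \<Longrightarrow> g 0 = 0 \<Longrightarrow> lift3 h (lift3 g f) = lift3 (\<lambda>w. h (g w)) f"
  by (intro poly3_eqI) (simp add: c3_lift3)

lemma lift3_id: "lift3 (\<lambda>w. w) f = f"
  by (intro poly3_eqI) (simp add: c3_lift3)

subsection \<open>Division by monic linear operators\<close>

lemma additive_map_poly:
  assumes "additive (h :: 'a::ab_group_add \<Rightarrow> 'b::ab_group_add)"
  shows "additive (map_poly h)"
  using additive.add[OF assms] additive.zero[OF assms]
  by (intro additive.intro poly_eqI) (simp add: coeff_map_poly)

text \<open>Division by the operator q -> T q - L q, monic of degree one in the variable T. The map
  L acts on coefficients and takes the place of the root, so the remainder is the value of p under T
  -> L.\<close>

lemma division_poly: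
  fixes p :: "'a::ab_group_add poly"
  assumes "additive L"
  obtains q r where "p = pCons 0 q - map_poly L q + [:r:]"
proof -
  note [simp] = additive.zero[OF assms] additive.add[OF assms]
  have "\<exists>q r. p = pCons 0 q - map_poly L q + [:r:]"
  proof (induction p)
    case 0
    show ?case by (intro exI[of _ 0]) simp
  next
    case (pCons a p)
    then obtain q r where p: "p = pCons 0 q - map_poly L q + [:r:]" by blast
    \<comment> \<open>Horner step: the quotient of a + T p is T q + r, its remainder a + L
      r.\<close>
    have "pCons a p = pCons 0 (pCons 0 q + [:r:]) - map_poly L (pCons 0 q + [:r:]) + [:a + L r:]"
      unfolding p by (intro poly_eqI) (auto simp: coeff_map_poly coeff_pCons split: nat.split)
    then show ?case by blast
  qed
  then show ?thesis using that by blast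
qed

text \<open>The leading coefficient of q survives in degree \<open>degree q + 1\<close>, so a
  constant value forces q = 0. With r = 0 this is injectivity.\<close>

lemma division_poly_unique:
  fixes q :: "'a::ab_group_add poly"
  assumes "additive L" and "pCons 0 q - map_poly L q = [:r:]"
  shows "q = 0"
proof (rule ccontr)
  assume "q \<noteq> 0"
  have "coeff (pCons 0 q - map_poly L q) (Suc (degree q)) = coeff q (degree q)"
    using additive.zero[OF assms(1)] by (simp add: coeff_map_poly coeff_eq_0)
  then show False
    using assms(2) \<open>q \<noteq> 0\<close> by simp
qed

section \<open>Modules given by operators\<close>

text \<open>A module over the group algebra of {1, Z}, given by operators on a whole type, so that
  polynomials with coefficients in it form a type again.\<close>

locale sign_module =
  fixes sc :: "complex \<Rightarrow> 'w::ab_group_add \<Rightarrow> 'w" and Zo :: "'w \<Rightarrow> 'w"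
  assumes additive_sc: "additive (sc c)"
    and sc_add_left: "sc (a + b) w = sc a w + sc b w"
    and sc_mult: "sc (a * b) w = sc a (sc b w)"
    and sc_one: "sc 1 w = w"
    and additive_Z: "additive Zo"
    and Z_sc: "Zo (sc c w) = sc c (Zo w)"
    and Z_Z: "Zo (Zo w) = w"
begin

lemmas sc_add = additive.add[OF additive_sc]
lemmas sc_zero = additive.zero[OF additive_sc]
lemmas sc_minus = additive.minus[OF additive_sc]
lemmas sc_diff = additive.diff[OF additive_sc]
lemmas sc_sum = additive.sum[OF additive_sc]
lemmas Z_add = additive.add[OF additive_Z]
lemmas Z_zero = additive.zero[OF additive_Z]
lemmas Z_minus = additive.minus[OF additive_Z]

lemma sc_zero_left: "sc 0 w = 0"
  using sc_add_left[of 0 0 w] by simp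

lemma sc_half: "sc (1/2) w + sc (1/2) w = w"
  using sc_add_left[of "1/2" "1/2" w] by (simp add: sc_one)

lemma sign_module_uminus: "sign_module sc (\<lambda>w. - Zo w)"
  using additive_sc sc_add_left sc_mult sc_one
  by unfold_locales (auto simp: Z_add Z_sc sc_minus Z_minus Z_Z additive_def)

end

locale conifold_module = sign_module sc Zo
  for sc :: "complex \<Rightarrow> 'w::ab_group_add \<Rightarrow> 'w" and Zo :: "'w \<Rightarrow> 'w" +
  fixes Xo Yo :: "'w \<Rightarrow> 'w"
  assumes additive_X: "additive Xo" and additive_Y: "additive Yo"
    and X_sc: "Xo (sc c w) = sc c (Xo w)"
    and Y_sc: "Yo (sc c w) = sc c (Yo w)"
    and X_Z: "Xo (Zo w) = - Zo (Xo w)"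
    and Y_Z: "Yo (Zo w) = - Zo (Yo w)"
    and XXY: "Xo (Xo (Yo w)) = Yo (Xo (Xo w))"
    and YYX: "Yo (Yo (Xo w)) = Xo (Yo (Yo w))"
begin

lemmas X_add = additive.add[OF additive_X]
lemmas X_zero = additive.zero[OF additive_X]
lemmas X_minus = additive.minus[OF additive_X]
lemmas X_diff = additive.diff[OF additive_X]
lemmas Y_add = additive.add[OF additive_Y]
lemmas Y_zero = additive.zero[OF additive_Y]
lemmas Y_minus = additive.minus[OF additive_Y]
lemmas Y_diff = additive.diff[OF additive_Y]

definition zop :: "'w \<Rightarrow> 'w" where
  "zop w = sc (1/2) (Xo (Yo w) + Yo (Xo w))"

lemma additive_zop: "additive zop"
  by (intro additive.intro) (simp add: zop_def X_add Y_add sc_add algebra_simps)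

lemma zop_double: "zop w + zop w = Xo (Yo w) + Yo (Xo w)"
  by (simp add: zop_def sc_half)

lemma zop_X: "zop (Xo w) = Xo (zop w)"
  by (simp add: zop_def X_add X_sc XXY algebra_simps)

lemma zop_Y: "zop (Yo w) = Yo (zop w)"
  by (simp add: zop_def Y_add Y_sc YYX algebra_simps)

lemma zop_Z: "zop (Zo w) = Zo (zop w)"
  by (simp add: zop_def Z_add Z_sc X_Z Y_Z X_minus Y_minus)

lemma zop_sc: "zop (sc c w) = sc c (zop w)"
  by (simp add: zop_def X_sc Y_sc flip: sc_add sc_mult)

end

context sign_module
begin

abbreviation sc3 :: "complex \<Rightarrow> 'w poly3 \<Rightarrow> 'w poly3" where
  "sc3 c \<equiv> lift3 (sc c)"

abbreviation Z3 :: "'w poly3 \<Rightarrow> 'w poly3" where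
  "Z3 f \<equiv> flip_XY (lift3 Zo f)"

text \<open>Z acts diagonally on S \<otimes> W, by \<open>flip_XY\<close> on S and by
  \<open>Zo\<close> on W, while X and Y act on the factor S alone: this is the induction of modules
  from the group algebra of {1, Z}.\<close>

lemma induced_module: "conifold_module sc3 Z3 left_X left_Y"
proof
  show "sc3 (a + b) w = sc3 a w + sc3 b w" for a b w
    by (rule poly3_eqI) (simp add: c3_lift3 sc_zero sc_add_left)
  show "sc3 (a * b) w = sc3 a (sc3 b w)" for a b w
    by (rule poly3_eqI) (simp add: c3_lift3 sc_zero sc_mult)
  show "sc3 1 w = w" for w
    by (rule poly3_eqI) (simp add: c3_lift3 sc_zero sc_one)
  show "Z3 (sc3 c w) = sc3 c (Z3 w)" for c w
    by (rule poly3_eqI) (simp add: c3_lift3 sc_zero Z_zero Z_sc c3_flip_XY sc_minus)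
  show "Z3 (Z3 w) = w" for w
    by (rule poly3_eqI) (simp add: c3_lift3 Z_zero Z_Z c3_flip_XY Z_minus)
qed (simp_all add: lift3_ops[OF additive_sc] lift3_ops[OF additive_Z] flip_left_X flip_left_Y
      flip_XY_add left_X_add left_Y_add left_YYX left_XXY left_X_minus left_Y_minus)

end

section \<open>The action of the free algebra and of its conifold ideal\<close>

definition word_act :: "('w \<Rightarrow> 'w) \<Rightarrow> ('w \<Rightarrow> 'w) \<Rightarrow> ('w \<Rightarrow> 'w) \<Rightarrow> generator list \<Rightarrow> 'w \<Rightarrow> 'w" where
  "word_act Xo Yo Zo us w = foldr (case_generator Xo Yo Zo) us w"

definition free_act ::
  "(complex \<Rightarrow> 'w::ab_group_add \<Rightarrow> 'w) \<Rightarrow> ('w \<Rightarrow> 'w) \<Rightarrow> ('w \<Rightarrow> 'w) \<Rightarrow> ('w \<Rightarrow> 'w) \<Rightarrow> free_alg \<Rightarrow> 'w \<Rightarrow> 'w"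
  where "free_act sc Zo Xo Yo p w =
    (\<Sum>u\<in>Poly_Mapping.keys p. sc (Poly_Mapping.lookup p u) (word_act Xo Yo Zo (letters u) w))"

lemma sum_keys_add:
  fixes g :: "'k \<Rightarrow> 'c::ab_group_add \<Rightarrow> 'b::ab_group_add"
  assumes "\<And>u. additive (g u)"
  shows "(\<Sum>u\<in>Poly_Mapping.keys (p + q). g u (Poly_Mapping.lookup (p + q) u)) =
    (\<Sum>u\<in>Poly_Mapping.keys p. g u (Poly_Mapping.lookup p u)) +
    (\<Sum>u\<in>Poly_Mapping.keys q. g u (Poly_Mapping.lookup q u))"
proof -
  let ?K = "Poly_Mapping.keys p \<union> Poly_Mapping.keys q"
  have ext: "(\<Sum>u\<in>Poly_Mapping.keys r. g u (Poly_Mapping.lookup r u)) =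
      (\<Sum>u\<in>?K. g u (Poly_Mapping.lookup r u))" if "Poly_Mapping.keys r \<subseteq> ?K" for r
    using that by (intro sum.mono_neutral_left) (auto simp: in_keys_iff additive.zero[OF assms])
  show ?thesis
    using ext[of p] ext[of q] ext[of "p + q", OF keys_add]
    by (simp add: lookup_add additive.add[OF assms] sum.distrib)
qed

lemma poly_mapping_eq_sum_single:
  "(p :: 'k \<Rightarrow>\<^sub>0 'c::comm_monoid_add) =
    (\<Sum>u\<in>Poly_Mapping.keys p. Poly_Mapping.single u (Poly_Mapping.lookup p u))"
proof (rule poly_mapping_eqI)
  fix k
  show "Poly_Mapping.lookup p k = Poly_Mapping.lookup
      (\<Sum>u\<in>Poly_Mapping.keys p. Poly_Mapping.single u (Poly_Mapping.lookup p u)) k"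
    by (cases "k \<in> Poly_Mapping.keys p")
      (auto simp: lookup_sum lookup_single when_def sum.delta in_keys_iff)
qed

lemma additive_eqI_single:
  fixes f g :: "('k \<Rightarrow>\<^sub>0 'c::ab_group_add) \<Rightarrow> 'b::ab_group_add"
  assumes "additive f" "additive g"
    and "\<And>u c. f (Poly_Mapping.single u c) = g (Poly_Mapping.single u c)"
  shows "f p = g p"
  using arg_cong[OF poly_mapping_eq_sum_single, of f p] arg_cong[OF poly_mapping_eq_sum_single, of g p]
  by (simp add: additive.sum[OF assms(1)] additive.sum[OF assms(2)] assms(3))

context conifold_module
begin

abbreviation "word_op \<equiv> word_act Xo Yo Zo"
abbreviation "free_op \<equiv> free_act sc Zo Xo Yo"

lemma generator_op:
  "additive (case_generator Xo Yo Zo g)" "case_generator Xo Yo Zo g (sc c w) = sc c (case_generator Xo Yo Zo g w)"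
  by (cases g; simp add: additive_X additive_Y additive_Z X_sc Y_sc Z_sc)+

lemma word_op_append: "word_op (us @ vs) w = word_op us (word_op vs w)"
  by (simp add: word_act_def)

lemma additive_word_op: "additive (word_op us)"
  by (induction us) (auto simp: word_act_def additive_def additive.add[OF generator_op(1)])

lemma word_op_sc: "word_op us (sc c w) = sc c (word_op us w)"
  by (induction us) (auto simp: word_act_def generator_op(2))

lemma free_op_add: "free_op (p + q) w = free_op p w + free_op q w"
  unfolding free_act_def by (rule sum_keys_add) (simp add: additive_def sc_add_left)

lemma free_op_additive_left: "additive (\<lambda>p. free_op p w)"
  by (simp add: additive_def free_op_add)

lemmas free_op_zero = additive.zero[OF free_op_additive_left]
lemmas free_op_diff = additive.diff[OF free_op_additive_left]

lemma free_op_single: "free_op (Poly_Mapping.single u c) w = sc c (word_op (letters u) w)"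
  by (simp add: free_act_def sc_zero_left)

lemma additive_free_op: "additive (free_op p)"
  by (auto simp: additive_def free_act_def sum.distrib sc_add additive.add[OF additive_word_op])

lemmas free_op_add_right = additive.add[OF additive_free_op]
lemmas free_op_zero_right = additive.zero[OF additive_free_op]
lemma free_op_mult: "free_op (p * q) w = free_op p (free_op q w)"
proof -
  have single: "free_op (Poly_Mapping.single u c * Poly_Mapping.single v d) w =
      free_op (Poly_Mapping.single u c) (free_op (Poly_Mapping.single v d) w)" for u c v d
    unfolding mult_single free_op_single word_op_sc sc_mult
    by (simp add: plus_word_def word_op_append)
  have "free_op (Poly_Mapping.single u c * q) w = free_op (Poly_Mapping.single u c) (free_op q w)"
    for u c
    by (rule additive_eqI_single[where p = q and f = "\<lambda>q. free_op (Poly_Mapping.single u c * q) w"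
          and g = "\<lambda>q. free_op (Poly_Mapping.single u c) (free_op q w)"])
      (unfold additive_def distrib_left free_op_add free_op_add_right single, simp_all)
  then show ?thesis
    by (intro additive_eqI_single[where p = p and f = "\<lambda>p. free_op (p * q) w"
          and g = "\<lambda>p. free_op p (free_op q w)"])
      (unfold additive_def distrib_right free_op_add, simp_all)
qed

lemma free_op_scalar: "free_op (Poly_Mapping.single 0 c) w = sc c w"
  by (simp add: free_op_single zero_word_def word_act_def)

lemma free_op_one: "free_op 1 w = w"
  using free_op_scalar[of 1 w] by (simp add: sc_one)

lemma free_op_X: "free_op free_X w = Xo w"
  and free_op_Y: "free_op free_Y w = Yo w"
  and free_op_Z: "free_op free_Z w = Zo w"
  by (simp_all add: free_X_def free_Y_def free_Z_def free_op_single word_act_def sc_one)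

lemmas free_op_simps = free_op_add free_op_diff free_op_mult free_op_one free_op_scalar
  free_op_X free_op_Y free_op_Z free_op_zero

end

lemma ring_free_alg: "ring (ring_of_type_algebra :: 'a::ring_1 ring)"
proof -
  have "\<exists>y. x + y = 0" for x :: 'a
    using add.right_inverse by blast
  then show ?thesis
    unfolding ring_of_type_algebra_def using add.right_inverse
    by unfold_locales (auto simp: algebra_simps Units_def)
qed

interpretation free_ring: ring "ring_of_type_algebra :: free_alg ring"
  by (rule ring_free_alg)

lemma ideal_conifold: "ideal conifold_ideal ring_of_type_algebra"
  unfolding conifold_ideal_def
  by (rule free_ring.genideal_ideal) (simp add: ring_of_type_algebra_def)

lemma minus_ring_of_type_algebra: "\<ominus>\<^bsub>ring_of_type_algebra\<^esub> (x :: 'a::ring_1) = - x"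
proof -
  interpret ring "ring_of_type_algebra :: 'a ring" by (rule ring_free_alg)
  show ?thesis
    by (rule minus_equality) (simp_all add: ring_of_type_algebra_def)
qed

lemma ideal_of_type_algebraI:
  fixes I :: "'a::ring_1 set"
  assumes "0 \<in> I" "\<And>a b. a \<in> I \<Longrightarrow> b \<in> I \<Longrightarrow> a + b \<in> I"
    and "\<And>a r. a \<in> I \<Longrightarrow> r * a \<in> I" "\<And>a r. a \<in> I \<Longrightarrow> a * r \<in> I"
  shows "ideal I ring_of_type_algebra"
proof -
  interpret ring "ring_of_type_algebra :: 'a ring" by (rule ring_free_alg)
  have minus: "- a \<in> I" if "a \<in> I" for a
    using assms(3)[OF that, of "- 1"] by simp
  show ?thesis
  proof (intro idealI ring_free_alg)
    show "subgroup I (add_monoid ring_of_type_algebra)"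
    proof (intro group.subgroupI add.group_axioms)
      fix a assume "a \<in> I"
      then show "inv\<^bsub>add_monoid ring_of_type_algebra\<^esub> a \<in> I"
        using minus[of a] minus_ring_of_type_algebra[of a] by (simp add: a_inv_def)
    qed (use assms(1,2) in \<open>auto simp: ring_of_type_algebra_def\<close>)
  qed (use assms in \<open>auto simp: ring_of_type_algebra_def\<close>)
qed

context conifold_module
begin

text \<open>The elements that kill every vector form a two-sided ideal, closed under right multiples
  because all vectors are killed at once, and the relations lie in it.\<close>

lemma free_op_ideal: "p \<in> conifold_ideal \<Longrightarrow> free_op p w = 0"
proof -
  let ?I = "{p. \<forall>w. free_op p w = 0}"
  have "ideal ?I ring_of_type_algebra"
    by (rule ideal_of_type_algebraI) (simp_all add: free_op_simps free_op_zero_right)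
  moreover have "conifold_relations \<subseteq> ?I"
    by (auto simp: conifold_relations_def free_op_simps power2_eq_square commutator_def
        X_Z Y_Z XXY YYX Z_Z)
  ultimately have "conifold_ideal \<subseteq> ?I"
    unfolding conifold_ideal_def by (rule free_ring.genideal_minimal)
  then show "p \<in> conifold_ideal \<Longrightarrow> free_op p w = 0" by blast
qed

end

locale conifold_hom =
  A: conifold_module sc Zo Xo Yo + B: conifold_module sc' Zo' Xo' Yo'
  for sc :: "complex \<Rightarrow> 'v::ab_group_add \<Rightarrow> 'v" and Zo Xo Yo
    and sc' :: "complex \<Rightarrow> 'w::ab_group_add \<Rightarrow> 'w" and Zo' Xo' Yo' +
  fixes h :: "'v \<Rightarrow> 'w"
  assumes additive_hom: "additive h"
    and hom_sc: "h (sc c v) = sc' c (h v)"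
    and hom_Z: "h (Zo v) = Zo' (h v)"
    and hom_X: "h (Xo v) = Xo' (h v)"
    and hom_Y: "h (Yo v) = Yo' (h v)"
begin

lemma hom_word_op: "h (A.word_op us v) = B.word_op us (h v)"
proof (induction us)
  case (Cons g us)
  then show ?case
    by (cases g) (simp_all add: word_act_def hom_X hom_Y hom_Z)
qed (simp add: word_act_def)

lemma hom_free_op: "h (A.free_op p v) = B.free_op p (h v)"
  by (simp add: free_act_def additive.sum[OF additive_hom] hom_sc hom_word_op)

end

text \<open>Functoriality of W -> S \<otimes> W for linear maps that commute with Z.\<close>

lemma lift3_hom:
  assumes V: "sign_module scV ZV" and W: "sign_module scW ZW"
    and h: "additive h" "\<And>c v. h (scV c v) = scW c (h v)" "\<And>v. h (ZV v) = ZW (h v)"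
  shows "conifold_hom (\<lambda>c. lift3 (scV c)) (\<lambda>f. flip_XY (lift3 ZV f)) left_X left_Y
    (\<lambda>c. lift3 (scW c)) (\<lambda>f. flip_XY (lift3 ZW f)) left_X left_Y (lift3 h)"
proof -
  interpret V: sign_module scV ZV by (rule V)
  interpret W: sign_module scW ZW by (rule W)
  interpret A: conifold_module V.sc3 V.Z3 left_X left_Y by (rule V.induced_module)
  interpret B: conifold_module W.sc3 W.Z3 left_X left_Y by (rule W.induced_module)
  show ?thesis
    by unfold_locales (simp_all add: additive_def lift3_ops[OF h(1)] lift3_comp V.sc_zero W.sc_zero
        V.Z_zero W.Z_zero additive.zero[OF h(1)] h(2,3))
qed

section \<open>Monomials and left linear maps\<close>

definition mono3 :: "'w::zero \<Rightarrow> nat \<Rightarrow> nat \<Rightarrow> nat \<Rightarrow> 'w poly3" where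
  "mono3 w k j i = Polynomial.monom (Polynomial.monom (Polynomial.monom w i) j) k"

lemma c3_mono3: "c3 (mono3 w k j i) k' j' i' = (if k' = k \<and> j' = j \<and> i' = i then w else 0)"
  by (auto simp: c3_def mono3_def)

lemma const3_eq_mono3: "const3 w = mono3 w 0 0 0"
  by (rule poly3_eqI) (auto simp: c3_mono3 c3_const3)

lemma mono3_rec:
  shows left_Y_mono3: "left_Y (mono3 w k 0 0) = mono3 w (Suc k) 0 0"
    and left_X_mono3: "left_X (mono3 w k j i) = mono3 w k (Suc j) i"
    and left_z_mono3: "left_z (mono3 w k j i) = mono3 w k j (Suc i)"
  by (rule poly3_eqI; auto simp: c3_simps c3_mono3 split: nat.split)+

text \<open>Y is applied first, while no X is present, so that its left multiplication is a plain
  shift without signs or correction terms.\<close>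

lemma mono3_eq_funpow: "mono3 w k j i = (left_z ^^ i) ((left_X ^^ j) ((left_Y ^^ k) (const3 w)))"
proof -
  have "(left_Y ^^ k) (const3 w) = mono3 w k 0 0"
    by (induction k) (simp_all add: const3_eq_mono3 left_Y_mono3)
  moreover have "(left_X ^^ j) (mono3 w k 0 0) = mono3 w k j 0"
    by (induction j) (simp_all add: left_X_mono3)
  moreover have "(left_z ^^ i) (mono3 w k j 0) = mono3 w k j i"
    by (induction i) (simp_all add: left_z_mono3)
  ultimately show ?thesis by simp
qed

lemma poly3_mono_induct:
  fixes f :: "'w::ab_group_add poly3"
  assumes "\<And>w k j i. P (mono3 w k j i)" "\<And>f g. P f \<Longrightarrow> P g \<Longrightarrow> P (f + g)"
  shows "P f"
proof -
  have P0: "P 0"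
    using assms(1)[of 0 0 0 0] by (simp add: mono3_def)
  have sum: "P (sum F A)" if "\<And>a. P (F a)" for F :: "nat \<Rightarrow> 'w poly3" and A
    using that by (induction A rule: infinite_finite_induct) (auto intro: P0 assms(2))
  have 1: "P (Polynomial.monom (Polynomial.monom p j) k)" for p j k
  proof -
    have "Polynomial.monom (Polynomial.monom p j) k = (\<Sum>i\<le>degree p. mono3 (coeff p i) k j i)"
      by (subst poly_as_sum_of_monoms[of p, symmetric])
        (simp add: mono3_def additive.sum[of "\<lambda>p. Polynomial.monom (Polynomial.monom p j) k"]
          additive_def add_monom)
    then show ?thesis by (simp add: sum assms(1))
  qed
  have 2: "P (Polynomial.monom p k)" for p k
  proof -
    have "Polynomial.monom p k =
        (\<Sum>i\<le>degree p. Polynomial.monom (Polynomial.monom (coeff p i) i) k)"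
      by (subst poly_as_sum_of_monoms[of p, symmetric])
        (simp add: additive.sum[of "\<lambda>p. Polynomial.monom p k"] additive_def add_monom)
    then show ?thesis by (simp add: sum 1)
  qed
  show ?thesis
    using sum[OF 2, of "coeff f" "\<lambda>i. i" "{..degree f}"] by (simp add: poly_as_sum_of_monoms)
qed

text \<open>The constants generate S \<otimes> W under X, Y and z, so an additive map that
  intertwines these with given operators on the target is known from its values there.\<close>

lemma left_linear_eqI:
  fixes h h' :: "'w::ab_group_add poly3 \<Rightarrow> 'v::ab_group_add"
  assumes add: "additive h" "additive h'"
    and H: "\<And>f. h (left_X f) = TX (h f)" "\<And>f. h (left_Y f) = TY (h f)"
      "\<And>f. h (left_z f) = Tz (h f)"
    and H': "\<And>f. h' (left_X f) = TX (h' f)" "\<And>f. h' (left_Y f) = TY (h' f)"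
      "\<And>f. h' (left_z f) = Tz (h' f)"
    and const: "\<And>w. h (const3 w) = h' (const3 w)"
  shows "h f = h' f"
proof (induction f rule: poly3_mono_induct)
  case (1 w k j i)
  have *: "h ((T ^^ n) g) = h' ((T ^^ n) g)"
    if "h g = h' g" "\<And>f. h (T f) = T' (h f)" "\<And>f. h' (T f) = T' (h' f)" for T T' n g
    by (induction n) (simp_all add: that)
  show ?case
    unfolding mono3_eq_funpow
    by (intro *[OF _ H(3) H'(3)] *[OF _ H(1) H'(1)] *[OF _ H(2) H'(2)] const)
next
  case (2 f g)
  then show ?case
    by (simp add: additive.add[OF add(1)] additive.add[OF add(2)])
qed

section \<open>The resolution\<close>

text \<open>The sum of L^n applied to the n-th coefficient: the variable is replaced by an operator
  on the coefficients.\<close>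

definition horner :: "('a::ab_group_add \<Rightarrow> 'a) \<Rightarrow> 'a poly \<Rightarrow> 'a" where
  "horner L p = fold_coeffs (\<lambda>a b. a + L b) p 0"

lemma horner_0 [simp]: "horner L 0 = 0"
  by (simp add: horner_def)

lemma horner_pCons: "additive L \<Longrightarrow> horner L (pCons a p) = a + L (horner L p)"
  by (cases "p = 0"; cases "a = 0") (simp_all add: horner_def additive.zero)

lemma horner_add:
  assumes "additive L" shows "horner L (p + q) = horner L p + horner L q"
  by (induction p q rule: poly_induct2)
    (simp_all add: horner_pCons assms additive.add[OF assms])

lemma additive_horner: "additive L \<Longrightarrow> additive (horner L)"
  by (simp add: additive_def horner_add)

lemma horner_map_poly:
  assumes L: "additive L" "additive L'" and h: "additive h" "\<And>a. h (L a) = L' (h a)"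
  shows "horner L' (map_poly h p) = h (horner L p)"
  by (induction p) (simp_all add: horner_pCons L map_poly_pCons h additive.zero[OF h(1)]
      additive.add[OF h(1)])

lemma alternate_pCons: "alternate (pCons a p) = pCons a (- alternate p)"
  by (rule poly_eqI) (auto simp: coeff_alternate coeff_pCons split: nat.split)

text \<open>If h anticommutes with L, moving h in front of L^n costs the sign (-1)^n that
  \<open>alternate\<close> puts in.\<close>

lemma horner_alternate:
  assumes L: "additive L" and h: "additive h" "\<And>a. L (h a) = - h (L a)"
  shows "horner L (alternate (map_poly h p)) = h (horner L p)"
proof (induction p)
  case (pCons a p)
  then show ?case
    by (simp add: horner_pCons L map_poly_pCons additive.zero[OF h(1)] additive.add[OF h(1)]
        alternate_pCons additive.minus[OF additive_horner[OF L]] additive.minus[OF L] h(2))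
qed (simp add: additive.zero[OF h(1)])

text \<open>For \<open>t = twice_z\<close> this is the twisted Leibniz rule for a + X p, with
  \<open>\<delta>\<close> a = 0, \<open>\<delta>\<close> X = 2z and \<open>\<sigma>\<close> X = -
  X.\<close>

lemma odd_shift_pCons:
  assumes "additive t"
  shows "odd_shift t (pCons a p) = map_poly t p - pCons 0 (odd_shift t p)"
  using additive.zero[OF assms]
  by (intro poly_eqI) (auto simp: coeff_odd_shift coeff_map_poly coeff_pCons split: nat.split)

lemma additive_twice_z: "additive twice_z"
  by (auto simp: additive_def twice_z_def intro!: poly_eqI simp: coeff_pCons algebra_simps split: nat.split)

lemma additive_pCons_0: "additive (pCons (0::'a::ab_group_add))"
  by (simp add: additive_def)

lemma additive_alternate: "additive alternate"
  by (auto simp: additive_def intro!: poly_eqI simp: coeff_alternate)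

lemma additive_odd_shift: "additive t \<Longrightarrow> additive (odd_shift t)"
  by (auto simp: additive_def intro!: poly_eqI simp: coeff_odd_shift additive.zero additive_def)

lemma map_poly_alternate: "additive h \<Longrightarrow> map_poly h (alternate p) = alternate (map_poly h p)"
  by (rule poly_eqI) (simp add: coeff_map_poly coeff_alternate additive.zero additive.minus)

lemma map_poly_odd_shift:
  assumes "additive h" "additive t" "\<And>a. h (t a) = t (h a)"
  shows "map_poly h (odd_shift t p) = odd_shift t (map_poly h p)"
  by (rule poly_eqI) (simp add: coeff_map_poly coeff_odd_shift assms additive.zero[OF assms(1)]
      additive.zero[OF assms(2)])

lemma map_poly_pCons_0: "additive h \<Longrightarrow> map_poly h (pCons 0 p) = pCons 0 (map_poly h p)"
  by (simp add: map_poly_pCons additive.zero)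

lemma map_poly_twice_z: "additive h \<Longrightarrow> map_poly h (twice_z p) = twice_z (map_poly h p)"
  by (simp add: twice_z_def map_poly_pCons_0 additive.add[OF additive_map_poly])

context conifold_module
begin

interpretation F: conifold_module sc3 Z3 left_X left_Y
  by (rule induced_module)

text \<open>This map and the next two compose to the action map from S \<otimes> W to W. The
  outermost variable is evaluated first, because in z^i X^j Y^k w it is Y^k that acts on w
  first.\<close>

definition aug_Y :: "'w poly3 \<Rightarrow> 'w poly poly" where
  "aug_Y = horner (map_poly (map_poly Yo))"

definition aug_X :: "'w poly poly \<Rightarrow> 'w poly" where
  "aug_X = horner (map_poly Xo)"

definition aug_z :: "'w poly \<Rightarrow> 'w" where
  "aug_z = horner zop"

definition aug :: "'w poly3 \<Rightarrow> 'w" where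
  "aug f = aug_z (aug_X (aug_Y f))"

lemmas additive_ops = additive_sc additive_X additive_Y additive_Z additive_zop

lemma additive_coeff_ops:
  "additive (map_poly Yo)" "additive (map_poly (map_poly Yo))" "additive (map_poly Xo)"
  "additive (map_poly Zo)" "additive (map_poly (map_poly Zo))"
  "additive (map_poly (sc c))" "additive (map_poly (map_poly (sc c)))"
  by (intro additive_map_poly additive_ops)+

lemma additive_aug: "additive aug" "additive aug_Y" "additive aug_X" "additive aug_z"
proof -
  show *: "additive aug_Y" "additive aug_X" "additive aug_z"
    unfolding aug_Y_def aug_X_def aug_z_def by (intro additive_horner additive_coeff_ops additive_ops)+
  show "additive aug"
    unfolding aug_def by (rule additive.intro) (simp add: *[THEN additive.add])
qed

lemma aug_Y_map:
  assumes "additive h" "\<And>p. h (map_poly (map_poly Yo) p) = map_poly (map_poly Yo) (h p)"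
  shows "aug_Y (map_poly h f) = h (aug_Y f)"
  unfolding aug_Y_def by (intro horner_map_poly additive_coeff_ops assms)

lemma aug_X_map:
  assumes "additive h" "\<And>p. h (map_poly Xo p) = map_poly Xo (h p)"
  shows "aug_X (map_poly h f) = h (aug_X f)"
  unfolding aug_X_def by (intro horner_map_poly additive_coeff_ops assms)

lemma aug_z_map:
  assumes "additive h" "\<And>p. h (zop p) = zop (h p)"
  shows "aug_z (map_poly h f) = h (aug_z f)"
  unfolding aug_z_def by (intro horner_map_poly additive_ops assms)

text \<open>Naturality of the action map; it is applied to scalars and later to the projection onto
  a direct summand.\<close>

lemma aug_coeffwise:
  assumes h: "additive h" and com: "\<And>w. h (Yo w) = Yo (h w)" "\<And>w. h (Xo w) = Xo (h w)"
    "\<And>w. h (zop w) = zop (h w)"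
  shows "aug (lift3 h f) = h (aug f)"
proof -
  have h0: "h 0 = 0" by (rule additive.zero[OF h])
  have 1: "map_poly h (map_poly Yo p) = map_poly Yo (map_poly h p)" for p
    by (rule poly_eqI) (simp add: coeff_map_poly h0 Y_zero com)
  have 2: "map_poly h (map_poly Xo p) = map_poly Xo (map_poly h p)" for p
    by (rule poly_eqI) (simp add: coeff_map_poly h0 X_zero com)
  have 3: "map_poly (map_poly h) (map_poly (map_poly Yo) p) =
      map_poly (map_poly Yo) (map_poly (map_poly h) p)" for p
    by (rule poly_eqI) (simp add: coeff_map_poly 1)
  show ?thesis
    unfolding aug_def lift3_def
    by (subst aug_Y_map[OF additive_map_poly[OF additive_map_poly[OF h]] 3],
        subst aug_X_map[OF additive_map_poly[OF h] 2], rule aug_z_map[OF h com(3)])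
qed

lemma aug_sc: "aug (sc3 c f) = sc c (aug f)"
  by (rule aug_coeffwise) (simp_all add: additive_sc X_sc Y_sc zop_sc)

lemma aug_left_X: "aug (left_X f) = Xo (aug f)"
proof -
  have "aug_Y (left_X f) = pCons 0 (aug_Y f)"
    unfolding left_X_def
    by (rule aug_Y_map) (simp_all add: additive_coeff_ops additive_pCons_0 map_poly_pCons_0)
  then show ?thesis
    by (simp add: aug_def aug_X_def horner_pCons additive_coeff_ops
        aug_z_map additive_ops zop_X)
qed

lemma aug_left_z: "aug (left_z f) = zop (aug f)"
proof -
  have 1: "pCons 0 (map_poly Yo p) = map_poly Yo (pCons 0 p)"
    "pCons 0 (map_poly Xo p) = map_poly Xo (pCons 0 p)" for p
    by (simp_all add: map_poly_pCons_0 additive_ops)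
  have "map_poly (pCons 0) (map_poly (map_poly Yo) p) = map_poly (map_poly Yo) (map_poly (pCons 0) p)" for p
    by (rule poly_eqI) (simp add: coeff_map_poly 1)
  then have "aug_Y (left_z f) = map_poly (pCons 0) (aug_Y f)"
    unfolding left_z_def
    by (intro aug_Y_map) (simp_all add: additive_pCons_0 additive_map_poly)
  moreover have "aug_X (map_poly (pCons 0) p) = pCons 0 (aug_X p)" for p
    by (intro aug_X_map) (simp_all add: additive_pCons_0 map_poly_pCons_0 additive_ops)
  ultimately show ?thesis
    by (simp add: aug_def aug_z_def horner_pCons additive_ops)
qed

text \<open>Here Y has to pass X^j before it can act on w. Once Y is evaluated the claim concerns
  polynomials in X alone, and there the relation YX = - XY + 2z, which holds in W by
  \<open>zop_double\<close>, is used once for each factor X.\<close>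

lemma aug_left_Y: "aug (left_Y f) = Yo (aug f)"
proof -
  have L: "additive (map_poly (map_poly Yo))" by (rule additive_coeff_ops)
  have com: "alternate (map_poly (map_poly Yo) p) = map_poly (map_poly Yo) (alternate p)"
    "odd_shift twice_z (map_poly (map_poly Yo) p) = map_poly (map_poly Yo) (odd_shift twice_z p)" for p
    by (simp_all add: map_poly_alternate map_poly_odd_shift additive_coeff_ops additive_twice_z
        map_poly_twice_z additive_Y)
  have 1: "aug_Y (left_Y f) = map_poly (map_poly Yo) (alternate (aug_Y f)) + odd_shift twice_z (aug_Y f)"
    using aug_Y_map[of alternate f, OF additive_alternate com(1)]
      aug_Y_map[of "odd_shift twice_z" f, OF additive_odd_shift[OF additive_twice_z] com(2)]
    by (simp add: left_Y_def additive.add[OF additive_aug(2)])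
      (simp add: aug_Y_def horner_pCons L com)
  have 2: "aug_z (aug_X (map_poly (map_poly Yo) (alternate g) + odd_shift twice_z g)) =
      Yo (aug_z (aug_X g))" for g
  proof (induction g)
    case 0
    show ?case by (simp add: additive.zero[OF additive_aug(3)] additive.zero[OF additive_aug(4)] Y_zero)
  next
    case (pCons a g)
    let ?h = "\<lambda>p. aug_z (aug_X p)"
    note adds = additive_aug(3)[THEN additive.add] additive_aug(4)[THEN additive.add]
      additive_aug(3)[THEN additive.minus] additive_aug(4)[THEN additive.minus]
      additive_aug(3)[THEN additive.diff] additive_aug(4)[THEN additive.diff]
    have X: "?h (pCons b p) = aug_z b + Xo (?h p)" for b p
      by (simp add: aug_X_def horner_pCons additive_coeff_ops additive.add[OF additive_aug(4)]
          aug_z_map additive_ops zop_X)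
    have t: "?h (map_poly twice_z p) = zop (?h p) + zop (?h p)" for p
    proof -
      have "aug_X (map_poly twice_z p) = twice_z (aug_X p)"
        by (rule aug_X_map) (simp_all add: additive_twice_z map_poly_twice_z additive_ops)
      then show ?thesis
        by (simp add: twice_z_def aug_z_def horner_pCons additive_ops horner_add
            additive.add[OF additive_zop])
    qed
    have Y: "aug_z (map_poly Yo b) = Yo (aug_z b)" for b
      by (rule aug_z_map) (simp_all add: additive_ops zop_Y)
    have "?h (map_poly (map_poly Yo) (alternate (pCons a g)) + odd_shift twice_z (pCons a g)) =
        Yo (aug_z a) - Xo (?h (map_poly (map_poly Yo) (alternate g) + odd_shift twice_z g))
        + (zop (?h g) + zop (?h g))"
      by (simp add: alternate_pCons odd_shift_pCons additive_twice_z map_poly_pCons Y_zero adds X t Y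
          additive.minus[OF L] additive.zero[OF additive_aug(4)] X_add X_minus X_diff algebra_simps
          del: add_pCons)
    also have "\<dots> = Yo (?h (pCons a g))"
      by (simp add: pCons.IH X Y_add zop_double)
    finally show ?case .
  qed
  show ?thesis
    by (simp add: aug_def 1 2)
qed

text \<open>Moving Z through X^j and Y^k down to w produces exactly the signs of
  \<open>flip_XY\<close>; each of the two variables is treated by
  \<open>horner_alternate\<close>.\<close>

lemma aug_Z3: "aug (Z3 f) = Zo (aug f)"
proof -
  have comm: "map_poly Yo (map_poly Zo p) = - map_poly Zo (map_poly Yo p)"
    "map_poly Xo (map_poly Zo p) = - map_poly Zo (map_poly Xo p)" for p
    by (rule poly_eqI, simp add: coeff_map_poly Y_zero Z_zero X_zero Y_Z X_Z)+
  let ?g = "\<lambda>p. alternate (map_poly (map_poly Zo) p)"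
  have g: "additive ?g"
    by (rule additive.intro)
      (simp add: additive.add[OF additive_alternate] additive.add[OF additive_coeff_ops(5)])
  have "map_poly alternate (map_poly (map_poly (map_poly Zo)) f) = map_poly ?g f"
    by (rule poly_eqI) (simp add: coeff_map_poly additive.zero[OF g])
  moreover have "map_poly (map_poly Yo) (?g p) = - ?g (map_poly (map_poly Yo) p)" for p
    by (rule poly_eqI) (simp add: coeff_map_poly coeff_alternate comm additive.minus[OF additive_coeff_ops(1)])
  ultimately have "aug_Y (Z3 f) = ?g (aug_Y f)"
    unfolding aug_Y_def flip_XY_def lift3_def
    by (simp add: horner_alternate[OF additive_coeff_ops(2) g])
  moreover have "aug_X (?g p) = map_poly Zo (aug_X p)" for p
    unfolding aug_X_def
    by (rule horner_alternate[OF additive_coeff_ops(3) additive_coeff_ops(4)]) (rule comm)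
  moreover have "aug_z (map_poly Zo p) = Zo (aug_z p)" for p
    by (rule aug_z_map) (simp_all add: additive_ops zop_Z)
  ultimately show ?thesis
    by (simp add: aug_def)
qed

lemma aug_const3: "aug (const3 w) = w"
  by (simp add: aug_def aug_Y_def aug_X_def aug_z_def const3_def horner_pCons additive_coeff_ops
      additive_ops additive.zero[OF additive_coeff_ops(1)] additive.zero[OF additive_coeff_ops(2)]
      additive.zero[OF additive_coeff_ops(3)] additive.zero[OF additive_zop])

lemma aug_hom: "conifold_hom sc3 Z3 left_X left_Y sc Zo Xo Yo aug"
  by unfold_locales (simp_all add: additive.add[OF additive_aug(1)] aug_sc aug_Z3 aug_left_X aug_left_Y)

definition dX :: "'w poly3 \<Rightarrow> 'w poly3" where "dX f = right_X f - lift3 Xo f"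
definition dY :: "'w poly3 \<Rightarrow> 'w poly3" where "dY f = right_Y f - lift3 Yo f"
text \<open>As z is central in S, left multiplication by z serves as right multiplication.\<close>

definition dz :: "'w poly3 \<Rightarrow> 'w poly3" where "dz f = left_z f - lift3 zop f"
definition eX :: "'w poly3 \<Rightarrow> 'w poly3" where "eX f = right_X f + lift3 Xo f"
definition eY :: "'w poly3 \<Rightarrow> 'w poly3" where "eY f = right_Y f + lift3 Yo f"

lemmas de_defs = dX_def dY_def dz_def eX_def eY_def
lemmas right_left = right_X_left_X right_X_left_Y right_X_left_z right_Y_left_X right_Y_left_Y
  right_Y_left_z left_Xz left_Yz
lemmas lift3_ops_all = lift3_ops[OF additive_X] lift3_ops[OF additive_Y] lift3_ops[OF additive_Z]
  lift3_ops[OF additive_zop] lift3_ops[OF additive_sc]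

lemma additive_de: "additive dX" "additive dY" "additive dz" "additive eX" "additive eY"
  by (rule additive.intro, simp add: de_defs ops_add lift3_ops_all algebra_simps)+

lemmas de_add = additive_de[THEN additive.add]
lemmas de_minus = additive_de[THEN additive.minus]
lemmas de_diff = additive_de[THEN additive.diff]
lemmas de_zero = additive_de[THEN additive.zero]

lemma de_left:
  assumes "d \<in> {dX, dY, dz, eX, eY}"
  shows "d (left_X f) = left_X (d f)" "d (left_Y f) = left_Y (d f)" "d (left_z f) = left_z (d f)"
    "d (sc3 c f) = sc3 c (d f)"
proof -
  have sc: "lift3 Xo (sc3 c f) = sc3 c (lift3 Xo f)" "lift3 Yo (sc3 c f) = sc3 c (lift3 Yo f)"
    "lift3 zop (sc3 c f) = sc3 c (lift3 zop f)"
    by (simp_all add: lift3_comp additive_ops[THEN additive.zero] X_sc Y_sc zop_sc)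
  show "d (left_X f) = left_X (d f)" "d (left_Y f) = left_Y (d f)" "d (left_z f) = left_z (d f)"
    "d (sc3 c f) = sc3 c (d f)"
    using assms
    by (auto simp: de_defs right_left lift3_ops_all ops_add ops_diff sc)
qed

lemma Z3_right: "Z3 (right_X f) = - right_X (Z3 f)" "Z3 (right_Y f) = - right_Y (Z3 f)"
    "Z3 (left_z f) = left_z (Z3 f)"
  by (simp_all add: lift3_ops_all flip_right_X flip_right_Y flip_left_z)

lemma Z3_lift: "Z3 (lift3 Xo f) = - lift3 Xo (Z3 f)" "Z3 (lift3 Yo f) = - lift3 Yo (Z3 f)"
    "Z3 (lift3 zop f) = lift3 zop (Z3 f)"
  by (rule poly3_eqI; simp add: c3_flip_XY c3_lift3 X_Z Y_Z zop_Z X_zero Y_zero Z_zero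
        additive.zero[OF additive_zop] X_minus Y_minus Z_minus additive.minus[OF additive_zop])+

text \<open>The maps of X and Y anticommute with Z, that of z commutes with it. This is why Z acts
  with signs on the terms of the resolution.\<close>

lemma Z3_de: "Z3 (dX f) = - dX (Z3 f)" "Z3 (dY f) = - dY (Z3 f)" "Z3 (dz f) = dz (Z3 f)"
    "Z3 (eX f) = - eX (Z3 f)" "Z3 (eY f) = - eY (Z3 f)"
  by (simp_all only: de_defs F.Z_add additive.diff[OF F.additive_Z] Z3_right Z3_lift) simp_all

lemma lift3_XY: "lift3 Xo (lift3 Yo f) = - lift3 Yo (lift3 Xo f) + (lift3 zop f + lift3 zop f)"
  by (rule poly3_eqI) (simp add: c3_lift3 X_zero Y_zero additive.zero[OF additive_zop] zop_double)

lemma lift3_zop_comm: "lift3 zop (lift3 Xo f) = lift3 Xo (lift3 zop f)"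
   "lift3 zop (lift3 Yo f) = lift3 Yo (lift3 zop f)"
  by (rule poly3_eqI, simp add: c3_lift3 X_zero Y_zero additive.zero[OF additive_zop] zop_X zop_Y)+

lemma dz_comm: "dz (dX f) = dX (dz f)" "dz (dY f) = dY (dz f)" "dz (eX f) = eX (dz f)"
   "dz (eY f) = eY (dz f)"
  by (simp_all add: de_defs ops_add ops_diff lift3_ops_all right_left lift3_zop_comm
      algebra_simps)

text \<open>The mixed terms cancel, because right multiplications commute with operators on the
  coefficients. What is left is the relation XY + YX = 2z in S minus the same relation in W.\<close>

lemma dX_eY: "dX (eY f) + dY (eX f) = dz f + dz f"
  by (simp add: de_defs ops_add ops_diff lift3_ops_all lift3_XY right_XY algebra_simps)

lemma right_const3: "right_X (const3 w) = left_X (const3 w)" "right_Y (const3 w) = left_Y (const3 w)"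
  for w :: "'b::ab_group_add"
  by (rule poly3_eqI; auto simp: c3_simps c3_const3 split: nat.split)+

text \<open>At s \<otimes> w both sides of the first equation are s X w. They are left linear in s,
  and on constants right and left multiplication agree. The second is the same for Y.\<close>

lemma aug_right: "aug (right_X f) = aug (lift3 Xo f)" "aug (right_Y f) = aug (lift3 Yo f)"
proof -
  note [simp] = additive_def ops_add lift3_ops_all additive.add[OF additive_aug(1)]
    right_X_left_X right_X_left_Y right_X_left_z right_Y_left_X right_Y_left_Y right_Y_left_z
    aug_left_X aug_left_Y aug_left_z aug_const3 right_const3
  show "aug (right_X f) = aug (lift3 Xo f)"
    by (rule left_linear_eqI[where h = "\<lambda>f. aug (right_X f)" and h' = "\<lambda>f. aug (lift3 Xo f)"
          and TX = Xo and TY = Yo and Tz = zop]) simp_all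
  show "aug (right_Y f) = aug (lift3 Yo f)"
    by (rule left_linear_eqI[where h = "\<lambda>f. aug (right_Y f)" and h' = "\<lambda>f. aug (lift3 Yo f)"
          and TX = Xo and TY = Yo and Tz = zop]) simp_all
qed

end

section \<open>Exactness of the complex\<close>

lemma additive_uminus_comp:
  "additive h \<Longrightarrow> additive (\<lambda>a. - h a :: 'b::ab_group_add)"
  by (simp add: additive_def)

context conifold_module
begin

interpretation F: conifold_module sc3 Z3 left_X left_Y
  by (rule induced_module)

lemma dY_eq: "dY f = pCons 0 f - map_poly (map_poly (map_poly Yo)) f"
  by (simp add: dY_def right_Y_def lift3_def)

lemma eY_eq: "eY f = pCons 0 f - map_poly (\<lambda>p. - map_poly (map_poly Yo) p) f"
proof -
  have "map_poly (\<lambda>p. - map_poly (map_poly Yo) p) f = - map_poly (map_poly (map_poly Yo)) f"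
    by (rule poly_eqI) (simp add: coeff_map_poly)
  then show ?thesis
    by (simp add: eY_def right_Y_def lift3_def)
qed

text \<open>On polynomials free of Y the map \<open>dX\<close> is monic in X; in general right
  multiplication by X brings the signs (-1)^k and a term of lower degree in Y. Hence the order of
  division below: first Y, then X, then z.\<close>

lemma dX_const: "dX [:p:] = [:pCons 0 p - map_poly (map_poly Xo) p:]"
proof -
  have "right_X [:p:] = [:pCons 0 p:]"
    by (rule poly3_eqI, subst c3_right_X) (auto simp: c3_def coeff_pCons split: nat.split)
  then show ?thesis
    by (simp add: dX_def lift3_def map_poly_pCons)
qed

lemma dz_const: "dz [:p:] = [:map_poly (pCons 0) p - map_poly (map_poly zop) p:]"
  by (simp add: dz_def left_z_def lift3_def map_poly_pCons)

lemma dz_const_const: "dz [:[:r:]:] = [:[:pCons 0 r - map_poly zop r:]:]"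
  by (simp add: dz_const map_poly_pCons)

lemma dY_const_imp_0: "dY f = [:p:] \<Longrightarrow> f = 0"
  by (rule division_poly_unique[OF additive_coeff_ops(2)]) (simp add: dY_eq)

lemma eY_const_imp_0: "eY f = [:p:] \<Longrightarrow> f = 0"
  by (rule division_poly_unique[OF additive_uminus_comp[OF additive_coeff_ops(2)]]) (simp add: eY_eq)

lemma dX_const_imp_0: "dX [:p:] = [:[:r:]:] \<Longrightarrow> p = 0"
  by (rule division_poly_unique[OF additive_coeff_ops(3)]) (simp add: dX_const)

lemma dz_inj: "dz f = 0 \<Longrightarrow> f = 0"
proof (rule poly_eqI, rule poly_eqI)
  fix k j
  assume "dz f = 0"
  have "pCons 0 (coeff (coeff f k) j) - map_poly zop (coeff (coeff f k) j) = coeff (coeff (dz f) k) j"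
    by (simp add: dz_def left_z_def lift3_def coeff_map_poly)
  also have "\<dots> = [:0:]"
    using \<open>dz f = 0\<close> by simp
  finally have "coeff (coeff f k) j = 0"
    by (rule division_poly_unique[OF additive_zop])
  then show "coeff (coeff f k) j = coeff (coeff 0 k) j" by simp
qed

lemma dY_division: obtains q p where "f = dY q + [:p:]"
  using division_poly[OF additive_coeff_ops(2), of f] by (metis dY_eq)

lemma eY_division: obtains q p where "f = eY q + [:p:]"
  using division_poly[OF additive_uminus_comp[OF additive_coeff_ops(2)], of f] by (metis eY_eq)

lemma add_const: "[:p + q:] = [:p:] + [:q :: 'b::ab_group_add:]"
  by simp

lemma dX_division: obtains q r where "[:p:] = dX [:q:] + [:[:r:]:]"
  using division_poly[OF additive_coeff_ops(3), of p] by (metis dX_const add_const)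

lemma dz_division: obtains q w where "[:[:r:]:] = dz [:[:q:]:] + const3 w"
  using division_poly[OF additive_zop, of r] by (metis dz_const_const add_const const3_def)

lemma aug_de: "aug (dX f) = 0" "aug (dY f) = 0" "aug (dz f) = 0"
proof -
  have *: "aug (dX f) = 0" "aug (dY f) = 0" for f
    by (simp_all add: de_defs additive.diff[OF additive_aug(1)] aug_right)
  then show "aug (dX f) = 0" "aug (dY f) = 0" .
  \<comment> \<open>Twice \<open>dz\<close> is a sum of values of \<open>dX\<close> and
    \<open>dY\<close>, which the action map kills.\<close>
  have "aug (dz f) + aug (dz f) = aug (dX (eY f) + dY (eX f))"
    by (simp add: dX_eY additive.add[OF additive_aug(1)])
  also have "\<dots> = 0"
    by (simp add: additive.add[OF additive_aug(1)] *)
  finally show "aug (dz f) = 0"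
    by (metis sc_half sc_add sc_zero)
qed

text \<open>Dividing by \<open>dY\<close>, \<open>dX\<close> and \<open>dz\<close> in turn reduces f
  to a constant w, and the action map sends both f and this constant to w.\<close>

lemma exact_0:
  assumes "aug f = 0"
  obtains a b c where "f = dX a + dY b + dz c"
proof -
  obtain b p where f: "f = dY b + [:p:]" by (rule dY_division)
  obtain a r where p: "[:p:] = dX [:a:] + [:[:r:]:]" by (rule dX_division)
  obtain c w where r: "[:[:r:]:] = dz [:[:c:]:] + const3 w" by (rule dz_division)
  have eq: "f = dX [:a:] + dY b + dz [:[:c:]:] + const3 w"
    by (simp only: f p r add_ac)
  then have "aug f = w"
    by (simp add: additive.add[OF additive_aug(1)] aug_de aug_const3)
  then show ?thesis
    using that eq assms by (simp add: const3_def)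
qed

text \<open>Subtracting the boundary of (u, v, w) brings the cycle to a reduced form, whose first
  entry is free of Y and whose last is a constant in X and Y. Such a cycle vanishes: comparing
  degrees in Y and then in X kills the second and the first entry, and \<open>dz\<close> is
  injective.\<close>

lemma exact_1:
  assumes "dX a + dY b + dz c = 0"
  obtains u v w where "a = eY u + dz v" "b = eX u + dz w" "c = - (u + u) - dX v - dY w"
proof -
  obtain u a1 where a: "a = eY u + [:a1:]" by (rule eY_division)
  \<comment> \<open>The boundary of u contributes -2u to the last entry, so it is c + 2u that is
    divided.\<close>
  obtain w' c1 where c: "c + (u + u) = dY w' + [:c1:]" by (rule dY_division)
  obtain v' c2 where c1: "[:c1:] = dX [:v':] + [:[:c2:]:]" by (rule dX_division)
  define v where "v = - [:v':]"
  define w where "w = - w'"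
  define b1 where "b1 = b - eX u - dz w"
  define a2 where "a2 = [:a1:] - dz v"
  have a': "a = eY u + dz v + a2"
    by (simp add: a a2_def)
  have b': "b = eX u + dz w + b1"
    by (simp add: b1_def)
  have c': "c = - (u + u) - dX v - dY w + [:[:c2:]:]"
    using c c1 by (simp add: v_def w_def de_minus algebra_simps del: minus_pCons)
  have "dX a2 + dY b1 + dz [:[:c2:]:] + (dX (eY u) + dY (eX u)) = dz u + dz u"
    using assms unfolding a' b' c'
    by (simp add: de_add de_diff de_minus dz_comm algebra_simps)
  then have rest: "dX a2 + dY b1 + dz [:[:c2:]:] = 0"
    by (simp add: dX_eY)
  obtain a3 where a3: "a2 = [:a3:]"
    unfolding a2_def v_def by (simp add: dz_const)
  have "dY b1 = - (dX [:a3:] + dz [:[:c2:]:])"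
    using rest a3 by (simp add: algebra_simps add_eq_0_iff2)
  then have "b1 = 0"
    unfolding dX_const dz_const by (intro dY_const_imp_0) simp
  then have X: "dX [:a3:] = - dz [:[:c2:]:]"
    using rest a3 by (simp add: de_zero add_eq_0_iff2)
  then have "a3 = 0"
    unfolding dz_const_const by (intro dX_const_imp_0) simp
  then have "[:[:c2:]:] = 0"
    using X dz_inj[of "[:[:c2:]:]"] by (simp add: de_zero)
  then show ?thesis
    using that a' b' c' a3 \<open>b1 = 0\<close> \<open>a3 = 0\<close> by simp
qed

text \<open>Division of v by \<open>eY\<close> supplies t. The rest u - dz t has a value under
  \<open>eY\<close> that is free of Y, so it is zero; the formulas for v and w follow by cancelling
  \<open>dz\<close>.\<close>

lemma exact_2:
  assumes "eY u + dz v = 0" "eX u + dz w = 0" "- (u + u) - dX v - dY w = 0"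
  obtains t where "u = dz t" "v = - eY t" "w = - eX t"
proof -
  obtain t' p where v: "v = eY t' + [:p:]" by (rule eY_division)
  define t where "t = - t'"
  define u1 where "u1 = u - dz t"
  have "eY u1 = - dz [:p:]"
    using assms(1)
    by (simp add: u1_def t_def v de_add de_diff de_minus dz_comm algebra_simps eq_neg_iff_add_eq_0)
  then have "eY u1 = [:- (map_poly (pCons 0) p - map_poly (map_poly zop) p):]"
    by (simp add: dz_const)
  then have u1: "u1 = 0"
    by (rule eY_const_imp_0)
  then have u: "u = dz t"
    by (simp add: u1_def)
  have "dz (v + eY t) = 0"
    using assms(1) by (simp add: u de_add dz_comm add.commute)
  then have v: "v = - eY t"
    using dz_inj eq_neg_iff_add_eq_0 by blast
  have "dz (w + eX t) = 0"
    using assms(2) by (simp add: u de_add dz_comm add.commute)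
  then have w: "w = - eX t"
    using dz_inj eq_neg_iff_add_eq_0 by blast
  show ?thesis
    using that u v w by blast
qed

lemma complex_1: "dX (eY u + dz v) + dY (eX u + dz w) + dz (- u - u - dX v - dY w) = 0"
proof -
  have "dX (eY u + dz v) + dY (eX u + dz w) + dz (- u - u - dX v - dY w) =
      (dX (eY u) + dY (eX u)) - (dz u + dz u)"
    by (simp add: de_add de_diff de_minus dz_comm algebra_simps)
  then show ?thesis
    by (simp add: dX_eY)
qed

lemma complex_2: "- (dz t + dz t) - dX (- eY t) - dY (- eX t) = 0"
proof -
  have "- (dz t + dz t) - dX (- eY t) - dY (- eX t) = (dX (eY t) + dY (eX t)) - (dz t + dz t)"
    by (simp add: de_minus algebra_simps)
  then show ?thesis
    by (simp add: dX_eY)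
qed

end

section \<open>The resolution as a complex of triples\<close>

type_synonym 'w triple = "'w poly3 \<times> 'w poly3 \<times> 'w poly3"

definition triple_map :: "('w poly3 \<Rightarrow> 'w poly3) \<Rightarrow> 'w triple \<Rightarrow> 'w triple" where
  "triple_map h = map_prod h (map_prod h h)"

lemma triple_map_simp [simp]: "triple_map h (a, b, c) = (h a, h b, h c)"
  by (simp add: triple_map_def)

text \<open>On the summands of the modules in the resolution, \<open>Z\<close> acts with the signs that make the
  boundary maps commute with it.\<close>

fun degree_signs :: "nat \<Rightarrow> bool \<times> bool \<times> bool" where
  "degree_signs (Suc 0) = (False, False, True)"
| "degree_signs (Suc (Suc 0)) = (True, False, False)"
| "degree_signs _ = (True, True, True)"

text \<open>All terms of the complex share the type of triples; the zero conditions cut out the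
  ranks 1, 3, 3, 1, and 0 in higher degrees.\<close>

definition degree_shape :: "nat \<Rightarrow> 'w::ab_group_add triple \<Rightarrow> bool" where
  "degree_shape n t = (case t of (a, b, c) \<Rightarrow>
     if n = 0 \<or> n = 3 then b = 0 \<and> c = 0 else n = 1 \<or> n = 2 \<or> a = 0 \<and> b = 0 \<and> c = 0)"

lemma conifold_module_prod:
  assumes "conifold_module sc Zo Xo Yo" and "conifold_module sc' Zo' Xo' Yo'"
  shows "conifold_module (\<lambda>c. map_prod (sc c) (sc' c)) (map_prod Zo Zo') (map_prod Xo Xo') (map_prod Yo Yo')"
proof -
  interpret A: conifold_module sc Zo Xo Yo by fact
  interpret B: conifold_module sc' Zo' Xo' Yo' by fact
  show ?thesis
    by unfold_locales (auto simp: A.sc_add B.sc_add A.sc_add_left B.sc_add_left A.sc_mult B.sc_mult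
        A.sc_one B.sc_one A.Z_add B.Z_add A.Z_sc B.Z_sc A.Z_Z B.Z_Z A.X_add B.X_add A.Y_add B.Y_add
        A.X_sc B.X_sc A.Y_sc B.Y_sc A.X_Z B.X_Z A.Y_Z B.Y_Z A.XXY B.XXY A.YYX B.YYX)
qed

definition signed :: "bool \<Rightarrow> ('w \<Rightarrow> 'w::ab_group_add) \<Rightarrow> 'w \<Rightarrow> 'w" where
  "signed b h w = (if b then h w else - h w)"

context sign_module
begin

lemma signed_sign_module: "sign_module sc (signed b Zo)"
  using sign_module_uminus sign_module_axioms by (cases b) (simp_all add: signed_def[abs_def])

lemma signed_Z3: "signed b Z3 f = flip_XY (lift3 (signed b Zo) f)"
  by (cases b; rule poly3_eqI) (simp_all add: signed_def[abs_def] c3_flip_XY c3_lift3 Z_zero)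

lemma signed_induced_module: "conifold_module sc3 (signed b Z3) left_X left_Y"
  using sign_module.induced_module[OF signed_sign_module, of b]
  by (simp add: signed_Z3[abs_def])

definition triple_Z :: "nat \<Rightarrow> 'w triple \<Rightarrow> 'w triple" where
  "triple_Z n = (case degree_signs n of (s1, s2, s3) \<Rightarrow>
     map_prod (signed s1 Z3) (map_prod (signed s2 Z3) (signed s3 Z3)))"

lemma triple_module:
  "conifold_module (\<lambda>c. triple_map (sc3 c)) (triple_Z n) (triple_map left_X) (triple_map left_Y)"
  unfolding triple_map_def triple_Z_def
  by (cases "degree_signs n")
    (simp add: conifold_module_prod signed_induced_module)

end

context conifold_module
begin

interpretation F: conifold_module sc3 Z3 left_X left_Y
  by (rule induced_module)

text \<open>\<open>boundary n\<close> leads from degree n + 1 to degree n. The term -2u is the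
  bracket term; under \<open>dz\<close> it cancels the sum of \<open>dX (eY u)\<close> and
  \<open>dY (eX u)\<close>.\<close>

fun boundary :: "nat \<Rightarrow> 'w triple \<Rightarrow> 'w triple" where
  "boundary 0 (a, b, c) = (dX a + dY b + dz c, 0, 0)"
| "boundary (Suc 0) (u, v, w) = (eY u + dz v, eX u + dz w, - (u + u) - dX v - dY w)"
| "boundary (Suc (Suc 0)) (t, _, _) = (dz t, - eY t, - eX t)"
| "boundary (Suc (Suc (Suc n))) _ = 0"

lemma boundary_hom:
  "conifold_hom (\<lambda>c. triple_map (sc3 c)) (triple_Z (Suc n)) (triple_map left_X) (triple_map left_Y)
     (\<lambda>c. triple_map (sc3 c)) (triple_Z n) (triple_map left_X) (triple_map left_Y) (boundary n)"
proof -
  interpret A: conifold_module "\<lambda>c. triple_map (sc3 c)" "triple_Z (Suc n)" "triple_map left_X" "triple_map left_Y"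
    by (rule triple_module)
  interpret B: conifold_module "\<lambda>c. triple_map (sc3 c)" "triple_Z n" "triple_map left_X" "triple_map left_Y"
    by (rule triple_module)
  note simps = de_add de_diff de_minus de_zero F.Z_add additive.diff[OF F.additive_Z] F.Z_minus F.Z_zero
    F.sc_add F.sc_diff F.sc_minus F.sc_zero F.X_add F.X_diff F.X_minus F.X_zero
    F.Y_add F.Y_diff F.Y_minus F.Y_zero de_left Z3_de
  show ?thesis
  proof (unfold_locales, goal_cases)
    case (1 x y)
    show ?case
      by (cases x; cases y; cases "(n, x + y)" rule: boundary.cases) (auto simp: simps)
  next
    case (2 c x)
    show ?case
      by (cases x; cases "(n, x)" rule: boundary.cases) (auto simp: simps B.sc_zero)
  next
    case (3 x)
    show ?case
      by (cases x; cases "(n, x)" rule: boundary.cases)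
        (auto simp: simps triple_Z_def signed_def B.Z_zero zero_prod_def algebra_simps)
  next
    case (4 x)
    show ?case
      by (cases x; cases "(n, x)" rule: boundary.cases) (auto simp: simps B.X_zero)
  next
    case (5 x)
    show ?case
      by (cases x; cases "(n, x)" rule: boundary.cases) (auto simp: simps B.Y_zero)
  qed
qed

text \<open>Naturality of the complex in W, to be applied to the projection onto a direct
  summand.\<close>

lemma lift3_boundary:
  assumes p: "additive p" "\<And>w. p (Xo w) = Xo (p w)" "\<And>w. p (Yo w) = Yo (p w)" "\<And>w. p (zop w) = zop (p w)"
  shows "triple_map (lift3 p) (boundary n t) = boundary n (triple_map (lift3 p) t)"
proof -
  note zero = additive.zero[OF p(1)] X_zero Y_zero additive.zero[OF additive_zop]
  note l = lift3_ops[OF p(1)]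
  have c: "lift3 p (lift3 Xo f) = lift3 Xo (lift3 p f)" "lift3 p (lift3 Yo f) = lift3 Yo (lift3 p f)"
    "lift3 p (lift3 zop f) = lift3 zop (lift3 p f)" for f
    by (simp_all add: lift3_comp zero p)
  have "lift3 p (d f) = d (lift3 p f)" if "d \<in> {dX, dY, dz, eX, eY}" for d f
    using that by (auto simp: de_defs l c)
  then show ?thesis
    by (cases "(n, t)" rule: boundary.cases) (auto simp: l zero_prod_def)
qed

lemma boundary_boundary:
  "degree_shape (Suc (Suc n)) t \<Longrightarrow> boundary n (boundary (Suc n) t) = 0"
proof (cases n)
  case 0
  then show ?thesis
    using complex_1 by (cases t) (auto simp: zero_prod_def)
next
  case (Suc m)
  then show ?thesis
    using complex_2[of "fst t"]
    by (cases t; cases m; cases "m - 1")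
      (simp_all add: zero_prod_def degree_shape_def dz_comm de_zero de_minus)
qed

lemma boundary_shape: "degree_shape (Suc n) t \<Longrightarrow> degree_shape n (boundary n t)"
  by (cases "(n, t)" rule: boundary.cases) (auto simp: degree_shape_def zero_prod_def de_zero)

lemma boundary_exact:
  assumes "boundary n t = 0" "degree_shape (Suc n) t"
  obtains u where "degree_shape (Suc (Suc n)) u" "boundary (Suc n) u = t"
proof -
  obtain a b c where t: "t = (a, b, c)" by (cases t)
  have *: "\<exists>u. degree_shape (Suc (Suc n)) u \<and> boundary (Suc n) u = t"
  proof (cases "(n, t)" rule: boundary.cases)
    case 1
    then have "dX a + dY b + dz c = 0"
      using assms(1) t by (simp add: zero_prod_def)
    then obtain u v w where "a = eY u + dz v" "b = eX u + dz w" "c = - (u + u) - dX v - dY w"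
      by (rule exact_1)
    then show ?thesis
      using 1 t by (intro exI[of _ "(u, v, w)"]) (simp add: degree_shape_def)
  next
    case 2
    then have "eY a + dz b = 0" "eX a + dz c = 0" "- (a + a) - dX b - dY c = 0"
      using assms(1) t by (simp_all add: zero_prod_def)
    then obtain s where "a = dz s" "b = - eY s" "c = - eX s"
      by (rule exact_2)
    then show ?thesis
      using 2 t by (intro exI[of _ "(s, 0, 0)"]) (simp add: degree_shape_def)
  next
    case 3
    then have "dz a = 0"
      using assms(1) t by (simp add: zero_prod_def)
    then have "t = 0"
      using 3 t assms(2) dz_inj by (simp add: degree_shape_def zero_prod_def)
    then show ?thesis
      using 3 by (intro exI[of _ "0"]) (simp add: degree_shape_def zero_prod_def)
  next
    case (4 m)
    then have "t = 0"
      using assms(2) t by (auto simp add: degree_shape_def zero_prod_def)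
    then show ?thesis
      using 4 by (intro exI[of _ "0"]) (auto simp add: degree_shape_def zero_prod_def)
  qed
  then show ?thesis using that by blast
qed

lemma aug_boundary: "aug (fst (boundary 0 t)) = 0"
  by (cases t) (simp add: additive.add[OF additive_aug(1)] aug_de)

lemma aug_exact:
  assumes "aug f = 0"
  obtains t where "boundary 0 t = (f, 0, 0)"
  using exact_0[OF assms] by (metis boundary.simps(1))

end

section \<open>Presented rings and their modules\<close>

lemma relation_in_ideal: "p \<in> conifold_relations \<Longrightarrow> p \<in> conifold_ideal"
  unfolding conifold_ideal_def
  by (rule free_ring.genideal_self[THEN subsetD]) (simp_all add: ring_of_type_algebra_def)

text \<open>A ring presented by the conifold relations, given through its quotient map
  \<open>cl\<close>. The opposite of the conifold algebra is also of this kind, so that left and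
  right global dimension are treated by one argument.\<close>

locale conifold_quotient = ring R for R :: "('a, 'b) ring_scheme" (structure) +
  fixes cl :: "free_alg \<Rightarrow> 'a"
  assumes cl_add: "cl (p + q) = cl p \<oplus>\<^bsub>R\<^esub> cl q"
    and cl_mult: "cl (p * q) = cl p \<otimes>\<^bsub>R\<^esub> cl q"
    and cl_one: "cl 1 = \<one>\<^bsub>R\<^esub>"
    and carrier_eq: "carrier R = range cl"
    and cl_eq_zero_iff: "cl p = \<zero>\<^bsub>R\<^esub> \<longleftrightarrow> p \<in> conifold_ideal"
begin

lemma cl_closed [simp, intro]: "cl p \<in> carrier R"
  by (simp add: carrier_eq)

lemma cl_zero: "cl 0 = \<zero>\<^bsub>R\<^esub>"
  using cl_add[of 0 0] by (metis add.l_cancel_one' cl_closed add_0 zero_closed r_zero)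

lemma cl_minus: "cl (- p) = \<ominus>\<^bsub>R\<^esub> cl p"
  by (metis add.inv_equality cl_add cl_closed cl_zero left_minus)

lemma cl_eq_iff: "cl p = cl q \<longleftrightarrow> p - q \<in> conifold_ideal"
proof -
  have "cl (p - q) = cl p \<ominus>\<^bsub>R\<^esub> cl q"
    using cl_add[of p "- q"] by (simp add: cl_minus a_minus_def)
  then show ?thesis
    using cl_eq_zero_iff[of "p - q"] by (metis cl_closed r_right_minus_eq)
qed

lemma carrier_cases: "a \<in> carrier R \<Longrightarrow> (\<And>p. a = cl p \<Longrightarrow> P) \<Longrightarrow> P"
  by (auto simp: carrier_eq)

end

definition cscale :: "complex \<Rightarrow> ('m \<Rightarrow>\<^sub>0 complex) \<Rightarrow> 'm \<Rightarrow>\<^sub>0 complex" where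
  "cscale c f = Poly_Mapping.map ((*) c) f"

lemma lookup_cscale [simp]: "Poly_Mapping.lookup (cscale c f) k = c * Poly_Mapping.lookup f k"
  by (simp add: cscale_def map.rep_eq when_def)

lemma keys_cscale: "Poly_Mapping.keys (cscale c f) \<subseteq> Poly_Mapping.keys f"
  by (auto simp: in_keys_iff)

lemma cscale_single: "cscale c (Poly_Mapping.single k d) = Poly_Mapping.single k (c * d)"
  by (rule poly_mapping_eqI) (simp add: lookup_single when_def)

interpretation cscale: vector_space "cscale :: complex \<Rightarrow> ('m \<Rightarrow>\<^sub>0 complex) \<Rightarrow> _"
  by unfold_locales (rule poly_mapping_eqI; simp add: lookup_add algebra_simps)+

interpretation cscale_pair: vector_space_pair
  "cscale :: complex \<Rightarrow> ('m \<Rightarrow>\<^sub>0 complex) \<Rightarrow> _" "cscale :: complex \<Rightarrow> ('m \<Rightarrow>\<^sub>0 complex) \<Rightarrow> _"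
  by unfold_locales

lemma cscale_projection:
  assumes "cscale.subspace N"
  obtains g :: "('m \<Rightarrow>\<^sub>0 complex) \<Rightarrow> 'm \<Rightarrow>\<^sub>0 complex" where
    "\<And>x y. g (x + y) = g x + g y" "\<And>c x. g (cscale c x) = cscale c (g x)"
    "\<And>x. g x \<in> N" "\<And>x. x \<in> N \<Longrightarrow> g x = x"
proof -
  have "Vector_Spaces.linear cscale cscale (\<lambda>x. x)"
    by (rule cscale.linear_ident)
  then obtain g where "range g \<subseteq> N" "Vector_Spaces.linear cscale cscale g" "\<forall>v\<in>N. g v = v"
    using cscale_pair.linear_exists_left_inverse_on[of "\<lambda>x. x" N] assms by auto
  then show ?thesis
    using that[of g] by (auto simp: Vector_Spaces.linear_iff)
qed

context left_module
begin

lemma smult_zero: "a \<in> carrier R \<Longrightarrow> a \<odot>\<^bsub>M\<^esub> \<zero>\<^bsub>M\<^esub> = \<zero>\<^bsub>M\<^esub>"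
  by (metis M.add.l_cancel_one' M.l_zero M.zero_closed smult_closed smult_r_distr)

lemma zero_smult: "x \<in> carrier M \<Longrightarrow> \<zero>\<^bsub>R\<^esub> \<odot>\<^bsub>M\<^esub> x = \<zero>\<^bsub>M\<^esub>"
  by (metis M.add.l_cancel_one' R.l_zero R.zero_closed smult_closed smult_l_distr)

lemma smult_finsum:
  assumes "a \<in> carrier R" "finite A" "\<And>i. i \<in> A \<Longrightarrow> f i \<in> carrier M"
  shows "a \<odot>\<^bsub>M\<^esub> finsum M f A = finsum M (\<lambda>i. a \<odot>\<^bsub>M\<^esub> f i) A"
  using assms(2,3)
proof (induction A rule: finite_induct)
  case empty
  then show ?case using assms(1) by (simp add: smult_zero)
next
  case (insert x A)
  then show ?case
    using assms(1) by (simp add: M.finsum_insert Pi_def smult_closed smult_r_distr)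
qed

end

lemma (in abelian_group) finsum_neutral_left:
  assumes "finite B" "A \<subseteq> B" "\<And>i. i \<in> B \<Longrightarrow> f i \<in> carrier G" "\<And>i. i \<in> B - A \<Longrightarrow> f i = \<zero>"
  shows "finsum G f A = finsum G f B"
  using assms by (intro add.finprod_mono_neutral_cong_left) auto

text \<open>A module \<open>M\<close> on an arbitrary carrier is replaced by a direct summand of a module on a type of
  class \<open>ab_group_add\<close>: the linear map \<open>realize\<close> from the free vector space on the elements of \<open>M\<close>
  onto \<open>M\<close> has a linear section, along which the action is transported. On the kernel of \<open>realize\<close>,
  \<open>X\<close> and \<open>Y\<close> act by \<open>0\<close> and \<open>Z\<close> by \<open>1\<close>.\<close>

locale conifold_left_module = conifold_quotient R cl + left_module R M
  for R :: "('a, 'b) ring_scheme" (structure) and cl :: "free_alg \<Rightarrow> 'a"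
    and M :: "('a, 'm, 'c) module_scheme" (structure)
begin

abbreviation scalar :: "complex \<Rightarrow> 'a" where
  "scalar c \<equiv> cl (Poly_Mapping.single 0 c)"

text \<open>Finitely supported functions live on the whole type \<open>'m\<close>; points outside
  the carrier are sent to zero.\<close>

definition base :: "'m \<Rightarrow> 'm" where
  "base m = (if m \<in> carrier M then m else \<zero>\<^bsub>M\<^esub>)"

lemma base_closed [simp]: "base m \<in> carrier M"
  by (simp add: base_def)

definition realize :: "('m \<Rightarrow>\<^sub>0 complex) \<Rightarrow> 'm" where
  "realize f = finsum M (\<lambda>m. scalar (Poly_Mapping.lookup f m) \<odot>\<^bsub>M\<^esub> base m) (Poly_Mapping.keys f)"

lemma scalar_closed: "scalar c \<odot>\<^bsub>M\<^esub> base m \<in> carrier M"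
  by (simp add: smult_closed)

lemma realize_closed [simp]: "realize f \<in> carrier M"
  unfolding realize_def by (intro M.finsum_closed) (auto simp: scalar_closed)

lemma realize_superset:
  assumes "finite A" "Poly_Mapping.keys f \<subseteq> A"
  shows "realize f = finsum M (\<lambda>m. scalar (Poly_Mapping.lookup f m) \<odot>\<^bsub>M\<^esub> base m) A"
  unfolding realize_def using assms
  by (intro M.finsum_neutral_left) (auto simp: scalar_closed in_keys_iff cl_zero zero_smult)

lemma realize_add: "realize (f + g) = realize f \<oplus>\<^bsub>M\<^esub> realize g"
proof -
  let ?A = "Poly_Mapping.keys f \<union> Poly_Mapping.keys g"
  have "realize (f + g) = finsum M (\<lambda>m. scalar (Poly_Mapping.lookup f m) \<odot>\<^bsub>M\<^esub> base m \<oplus>\<^bsub>M\<^esub>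
      scalar (Poly_Mapping.lookup g m) \<odot>\<^bsub>M\<^esub> base m) ?A"
    by (subst realize_superset[of ?A])
      (simp_all add: Poly_Mapping.keys_add lookup_add single_add cl_add smult_l_distr)
  also have "\<dots> = realize f \<oplus>\<^bsub>M\<^esub> realize g"
    by (subst (1 2) realize_superset[of ?A]) (auto simp: scalar_closed intro!: M.finsum_addf)
  finally show ?thesis .
qed

lemma realize_single: "m \<in> carrier M \<Longrightarrow> realize (Poly_Mapping.single m 1) = m"
  by (subst realize_superset[of "{m}"])
    (simp_all add: M.finsum_insert smult_closed base_def cl_one smult_one flip: one_poly_mapping.abs_eq)

lemma realize_cscale: "realize (cscale c f) = scalar c \<odot>\<^bsub>M\<^esub> realize f"
proof -
  have "realize (cscale c f) =
      finsum M (\<lambda>m. scalar c \<odot>\<^bsub>M\<^esub> (scalar (Poly_Mapping.lookup f m) \<odot>\<^bsub>M\<^esub> base m)) (Poly_Mapping.keys f)"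
    by (subst realize_superset[of "Poly_Mapping.keys f"])
      (auto simp: keys_cscale mult_single cl_mult smult_assoc simp flip: smult_assoc cl_mult)
  also have "\<dots> = scalar c \<odot>\<^bsub>M\<^esub> realize f"
    unfolding realize_def by (subst smult_finsum) (auto simp: scalar_closed)
  finally show ?thesis .
qed

lemma realize_zero: "realize 0 = \<zero>\<^bsub>M\<^esub>"
  by (simp add: realize_def)

lemma realize_diff: "realize (f - g) = realize f \<ominus>\<^bsub>M\<^esub> realize g"
proof -
  have "realize (f - g) \<oplus>\<^bsub>M\<^esub> realize g = realize f"
    by (simp flip: realize_add)
  then show ?thesis
    by (metis M.add.inv_solve_right a_minus_def realize_closed)
qed

lemma subspace_kernel: "cscale.subspace {f. realize f = \<zero>\<^bsub>M\<^esub>}"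
  by (simp add: cscale.subspace_def realize_zero realize_add realize_cscale smult_zero)

definition kernel_projection :: "('m \<Rightarrow>\<^sub>0 complex) \<Rightarrow> 'm \<Rightarrow>\<^sub>0 complex" where
  "kernel_projection = (SOME g. (\<forall>x y. g (x + y) = g x + g y) \<and> (\<forall>c x. g (cscale c x) = cscale c (g x)) \<and>
     (\<forall>x. realize (g x) = \<zero>\<^bsub>M\<^esub>) \<and> (\<forall>x. realize x = \<zero>\<^bsub>M\<^esub> \<longrightarrow> g x = x))"

lemma kernel_projection:
  "kernel_projection (x + y) = kernel_projection x + kernel_projection y"
  "kernel_projection (cscale c x) = cscale c (kernel_projection x)"
  "realize (kernel_projection x) = \<zero>\<^bsub>M\<^esub>"
  "realize x = \<zero>\<^bsub>M\<^esub> \<Longrightarrow> kernel_projection x = x"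
proof -
  have "\<exists>g. (\<forall>x y. g (x + y) = g x + g y) \<and> (\<forall>c x. g (cscale c x) = cscale c (g x)) \<and>
     (\<forall>x. realize (g x) = \<zero>\<^bsub>M\<^esub>) \<and> (\<forall>x. realize x = \<zero>\<^bsub>M\<^esub> \<longrightarrow> g x = x)"
    by (rule cscale_projection[OF subspace_kernel]) blast
  from someI_ex[OF this] show
    "kernel_projection (x + y) = kernel_projection x + kernel_projection y"
    "kernel_projection (cscale c x) = cscale c (kernel_projection x)"
    "realize (kernel_projection x) = \<zero>\<^bsub>M\<^esub>"
    "realize x = \<zero>\<^bsub>M\<^esub> \<Longrightarrow> kernel_projection x = x"
    unfolding kernel_projection_def by blast+
qed

definition image_projection :: "('m \<Rightarrow>\<^sub>0 complex) \<Rightarrow> 'm \<Rightarrow>\<^sub>0 complex" where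
  "image_projection f = f - kernel_projection f"

lemma image_projection_eqI: "realize f = realize g \<Longrightarrow> image_projection f = image_projection g"
proof -
  assume "realize f = realize g"
  then have "kernel_projection (f - g) = f - g"
    by (intro kernel_projection(4)) (simp add: realize_diff M.r_neg a_minus_def)
  moreover have "kernel_projection f = kernel_projection (f - g) + kernel_projection g"
    by (simp flip: kernel_projection(1))
  ultimately show ?thesis
    by (simp add: image_projection_def)
qed

lemma realize_image_projection: "realize (image_projection f) = realize f"
  by (simp add: image_projection_def realize_diff kernel_projection a_minus_def)

lemma image_projection_add: "image_projection (f + g) = image_projection f + image_projection g"
  by (simp add: image_projection_def kernel_projection)

lemma image_projection_cscale: "image_projection (cscale c f) = cscale c (image_projection f)"
  by (simp add: image_projection_def kernel_projection cscale.scale_right_diff_distrib)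

text \<open>The point mass at x lies over x but depends on it nonlinearly. Removing its component in
  the kernel of \<open>realize\<close> turns it into a linear section.\<close>

definition lin_section :: "'m \<Rightarrow> 'm \<Rightarrow>\<^sub>0 complex" where
  "lin_section x = image_projection (Poly_Mapping.single x 1)"

lemma section_realize: "lin_section (realize f) = image_projection f"
  unfolding lin_section_def by (rule image_projection_eqI) (simp add: realize_single)

lemma realize_section: "x \<in> carrier M \<Longrightarrow> realize (lin_section x) = x"
  by (simp add: lin_section_def realize_image_projection realize_single)

lemma image_projection_section: "x \<in> carrier M \<Longrightarrow> image_projection (lin_section x) = lin_section x"
  using section_realize[of "lin_section x"] by (simp add: realize_section)

lemma section_add:
  assumes "x \<in> carrier M" "y \<in> carrier M"
  shows "lin_section (x \<oplus>\<^bsub>M\<^esub> y) = lin_section x + lin_section y"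
proof -
  have "x \<oplus>\<^bsub>M\<^esub> y = realize (lin_section x + lin_section y)"
    by (simp add: realize_add realize_section assms)
  then show ?thesis
    by (simp only: section_realize image_projection_add image_projection_section assms)
qed

lemma section_scalar:
  assumes "x \<in> carrier M"
  shows "lin_section (scalar c \<odot>\<^bsub>M\<^esub> x) = cscale c (lin_section x)"
proof -
  have "scalar c \<odot>\<^bsub>M\<^esub> x = realize (cscale c (lin_section x))"
    by (simp add: realize_cscale realize_section assms)
  then show ?thesis
    by (simp only: section_realize image_projection_cscale image_projection_section assms)
qed

lemma section_zero: "lin_section \<zero>\<^bsub>M\<^esub> = 0"
  using section_add[of "\<zero>\<^bsub>M\<^esub>" "\<zero>\<^bsub>M\<^esub>"] by simp

definition proj :: "('m \<Rightarrow>\<^sub>0 complex) \<Rightarrow> 'm \<Rightarrow>\<^sub>0 complex" where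
  "proj f = lin_section (realize f)"

text \<open>This action is not unital: \<open>op 1\<close> is the projection \<open>proj\<close>
  onto the image of the section.\<close>

definition op :: "free_alg \<Rightarrow> ('m \<Rightarrow>\<^sub>0 complex) \<Rightarrow> 'm \<Rightarrow>\<^sub>0 complex" where
  "op p f = lin_section (cl p \<odot>\<^bsub>M\<^esub> realize f)"

lemma op_add: "op p (f + g) = op p f + op p g"
  by (simp add: op_def realize_add smult_r_distr section_add smult_closed)

lemma op_add_left: "op (p + q) f = op p f + op q f"
  by (simp add: op_def cl_add smult_l_distr section_add smult_closed)

lemma op_mult: "op p (op q f) = op (p * q) f"
  by (simp add: op_def cl_mult smult_assoc realize_section smult_closed)

lemma additive_op: "additive (op p)" "additive (\<lambda>p. op p f)"
  by (simp_all add: additive_def op_add op_add_left)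

lemma op_cong: "p - q \<in> conifold_ideal \<Longrightarrow> op p f = op q f"
  by (simp add: op_def cl_eq_iff[THEN iffD2])

lemma op_ideal: "p \<in> conifold_ideal \<Longrightarrow> op p f = 0"
  by (simp add: op_def cl_eq_zero_iff[THEN iffD2] zero_smult section_zero)

lemma proj_eq_op: "proj f = op 1 f"
  by (simp add: op_def cl_one smult_one proj_def)

lemma cscale_op: "cscale c (op p f) = op (Poly_Mapping.single 0 c * p) f"
  by (simp add: op_def cl_mult smult_assoc section_scalar smult_closed)

lemma op_cscale: "op p (cscale c f) = op (p * Poly_Mapping.single 0 c) f"
  by (simp add: op_def cl_mult smult_assoc realize_cscale)

lemma scalar_commute: "Poly_Mapping.single 0 c * p = p * Poly_Mapping.single (0::word) (c::complex)"
  by (rule additive_eqI_single[where f = "\<lambda>p. Poly_Mapping.single 0 c * p"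
        and g = "\<lambda>p. p * Poly_Mapping.single 0 c"])
    (simp_all add: additive_def distrib_left distrib_right mult_single mult.commute)

lemma op_linear: "op p (cscale c f) = cscale c (op p f)"
  by (simp only: op_cscale cscale_op scalar_commute)

lemma op_diff: "op p (f - g) = op p f - op p g"
  by (rule additive.diff[OF additive_op(1)])

lemma op_proj: "op p (proj f) = op p f" "proj (op p f) = op p f"
  by (simp_all add: proj_eq_op op_mult)

text \<open>The square of \<open>op free_Z\<close> is \<open>proj\<close>; the complementary
  projection is added to obtain an involution of the whole type.\<close>

definition Z_op :: "('m \<Rightarrow>\<^sub>0 complex) \<Rightarrow> 'm \<Rightarrow>\<^sub>0 complex" where
  "Z_op f = op free_Z f + (f - proj f)"

lemma op_module: "conifold_module cscale Z_op (op free_X) (op free_Y)"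
proof -
  have anti: "op free_X (op free_Z f) = - op free_Z (op free_X f)"
    "op free_Y (op free_Z f) = - op free_Z (op free_Y f)" for f
    using op_ideal[OF relation_in_ideal, of "free_X * free_Z + free_Z * free_X" f]
      op_ideal[OF relation_in_ideal, of "free_Y * free_Z + free_Z * free_Y" f]
    by (simp_all add: conifold_relations_def op_mult op_add_left eq_neg_iff_add_eq_0)
  have com: "op free_X (op free_X (op free_Y f)) = op free_Y (op free_X (op free_X f))"
    "op free_Y (op free_Y (op free_X f)) = op free_X (op free_Y (op free_Y f))" for f
    unfolding op_mult
    by (rule op_cong, rule relation_in_ideal,
        simp add: conifold_relations_def commutator_def power2_eq_square mult.assoc)+
  have ZZ: "op free_Z (op free_Z f) = proj f" for f
    unfolding op_mult proj_eq_op
    by (rule op_cong, rule relation_in_ideal, simp add: conifold_relations_def power2_eq_square)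
  note simps = Z_op_def op_add op_diff op_linear op_proj proj_eq_op[symmetric]
  have proj: "proj (f + g) = proj f + proj g" "proj (f - g) = proj f - proj g"
    "proj (cscale c f) = cscale c (proj f)" "proj (proj f) = proj f" for f g c
    by (simp_all add: proj_eq_op op_add op_diff op_linear op_mult)
  show ?thesis
  proof (unfold_locales, goal_cases)
    case (5 x y)
    then show ?case by (simp add: simps proj)
  next
    case (6 c w)
    then show ?case
      by (simp add: simps proj cscale.scale_right_diff_distrib cscale.scale_right_distrib)
  next
    case (7 w)
    then show ?case by (simp add: simps proj ZZ)
  next
    case (12 w)
    then show ?case by (simp add: simps anti)
  next
    case (13 w)
    then show ?case by (simp add: simps anti)
  qed (simp_all add: op_add op_linear com cscale.scale_right_distrib cscale.scale_left_distrib)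
qed

end

context conifold_left_module
begin

lemma op_single: "op (Poly_Mapping.single u c) f = cscale c (op (Poly_Mapping.single u 1) f)"
proof -
  have "Poly_Mapping.single u c = Poly_Mapping.single 0 c * Poly_Mapping.single u 1"
    by (simp add: mult_single)
  then show ?thesis
    by (simp only: cscale_op)
qed

interpretation W: conifold_module cscale Z_op "op free_X" "op free_Y"
  by (rule op_module)

lemma proj_add: "proj (f + g) = proj f + proj g"
  by (simp add: proj_eq_op op_add)

lemma proj_cscale: "proj (cscale c f) = cscale c (proj f)"
  by (simp add: proj_eq_op op_linear)

lemma proj_diff: "proj (f - g) = proj f - proj g"
  by (simp add: proj_eq_op op_diff)

lemma proj_Z_op: "proj (Z_op f) = op free_Z f"
  by (simp add: Z_op_def proj_add proj_diff op_proj)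
    (simp add: proj_eq_op op_mult)

lemma Z_op_proj: "Z_op (proj f) = op free_Z f"
  by (simp add: Z_op_def op_proj) (simp add: proj_eq_op op_mult)

text \<open>The module operators and \<open>op\<close> differ by vectors that \<open>proj\<close>
  kills; for instance the empty word acts as the identity on one side and as \<open>proj\<close> on
  the other.\<close>

lemma proj_free_op: "proj (W.free_op p f) = op p f"
proof -
  have word: "proj (W.word_op us f) = op (Poly_Mapping.single (Word us) 1) f" for us
  proof (induction us)
    case Nil
    show ?case
      by (simp add: word_act_def proj_eq_op flip: zero_word_def)
  next
    case (Cons g us)
    have "proj (W.word_op (g # us) f) =
        op (Poly_Mapping.single (Word [g]) 1) (proj (W.word_op us f))"
      by (cases g)
        (simp_all add: word_act_def op_proj proj_Z_op flip: free_X_def free_Y_def free_Z_def)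
    then show ?case
      by (simp add: Cons op_mult mult_single plus_word_def)
  qed
  show ?thesis
  proof (rule additive_eqI_single[where f = "\<lambda>p. proj (W.free_op p f)" and g = "\<lambda>p. op p f"])
    fix u c
    show "proj (W.free_op (Poly_Mapping.single u c) f) = op (Poly_Mapping.single u c) f"
      using word[of "letters u"] by (simp add: W.free_op_single proj_cscale op_single[of u c])
  qed (simp_all add: additive_def W.free_op_add proj_add op_add_left)
qed

lemma realize_proj: "realize (proj f) = realize f"
  by (simp add: proj_def realize_section)

lemma realize_free_op: "realize (W.free_op p f) = cl p \<odot>\<^bsub>M\<^esub> realize f"
proof -
  have "realize (W.free_op p f) = realize (op p f)"
    by (simp flip: realize_proj[of "W.free_op p f"] add: proj_free_op)
  then show ?thesis
    by (simp add: op_def realize_section smult_closed)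
qed

end

subsection \<open>Normal forms\<close>

definition pair_scale :: "complex \<Rightarrow> complex \<times> complex \<Rightarrow> complex \<times> complex" where
  "pair_scale c = map_prod ((*) c) ((*) c)"

lemma pair_scale_simp [simp]: "pair_scale c (a, b) = (c * a, c * b)"
  by (simp add: pair_scale_def)

text \<open>The group algebra of {1, Z}: the pair (a, b) is a + b Z, and Z exchanges the
  entries.\<close>

interpretation group_alg: sign_module pair_scale prod.swap
  by unfold_locales (auto simp: pair_scale_def algebra_simps zero_prod_def)

interpretation nf: conifold_module group_alg.sc3 group_alg.Z3 left_X left_Y
  by (rule group_alg.induced_module)

definition nf_one :: "(complex \<times> complex) poly3" where
  "nf_one = const3 (1, 0)"

definition nf :: "free_alg \<Rightarrow> (complex \<times> complex) poly3" where
  "nf p = nf.free_op p nf_one"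

lemma nf_add: "nf (p + q) = nf p + nf q"
  and nf_diff: "nf (p - q) = nf p - nf q"
  and nf_zero: "nf 0 = 0"
  and nf_mult: "nf (p * q) = nf.free_op p (nf q)"
  and nf_1: "nf 1 = nf_one"
  by (simp_all add: nf_def nf.free_op_simps)

context sign_module
begin

text \<open>The map from the group algebra to W that sends 1 to w and respects Z.\<close>

definition orbit_map :: "'w \<Rightarrow> complex \<times> complex \<Rightarrow> 'w" where
  "orbit_map w v = sc (fst v) w + sc (snd v) (Zo w)"

lemma additive_orbit_map: "additive (orbit_map w)"
  by (rule additive.intro) (simp add: orbit_map_def sc_add_left)

lemma orbit_map_scale: "orbit_map w (pair_scale c v) = sc c (orbit_map w v)"
  by (simp add: orbit_map_def pair_scale_def sc_add sc_mult)

lemma orbit_map_swap: "orbit_map w (prod.swap v) = Zo (orbit_map w v)"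
  by (simp add: orbit_map_def Z_add Z_sc Z_Z add.commute)

lemma orbit_map_one: "orbit_map w (1, 0) = w"
  by (simp add: orbit_map_def sc_one sc_zero_left)

lemma lift3_orbit_map_hom:
  "conifold_hom group_alg.sc3 group_alg.Z3 left_X left_Y sc3 Z3 left_X left_Y (lift3 (orbit_map w))"
  by (rule lift3_hom[OF group_alg.sign_module_axioms sign_module_axioms]) (rule additive_orbit_map orbit_map_scale orbit_map_swap)+

lemma free_op_const3: "free_act sc3 Z3 left_X left_Y p (const3 w) = lift3 (orbit_map w) (nf p)"
proof -
  interpret h: conifold_hom group_alg.sc3 group_alg.Z3 left_X left_Y sc3 Z3 left_X left_Y
    "lift3 (orbit_map w)"
    by (rule lift3_orbit_map_hom)
  show ?thesis
    by (simp add: nf_def h.hom_free_op nf_one_def lift3_const[OF additive_orbit_map] orbit_map_one)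
qed

end

context conifold_module
begin

text \<open>The vector w is the image of 1 \<otimes> w under the action map, and 1 \<otimes> w is
  the image of 1 \<otimes> 1 under the map induced by \<open>orbit_map w\<close>. Both maps are
  linear over the free algebra, so they carry \<open>nf p\<close> to p w.\<close>

lemma free_op_eq_nf: "free_op p w = aug (lift3 (orbit_map w) (nf p))"
proof -
  interpret h: conifold_hom sc3 Z3 left_X left_Y sc Zo Xo Yo aug
    by (rule aug_hom)
  show ?thesis
    by (simp add: h.hom_free_op aug_const3 flip: free_op_const3)
qed

end

lemma left_module_regular:
  assumes "ring R"
  shows "left_module R (regular_module R)"
proof -
  interpret ring R by fact
  have "abelian_group (regular_module R)"
  proof (rule abelian_groupI)
    fix x assume "x \<in> carrier (regular_module R)"
    then show "\<exists>y\<in>carrier (regular_module R). y \<oplus>\<^bsub>regular_module R\<^esub> x = \<zero>\<^bsub>regular_module R\<^esub>"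
      by (intro bexI[of _ "\<ominus>\<^bsub>R\<^esub> x"]) (simp_all add: regular_module_def l_neg)
  qed (auto simp: regular_module_def a_ac)
  then show ?thesis
    by (intro left_module.intro left_module_axioms.intro assms)
      (auto simp: regular_module_def l_distr r_distr m_assoc)
qed

text \<open>An element with normal form 0 kills every module, in particular the vector 1 of the
  regular one.\<close>

lemma (in conifold_quotient) nf_zero_imp_ideal:
  assumes "nf p = 0"
  shows "p \<in> conifold_ideal"
proof -
  interpret reg: conifold_left_module R cl "regular_module R"
    by (intro conifold_left_module.intro left_module_regular conifold_quotient_axioms local.ring_axioms)
  interpret W: conifold_module cscale reg.Z_op "reg.op free_X" "reg.op free_Y"
    by (rule reg.op_module)
  let ?w = "reg.lin_section \<one>\<^bsub>R\<^esub>"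
  have 1: "\<one>\<^bsub>R\<^esub> \<in> carrier (regular_module R)"
    by (simp add: regular_module_def)
  have "W.free_op p ?w = 0"
    by (simp add: W.free_op_eq_nf assms lift3_zero[OF W.additive_orbit_map] additive.zero[OF W.additive_aug(1)])
  then have "cl p \<odot>\<^bsub>regular_module R\<^esub> \<one>\<^bsub>R\<^esub> = \<zero>\<^bsub>regular_module R\<^esub>"
    using reg.realize_free_op[of p ?w] by (simp add: reg.realize_section[OF 1] reg.realize_zero)
  then show ?thesis
    by (simp add: regular_module_def cl_eq_zero_iff)
qed

interpretation conifold: conifold_quotient conifold conifold_class
proof (intro conifold_quotient.intro conifold_quotient_axioms.intro)
  interpret conifold_ideal: ideal conifold_ideal "ring_of_type_algebra :: free_alg ring"
    by (rule ideal_conifold)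
  let ?T = "ring_of_type_algebra :: free_alg ring"
  have hom: "conifold_class \<in> ring_hom ?T conifold"
    using conifold_ideal.rcos_ring_hom by (simp add: conifold_def conifold_class_def[abs_def])
  show "ring conifold"
    unfolding conifold_def by (rule conifold_ideal.quotient_is_ring)
  show "conifold_class (p + q) = conifold_class p \<oplus>\<^bsub>conifold\<^esub> conifold_class q" for p q
    using ring_hom_add[OF hom, of p q] by (simp add: ring_of_type_algebra_def)
  show "conifold_class (p * q) = conifold_class p \<otimes>\<^bsub>conifold\<^esub> conifold_class q" for p q
    using ring_hom_mult[OF hom, of p q] by (simp add: ring_of_type_algebra_def)
  show "conifold_class 1 = \<one>\<^bsub>conifold\<^esub>"
    using ring_hom_one[OF hom] by (simp add: ring_of_type_algebra_def)
  show "carrier conifold = range conifold_class"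
    by (auto simp: conifold_def FactRing_def A_RCOSETS_def' conifold_class_def ring_of_type_algebra_def)
  show "conifold_class p = \<zero>\<^bsub>conifold\<^esub> \<longleftrightarrow> p \<in> conifold_ideal" for p
    unfolding conifold_def conifold_class_def FactRing_def
    using conifold_ideal.a_rcos_const[of p] conifold_ideal.rcos_const_imp_mem[of p]
    by (auto simp: ring_of_type_algebra_def)
qed

lemma nf_eq_zero_iff: "nf p = 0 \<longleftrightarrow> p \<in> conifold_ideal"
  using conifold.nf_zero_imp_ideal nf.free_op_ideal by (auto simp: nf_def)

definition free_z :: free_alg where
  "free_z = Poly_Mapping.single 0 (1/2) * (free_X * free_Y + free_Y * free_X)"

lemma (in conifold_module) free_op_z: "free_op free_z w = zop w"
  by (simp add: free_z_def free_op_simps zop_def)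

lemma (in sign_module) zop_induced: "conifold_module.zop sc3 left_X left_Y = left_z"
proof -
  interpret F: conifold_module sc3 Z3 left_X left_Y
    by (rule induced_module)
  show ?thesis
    using F.sc_half by (auto simp: F.zop_def left_YX F.sc_add)
qed

lemma nf_surj: "\<exists>p. nf p = f"
proof (induction f rule: poly3_mono_induct)
  case (1 w k j i)
  \<comment> \<open>The pair w = (a, b) is the normal form of a + Z b; multiplying from the left by
    z^i X^j Y^k moves it to its place.\<close>
  define gen where "gen = Poly_Mapping.single 0 (fst w) + free_Z * Poly_Mapping.single 0 (snd w)"
  have "nf gen = group_alg.sc3 (fst w) nf_one + group_alg.Z3 (group_alg.sc3 (snd w) nf_one)"
    by (simp add: gen_def nf_def nf.free_op_simps)
  also have "\<dots> = const3 w"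
    by (rule poly3_eqI)
      (auto simp: nf_one_def c3_lift3 c3_const3 c3_flip_XY pair_scale_def zero_prod_def prod_eq_iff)
  finally have "nf (free_z ^ i * (free_X ^ j * (free_Y ^ k * gen))) = mono3 w k j i"
    unfolding mono3_eq_funpow
    by (induction i; induction j; induction k)
      (simp_all add: nf_mult nf.free_op_simps mult.assoc nf.free_op_z group_alg.zop_induced)
  then show ?case by blast
next
  case (2 f g)
  then show ?case by (metis nf_add)
qed

context conifold_quotient
begin

lemma cl_eq_iff_nf: "cl p = cl q \<longleftrightarrow> nf p = nf q"
  using nf_eq_zero_iff[of "p - q"] by (simp add: cl_eq_iff nf_diff)

definition rep :: "'a \<Rightarrow> free_alg" where
  "rep a = (SOME p. cl p = a)"

lemma cl_rep: "a \<in> carrier R \<Longrightarrow> cl (rep a) = a"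
  unfolding rep_def by (rule someI_ex) (auto simp: carrier_eq)

text \<open>Inverse to \<open>elt\<close> on the carrier; the two identify the ring, as a left
  module over itself, with S \<otimes> W for W the group algebra of {1, Z}.\<close>

definition coords :: "'a \<Rightarrow> (complex \<times> complex) poly3" where
  "coords a = nf (rep a)"

definition elt :: "(complex \<times> complex) poly3 \<Rightarrow> 'a" where
  "elt f = cl (SOME p. nf p = f)"

lemma coords_cl [simp]: "coords (cl p) = nf p"
  using cl_rep[of "cl p"] by (simp add: coords_def cl_eq_iff_nf)

lemma elt_nf [simp]: "elt (nf p) = cl p"
  unfolding elt_def cl_eq_iff_nf by (rule someI_ex) blast

lemma elt_closed [simp]: "elt f \<in> carrier R"
  by (simp add: elt_def)

lemma coords_elt [simp]: "coords (elt f) = f"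
  using nf_surj[of f] by auto

lemma elt_coords: "a \<in> carrier R \<Longrightarrow> elt (coords a) = a"
  by (auto elim: carrier_cases)

lemma elt_add: "elt (f + g) = elt f \<oplus>\<^bsub>R\<^esub> elt g"
  using nf_surj[of f] nf_surj[of g] by (metis elt_nf nf_add cl_add)

lemma coords_add: "a \<in> carrier R \<Longrightarrow> b \<in> carrier R \<Longrightarrow> coords (a \<oplus>\<^bsub>R\<^esub> b) = coords a + coords b"
  by (metis coords_elt elt_add elt_coords)

lemma elt_zero: "elt 0 = \<zero>\<^bsub>R\<^esub>"
  by (metis elt_nf nf_zero cl_zero)

lemma coords_zero: "coords \<zero>\<^bsub>R\<^esub> = 0"
  by (metis coords_elt elt_zero)

lemma elt_act: "elt (nf.free_op p f) = cl p \<otimes>\<^bsub>R\<^esub> elt f"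
  using nf_surj[of f] by (metis elt_nf nf_mult cl_mult)

lemma coords_mult: "a \<in> carrier R \<Longrightarrow> coords (cl p \<otimes>\<^bsub>R\<^esub> a) = nf.free_op p (coords a)"
  by (metis coords_elt elt_act elt_coords)

lemma coords_eq_iff: "a \<in> carrier R \<Longrightarrow> b \<in> carrier R \<Longrightarrow> coords a = coords b \<longleftrightarrow> a = b"
  by (metis elt_coords)

end

section \<open>Projective modules\<close>

lemma left_module_homD:
  assumes "h \<in> left_module_hom R M N"
  shows "x \<in> carrier M \<Longrightarrow> h x \<in> carrier N"
    and "x \<in> carrier M \<Longrightarrow> y \<in> carrier M \<Longrightarrow> h (x \<oplus>\<^bsub>M\<^esub> y) = h x \<oplus>\<^bsub>N\<^esub> h y"
    and "a \<in> carrier R \<Longrightarrow> x \<in> carrier M \<Longrightarrow> h (a \<odot>\<^bsub>M\<^esub> x) = a \<odot>\<^bsub>N\<^esub> h x"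
  using assms by (auto simp: left_module_hom_def)

lemma left_module_homI:
  assumes "\<And>x. x \<in> carrier M \<Longrightarrow> h x \<in> carrier N"
    and "\<And>x y. x \<in> carrier M \<Longrightarrow> y \<in> carrier M \<Longrightarrow> h (x \<oplus>\<^bsub>M\<^esub> y) = h x \<oplus>\<^bsub>N\<^esub> h y"
    and "\<And>a x. a \<in> carrier R \<Longrightarrow> x \<in> carrier M \<Longrightarrow> h (a \<odot>\<^bsub>M\<^esub> x) = a \<odot>\<^bsub>N\<^esub> h x"
  shows "h \<in> left_module_hom R M N"
  using assms by (auto simp: left_module_hom_def)

lemma left_module_hom_comp:
  "f \<in> left_module_hom R M N \<Longrightarrow> g \<in> left_module_hom R N P \<Longrightarrow> (\<lambda>x. g (f x)) \<in> left_module_hom R M P"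
  by (auto simp: left_module_hom_def Pi_def)

lemma left_module_hom_zero:
  assumes "left_module R M" "left_module R N" "h \<in> left_module_hom R M N"
  shows "h \<zero>\<^bsub>M\<^esub> = \<zero>\<^bsub>N\<^esub>"
proof -
  interpret M: left_module R M by fact
  interpret N: left_module R N by fact
  show ?thesis
    using left_module_homD(3)[OF assms(3), of "\<zero>\<^bsub>R\<^esub>" "\<zero>\<^bsub>M\<^esub>"] left_module_homD(1)[OF assms(3), of "\<zero>\<^bsub>M\<^esub>"]
    by (simp add: M.zero_smult N.zero_smult)
qed

context left_module
begin

lemma left_module_hom_diff:
  assumes "f \<in> left_module_hom R P M" "g \<in> left_module_hom R P M" "left_module R P"
  shows "(\<lambda>x. f x \<ominus>\<^bsub>M\<^esub> g x) \<in> left_module_hom R P M"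
proof -
  interpret P: left_module R P by fact
  have minus: "\<ominus>\<^bsub>M\<^esub> (a \<odot>\<^bsub>M\<^esub> x) = a \<odot>\<^bsub>M\<^esub> (\<ominus>\<^bsub>M\<^esub> x)" if "a \<in> carrier R" "x \<in> carrier M" for a x
    using that smult_r_distr[of a "\<ominus>\<^bsub>M\<^esub> x" x]
    by (intro M.minus_equality) (simp_all add: smult_closed smult_zero M.l_neg)
  show ?thesis
  proof (rule left_module_homI)
    fix x y assume xy: "x \<in> carrier P" "y \<in> carrier P"
    then have "f x \<in> carrier M" "f y \<in> carrier M" "g x \<in> carrier M" "g y \<in> carrier M"
      using assms left_module_homD(1) by metis+
    then show "f (x \<oplus>\<^bsub>P\<^esub> y) \<ominus>\<^bsub>M\<^esub> g (x \<oplus>\<^bsub>P\<^esub> y) = f x \<ominus>\<^bsub>M\<^esub> g x \<oplus>\<^bsub>M\<^esub> (f y \<ominus>\<^bsub>M\<^esub> g y)"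
      using xy by (simp add: left_module_homD(2)[OF assms(1)] left_module_homD(2)[OF assms(2)]
          a_minus_def M.minus_add M.a_ac)
  qed (use assms in \<open>auto simp: left_module_homD a_minus_def smult_r_distr minus\<close>)
qed

definition free_extension :: "'i set \<Rightarrow> ('i \<Rightarrow> 'm) \<Rightarrow> ('i \<Rightarrow> 'a) \<Rightarrow> 'm" where
  "free_extension I v f = finsum M (\<lambda>i. f i \<odot>\<^bsub>M\<^esub> v i) {i \<in> I. f i \<noteq> \<zero>\<^bsub>R\<^esub>}"

lemma free_extension_superset:
  assumes "f \<in> carrier (free_left_module R I)" "\<And>i. i \<in> I \<Longrightarrow> v i \<in> carrier M"
    and "finite A" "{i \<in> I. f i \<noteq> \<zero>\<^bsub>R\<^esub>} \<subseteq> A" "A \<subseteq> I"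
  shows "free_extension I v f = finsum M (\<lambda>i. f i \<odot>\<^bsub>M\<^esub> v i) A"
  unfolding free_extension_def using assms
  by (intro M.finsum_neutral_left) (auto simp: free_left_module_def zero_smult intro!: smult_closed)

lemma free_extension_hom:
  assumes v: "\<And>i. i \<in> I \<Longrightarrow> v i \<in> carrier M"
  shows "free_extension I v \<in> left_module_hom R (free_left_module R I) M"
proof (rule left_module_homI)
  let ?F = "free_left_module R I"
  let ?s = "\<lambda>f. {i \<in> I. f i \<noteq> \<zero>\<^bsub>R\<^esub>}"
  have mem: "f i \<in> carrier R" if "f \<in> carrier ?F" "i \<in> I" for f i
    using that by (auto simp: free_left_module_def)
  have fin: "finite (?s f)" if "f \<in> carrier ?F" for f
    using that by (auto simp: free_left_module_def)
  show "free_extension I v f \<in> carrier M" if "f \<in> carrier ?F" for f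
    unfolding free_extension_def by (intro M.finsum_closed) (auto simp: mem that v smult_closed)
  show "free_extension I v (f \<oplus>\<^bsub>?F\<^esub> g) = free_extension I v f \<oplus>\<^bsub>M\<^esub> free_extension I v g"
    if f: "f \<in> carrier ?F" and g: "g \<in> carrier ?F" for f g
  proof -
    let ?A = "?s f \<union> ?s g"
    have add: "(f \<oplus>\<^bsub>?F\<^esub> g) i = f i \<oplus>\<^bsub>R\<^esub> g i" if "i \<in> I" for i
      using that by (simp add: free_left_module_def)
    have sub: "?s (f \<oplus>\<^bsub>?F\<^esub> g) \<subseteq> ?A"
      using add by auto
    have A: "finite ?A"
      using f g fin by simp
    have fg: "f \<oplus>\<^bsub>?F\<^esub> g \<in> carrier ?F"
      using f g finite_subset[OF sub A] mem by (auto simp: free_left_module_def)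
    have "free_extension I v (f \<oplus>\<^bsub>?F\<^esub> g) = finsum M (\<lambda>i. (f \<oplus>\<^bsub>?F\<^esub> g) i \<odot>\<^bsub>M\<^esub> v i) ?A"
      by (rule free_extension_superset[OF fg v A sub]) auto
    also have "\<dots> = finsum M (\<lambda>i. f i \<odot>\<^bsub>M\<^esub> v i \<oplus>\<^bsub>M\<^esub> g i \<odot>\<^bsub>M\<^esub> v i) ?A"
      by (intro M.finsum_cong') (auto simp: add smult_l_distr mem f g v smult_closed)
    also have "\<dots> = finsum M (\<lambda>i. f i \<odot>\<^bsub>M\<^esub> v i) ?A \<oplus>\<^bsub>M\<^esub> finsum M (\<lambda>i. g i \<odot>\<^bsub>M\<^esub> v i) ?A"
      by (intro M.finsum_addf) (auto simp: mem f g v smult_closed)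
    also have "finsum M (\<lambda>i. f i \<odot>\<^bsub>M\<^esub> v i) ?A = free_extension I v f"
      by (intro free_extension_superset[symmetric] f v A) auto
    also have "finsum M (\<lambda>i. g i \<odot>\<^bsub>M\<^esub> v i) ?A = free_extension I v g"
      by (intro free_extension_superset[symmetric] g v A) auto
    finally show ?thesis .
  qed
  show "free_extension I v (a \<odot>\<^bsub>?F\<^esub> f) = a \<odot>\<^bsub>M\<^esub> free_extension I v f"
    if a: "a \<in> carrier R" and f: "f \<in> carrier ?F" for a f
  proof -
    have sm: "(a \<odot>\<^bsub>?F\<^esub> f) i = a \<otimes>\<^bsub>R\<^esub> f i" if "i \<in> I" for i
      using that by (simp add: free_left_module_def)
    have sub: "?s (a \<odot>\<^bsub>?F\<^esub> f) \<subseteq> ?s f"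
      using sm a by auto
    have af: "a \<odot>\<^bsub>?F\<^esub> f \<in> carrier ?F"
      using a f finite_subset[OF sub fin[OF f]] mem by (auto simp: free_left_module_def)
    have "free_extension I v (a \<odot>\<^bsub>?F\<^esub> f) = finsum M (\<lambda>i. (a \<odot>\<^bsub>?F\<^esub> f) i \<odot>\<^bsub>M\<^esub> v i) (?s f)"
      by (rule free_extension_superset[OF af v fin[OF f] sub]) auto
    also have "\<dots> = finsum M (\<lambda>i. a \<odot>\<^bsub>M\<^esub> (f i \<odot>\<^bsub>M\<^esub> v i)) (?s f)"
      by (intro M.finsum_cong') (auto simp: sm smult_assoc mem f v a smult_closed)
    also have "\<dots> = a \<odot>\<^bsub>M\<^esub> free_extension I v f"
      unfolding free_extension_def
      by (rule smult_finsum[symmetric]) (auto simp: a fin f mem v smult_closed)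
    finally show ?thesis .
  qed
qed

text \<open>The dual basis lemma. The index set lies in the type \<open>'m\<close>, as the
  definition of a projective module takes it from there.\<close>

lemma projective_dual_basis:
  fixes I :: "'m set"
  assumes j: "\<And>i. i \<in> I \<Longrightarrow> j i \<in> left_module_hom R M (regular_module R)"
    and fin: "\<And>x. x \<in> carrier M \<Longrightarrow> finite {i \<in> I. j i x \<noteq> \<zero>\<^bsub>R\<^esub>}"
    and v: "\<And>i. i \<in> I \<Longrightarrow> v i \<in> carrier M"
    and sum: "\<And>x. x \<in> carrier M \<Longrightarrow> finsum M (\<lambda>i. j i x \<odot>\<^bsub>M\<^esub> v i) {i \<in> I. j i x \<noteq> \<zero>\<^bsub>R\<^esub>} = x"
  shows "projective_left_module R M"
proof -
  let ?F = "free_left_module R I"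
  let ?j = "\<lambda>x. \<lambda>i\<in>I. j i x"
  have jc: "j i x \<in> carrier R" if "i \<in> I" "x \<in> carrier M" for i x
    using left_module_homD(1)[OF j[OF that(1)] that(2)] by (simp add: regular_module_def)
  have "?j \<in> left_module_hom R M ?F"
  proof (rule left_module_homI)
    fix x assume x: "x \<in> carrier M"
    have "{i \<in> I. ?j x i \<noteq> \<zero>\<^bsub>R\<^esub>} = {i \<in> I. j i x \<noteq> \<zero>\<^bsub>R\<^esub>}" by auto
    then show "?j x \<in> carrier ?F"
      using fin[OF x] jc[OF _ x] by (auto simp: free_left_module_def)
  next
    fix x y assume xy: "x \<in> carrier M" "y \<in> carrier M"
    have "j i (x \<oplus>\<^bsub>M\<^esub> y) = j i x \<oplus>\<^bsub>R\<^esub> j i y" if "i \<in> I" for i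
      using left_module_homD(2)[OF j[OF that] xy] by (simp add: regular_module_def)
    then show "?j (x \<oplus>\<^bsub>M\<^esub> y) = ?j x \<oplus>\<^bsub>?F\<^esub> ?j y"
      by (auto simp: free_left_module_def fun_eq_iff)
  next
    fix a x assume ax: "a \<in> carrier R" "x \<in> carrier M"
    have "j i (a \<odot>\<^bsub>M\<^esub> x) = a \<otimes>\<^bsub>R\<^esub> j i x" if "i \<in> I" for i
      using left_module_homD(3)[OF j[OF that] ax] by (simp add: regular_module_def)
    then show "?j (a \<odot>\<^bsub>M\<^esub> x) = a \<odot>\<^bsub>?F\<^esub> ?j x"
      by (auto simp: free_left_module_def fun_eq_iff)
  qed
  moreover have "free_extension I v (?j x) = x" if "x \<in> carrier M" for x
  proof -
    have supp: "{i \<in> I. ?j x i \<noteq> \<zero>\<^bsub>R\<^esub>} = {i \<in> I. j i x \<noteq> \<zero>\<^bsub>R\<^esub>}" by auto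
    have "free_extension I v (?j x) = finsum M (\<lambda>i. j i x \<odot>\<^bsub>M\<^esub> v i) {i \<in> I. j i x \<noteq> \<zero>\<^bsub>R\<^esub>}"
      unfolding free_extension_def supp
      by (intro M.finsum_cong') (auto simp: jc v that smult_closed)
    then show ?thesis
      using sum[OF that] by simp
  qed
  ultimately show ?thesis
    unfolding projective_left_module_def
    using free_extension_hom[of I v, OF v] left_module_axioms
    by (intro conjI exI[of _ I] exI[of _ ?j] exI[of _ "free_extension I v"] ballI)
qed

definition free_basis :: "'i set \<Rightarrow> 'i \<Rightarrow> 'i \<Rightarrow> 'a" where
  "free_basis I k = (\<lambda>i\<in>I. if i = k then \<one>\<^bsub>R\<^esub> else \<zero>\<^bsub>R\<^esub>)"

lemma free_basis_closed: "i \<in> I \<Longrightarrow> free_basis I i \<in> carrier (free_left_module R I)"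
  by (auto simp: free_basis_def free_left_module_def intro: finite_subset[of _ "{i}"])

lemma free_extension_basis:
  assumes "\<And>i. i \<in> I \<Longrightarrow> v i \<in> carrier M" "i \<in> I"
  shows "free_extension I v (free_basis I i) = v i"
proof -
  have "free_extension I v (free_basis I i) = finsum M (\<lambda>k. free_basis I i k \<odot>\<^bsub>M\<^esub> v k) {i}"
    using assms
    by (intro free_extension_superset free_basis_closed) (auto simp: free_basis_def split: if_splits)
  then show ?thesis
    using assms by (simp add: M.finsum_insert free_basis_def smult_one)
qed

lemma hom_eq_free_extension:
  assumes G: "G \<in> left_module_hom R (free_left_module R I) M" and f: "f \<in> carrier (free_left_module R I)"
  shows "G f = free_extension I (\<lambda>i. G (free_basis I i)) f"
proof -
  let ?F = "free_left_module R I"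
  note basis = free_basis_closed[of _ I]
  have v: "G (free_basis I i) \<in> carrier M" if "i \<in> I" for i
    using left_module_homD(1)[OF G basis[OF that]] .
  have zero: "G \<zero>\<^bsub>?F\<^esub> = \<zero>\<^bsub>M\<^esub>"
  proof -
    have z: "\<zero>\<^bsub>?F\<^esub> \<in> carrier ?F" "\<zero>\<^bsub>?F\<^esub> \<oplus>\<^bsub>?F\<^esub> \<zero>\<^bsub>?F\<^esub> = \<zero>\<^bsub>?F\<^esub>"
      by (auto simp: free_left_module_def fun_eq_iff)
    have "G \<zero>\<^bsub>?F\<^esub> \<oplus>\<^bsub>M\<^esub> G \<zero>\<^bsub>?F\<^esub> = G \<zero>\<^bsub>?F\<^esub>"
      using left_module_homD(2)[OF G z(1) z(1)] z(2) by simp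
    then show ?thesis
      using left_module_homD(1)[OF G z(1)] by (metis M.add.l_cancel_one')
  qed
  \<comment> \<open>Induction on a finite set A containing the support: erasing the index k from f
    leaves a function supported in the smaller set.\<close>
  have "G f = free_extension I (\<lambda>i. G (free_basis I i)) f"
    if "finite A" "A \<subseteq> I" "{i \<in> I. f i \<noteq> \<zero>\<^bsub>R\<^esub>} \<subseteq> A" "f \<in> carrier ?F" for A f
    using that
  proof (induction A arbitrary: f rule: finite_induct)
    case empty
    have "f = \<zero>\<^bsub>?F\<^esub>"
    proof
      fix i
      show "f i = \<zero>\<^bsub>?F\<^esub> i"
        using empty by (cases "i \<in> I") (auto simp: free_left_module_def dest: PiE_arb)
    qed
    then have "G f = \<zero>\<^bsub>M\<^esub>"
      using zero by metis
    moreover have supp: "{i \<in> I. f i \<noteq> \<zero>\<^bsub>R\<^esub>} = {}"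
      using empty by simp
    ultimately show ?case
      unfolding free_extension_def supp by simp
  next
    case (insert k A)
    have f: "f i \<in> carrier R" if "i \<in> I" for i
      using insert.prems(3) that by (auto simp: free_left_module_def)
    define g where "g = (\<lambda>i\<in>I. if i = k then \<zero>\<^bsub>R\<^esub> else f i)"
    have supp: "{i \<in> I. g i \<noteq> \<zero>\<^bsub>R\<^esub>} \<subseteq> A"
      using insert.prems(2) by (auto simp: g_def split: if_splits)
    then have g: "g \<in> carrier ?F"
      using f finite_subset[OF supp insert.hyps(1)] by (auto simp: free_left_module_def g_def)
    have k: "k \<in> I"
      using insert.prems by simp
    have kb: "f k \<odot>\<^bsub>?F\<^esub> free_basis I k \<in> carrier ?F"
      using f[OF k] by (auto simp: free_left_module_def free_basis_def k intro: finite_subset[of _ "{k}"])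
    have eq: "f = g \<oplus>\<^bsub>?F\<^esub> (f k \<odot>\<^bsub>?F\<^esub> free_basis I k)"
    proof
      fix i
      show "f i = (g \<oplus>\<^bsub>?F\<^esub> (f k \<odot>\<^bsub>?F\<^esub> free_basis I k)) i"
        using f[of i] f[OF k] insert.prems(3)
        by (cases "i \<in> I") (auto simp: free_left_module_def g_def free_basis_def dest: PiE_arb)
    qed
    let ?e = "free_extension I (\<lambda>i. G (free_basis I i))"
    have E: "?e \<in> left_module_hom R ?F M"
      by (rule free_extension_hom) (rule v)
    have b: "?e (free_basis I k) = G (free_basis I k)"
      using v k by (rule free_extension_basis)
    note split = arg_cong[where f = G, OF eq] arg_cong[where f = ?e, OF eq]
    have "G f = G g \<oplus>\<^bsub>M\<^esub> f k \<odot>\<^bsub>M\<^esub> G (free_basis I k)"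
      unfolding split(1) left_module_homD(2)[OF G g kb] left_module_homD(3)[OF G f[OF k] basis[OF k]] ..
    also have "\<dots> = ?e g \<oplus>\<^bsub>M\<^esub> f k \<odot>\<^bsub>M\<^esub> ?e (free_basis I k)"
      using insert.IH[OF _ supp g] insert.prems(1) b by simp
    also have "\<dots> = ?e f"
      unfolding split(2) left_module_homD(2)[OF E g kb] left_module_homD(3)[OF E f[OF k] basis[OF k]] ..
    finally show ?case .
  qed
  moreover have "finite {i \<in> I. f i \<noteq> \<zero>\<^bsub>R\<^esub>}"
    using f by (auto simp: free_left_module_def)
  ultimately show ?thesis
    using f by blast
qed

end

text \<open>In place of surjectivity of g the image of h is required to lie in that of g, so that
  exactness at any term of a resolution can be used directly.\<close>

lemma projective_lift:
  fixes P :: "('a, 'p, 'x) module_scheme" and A :: "('a, 'm, 'y) module_scheme"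
    and B :: "('a, 'n, 'z) module_scheme"
  assumes P: "projective_left_module R P" and A: "left_module R A" and B: "left_module R B"
    and g: "g \<in> left_module_hom R A B" and h: "h \<in> left_module_hom R P B"
    and sub: "h ` carrier P \<subseteq> g ` carrier A"
  obtains f where "f \<in> left_module_hom R P A" "\<And>x. x \<in> carrier P \<Longrightarrow> g (f x) = h x"
proof -
  interpret P: left_module R P
    using P by (simp add: projective_left_module_def)
  interpret A: left_module R A by (rule A)
  interpret B: left_module R B by (rule B)
  obtain I :: "'p set" and j r where
    j: "j \<in> left_module_hom R P (free_left_module R I)" and
    r: "r \<in> left_module_hom R (free_left_module R I) P" and
    rj: "\<And>x. x \<in> carrier P \<Longrightarrow> r (j x) = x"
    using P by (auto simp: projective_left_module_def)
  let ?F = "free_left_module R I"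
  let ?b = "P.free_basis I"
  note basis = P.free_basis_closed[of _ I]
  have "\<exists>a. a \<in> carrier A \<and> g a = h (r (?b i))" if "i \<in> I" for i
    using sub left_module_homD(1)[OF r basis[OF that]] by (metis imageE image_subset_iff)
  then obtain a where a: "\<And>i. i \<in> I \<Longrightarrow> a i \<in> carrier A" "\<And>i. i \<in> I \<Longrightarrow> g (a i) = h (r (?b i))"
    by metis
  let ?f = "A.free_extension I a"
  have f: "?f \<in> left_module_hom R ?F A"
    by (rule A.free_extension_hom) (rule a)
  have fb: "?f (?b i) = a i" if "i \<in> I" for i
    using a(1) that by (rule A.free_extension_basis)
  show ?thesis
  proof
    show "(\<lambda>x. ?f (j x)) \<in> left_module_hom R P A"
      by (rule left_module_hom_comp[OF j f])
    show "g (?f (j x)) = h x" if "x \<in> carrier P" for x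
    proof -
      have jx: "j x \<in> carrier ?F"
        by (rule left_module_homD(1)[OF j that])
      have "B.free_extension I (\<lambda>i. g (?f (B.free_basis I i))) (j x) =
          B.free_extension I (\<lambda>i. h (r (B.free_basis I i))) (j x)"
        unfolding B.free_extension_def
      proof (intro B.M.finsum_cong')
        fix i assume "i \<in> {i \<in> I. j x i \<noteq> \<zero>\<^bsub>R\<^esub>}"
        then have i: "i \<in> I" by simp
        have "j x i \<in> carrier R"
          using jx i by (auto simp: free_left_module_def)
        then show "j x i \<odot>\<^bsub>B\<^esub> g (?f (?b i)) = j x i \<odot>\<^bsub>B\<^esub> h (r (?b i))"
          by (simp add: fb[OF i] a(2)[OF i])
      next
        show "(\<lambda>i. j x i \<odot>\<^bsub>B\<^esub> h (r (?b i))) \<in> {i \<in> I. j x i \<noteq> \<zero>\<^bsub>R\<^esub>} \<rightarrow> carrier B"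
          using jx left_module_homD(1)[OF h left_module_homD(1)[OF r basis]]
          by (auto simp: free_left_module_def intro!: B.smult_closed)
      qed simp
      then have "g (?f (j x)) = h (r (j x))"
        using B.hom_eq_free_extension[OF left_module_hom_comp[OF f g] jx]
          B.hom_eq_free_extension[OF left_module_hom_comp[OF r h] jx] by simp
      then show ?thesis
        by (simp add: rj that)
    qed
  qed
qed

section \<open>Comparison of resolutions\<close>

lemma projective_resolutionD:
  assumes "projective_resolution R M P d e"
  shows "projective_left_module R (P i)" "left_module R (P i)"
    "d i \<in> left_module_hom R (P (Suc i)) (P i)"
    "e \<in> left_module_hom R (P 0) M" "e ` carrier (P 0) = carrier M"
    "d 0 ` carrier (P (Suc 0)) = {x \<in> carrier (P 0). e x = \<zero>\<^bsub>M\<^esub>}"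
    "d (Suc i) ` carrier (P (Suc (Suc i))) = {x \<in> carrier (P (Suc i)). d i x = \<zero>\<^bsub>P i\<^esub>}"
  using assms by (auto simp: projective_resolution_def projective_left_module_def)

lemma (in abelian_group) diff_eq_zero:
  assumes "x \<in> carrier G" "y \<in> carrier G"
  shows "x \<ominus> y = \<zero> \<longleftrightarrow> x = y"
proof
  assume "x \<ominus> y = \<zero>"
  then have "x \<oplus> \<ominus> y \<oplus> y = y"
    using assms by (simp add: a_minus_def)
  then show "x = y"
    using assms by (simp add: a_assoc l_neg)
qed (use assms in \<open>simp add: a_minus_def r_neg\<close>)

lemma hom_diff:
  assumes "left_module R M" "left_module R N" "h \<in> left_module_hom R M N"
    and "x \<in> carrier M" "y \<in> carrier M"
  shows "h (x \<ominus>\<^bsub>M\<^esub> y) = h x \<ominus>\<^bsub>N\<^esub> h y"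
proof -
  interpret M: left_module R M by fact
  interpret N: left_module R N by fact
  note h = left_module_homD[OF assms(3)]
  have "h (x \<ominus>\<^bsub>M\<^esub> y) \<oplus>\<^bsub>N\<^esub> h y = h (x \<ominus>\<^bsub>M\<^esub> y \<oplus>\<^bsub>M\<^esub> y)"
    using assms(4,5) by (simp add: h(2))
  also have "x \<ominus>\<^bsub>M\<^esub> y \<oplus>\<^bsub>M\<^esub> y = x"
    using assms(4,5) by (simp add: a_minus_def M.M.a_assoc M.M.l_neg)
  finally show ?thesis
    using assms(4,5) h(1) by (metis N.M.add.inv_solve_right a_minus_def M.M.minus_closed)
qed

lemma boundary_zero:
  assumes "projective_resolution R M P d e"
  shows "x \<in> carrier (P (Suc 0)) \<Longrightarrow> e (d 0 x) = \<zero>\<^bsub>M\<^esub>"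
    and "x \<in> carrier (P (Suc (Suc i))) \<Longrightarrow> d i (d (Suc i) x) = \<zero>\<^bsub>P i\<^esub>"
  using projective_resolutionD(6)[OF assms] projective_resolutionD(7)[OF assms, of i] by blast+

text \<open>The comparison theorem in degrees 0, 1 and 2, which suffice for the splitting argument
  below. Each map is lifted through the exactness of P, the previous square showing that cycles are
  hit.\<close>

lemma chain_map:
  assumes M: "left_module R M"
    and P: "projective_resolution R M P d e" and Q: "projective_resolution R M Q d' e'"
  obtains f0 f1 f2 where
    "f0 \<in> left_module_hom R (Q 0) (P 0)" "f1 \<in> left_module_hom R (Q (Suc 0)) (P (Suc 0))"
    "f2 \<in> left_module_hom R (Q (Suc (Suc 0))) (P (Suc (Suc 0)))"
    "\<And>x. x \<in> carrier (Q 0) \<Longrightarrow> e (f0 x) = e' x"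
    "\<And>x. x \<in> carrier (Q (Suc 0)) \<Longrightarrow> d 0 (f1 x) = f0 (d' 0 x)"
    "\<And>x. x \<in> carrier (Q (Suc (Suc 0))) \<Longrightarrow> d (Suc 0) (f2 x) = f1 (d' (Suc 0) x)"
proof -
  note p = projective_resolutionD[OF P] and q = projective_resolutionD[OF Q]
  have "e' ` carrier (Q 0) \<subseteq> e ` carrier (P 0)"
    using p(5) q(5) by simp
  then obtain f0 where f0: "f0 \<in> left_module_hom R (Q 0) (P 0)"
    "\<And>x. x \<in> carrier (Q 0) \<Longrightarrow> e (f0 x) = e' x"
    using projective_lift[OF q(1) p(2) M p(4) q(4)] by blast
  have h1: "(\<lambda>x. f0 (d' 0 x)) \<in> left_module_hom R (Q (Suc 0)) (P 0)"
    by (rule left_module_hom_comp[OF q(3) f0(1)])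
  have "(\<lambda>x. f0 (d' 0 x)) ` carrier (Q (Suc 0)) \<subseteq> d 0 ` carrier (P (Suc 0))"
    unfolding p(6)
    using left_module_homD(1)[OF h1] f0(2)[OF left_module_homD(1)[OF q(3)]] boundary_zero(1)[OF Q]
    by auto
  then obtain f1 where f1: "f1 \<in> left_module_hom R (Q (Suc 0)) (P (Suc 0))"
    "\<And>x. x \<in> carrier (Q (Suc 0)) \<Longrightarrow> d 0 (f1 x) = f0 (d' 0 x)"
    using projective_lift[OF q(1) p(2) p(2) p(3) h1] by blast
  have h2: "(\<lambda>x. f1 (d' (Suc 0) x)) \<in> left_module_hom R (Q (Suc (Suc 0))) (P (Suc 0))"
    by (rule left_module_hom_comp[OF q(3) f1(1)])
  have "d 0 (f1 (d' (Suc 0) x)) = \<zero>\<^bsub>P 0\<^esub>" if "x \<in> carrier (Q (Suc (Suc 0)))" for x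
    using that f1(2)[OF left_module_homD(1)[OF q(3)]] boundary_zero(2)[OF Q, of x 0]
      left_module_hom_zero[OF q(2) p(2) f0(1)] by simp
  then have "(\<lambda>x. f1 (d' (Suc 0) x)) ` carrier (Q (Suc (Suc 0))) \<subseteq> d (Suc 0) ` carrier (P (Suc (Suc 0)))"
    unfolding p(7) using left_module_homD(1)[OF h2] by auto
  then obtain f2 where f2: "f2 \<in> left_module_hom R (Q (Suc (Suc 0))) (P (Suc (Suc 0)))"
    "\<And>x. x \<in> carrier (Q (Suc (Suc 0))) \<Longrightarrow> d (Suc 0) (f2 x) = f1 (d' (Suc 0) x)"
    using projective_lift[OF q(1) p(2) p(2) p(3) h2] by blast
  show ?thesis
    using that f0 f1 f2 by blast
qed

lemma (in abelian_group) diff_zero: "x \<in> carrier G \<Longrightarrow> x \<ominus> \<zero> = x"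
proof -
  have "\<ominus> \<zero> = \<zero>"
    by (rule minus_equality) simp_all
  then show "x \<in> carrier G \<Longrightarrow> x \<ominus> \<zero> = x"
    by (simp add: a_minus_def)
qed

lemma (in abelian_group) diff_closed: "x \<in> carrier G \<Longrightarrow> y \<in> carrier G \<Longrightarrow> x \<ominus> y \<in> carrier G"
  by (simp add: a_minus_def)

lemma (in abelian_group) diff_diff_self:
  "x \<in> carrier G \<Longrightarrow> y \<in> carrier G \<Longrightarrow> (x \<ominus> y) \<ominus> (x \<ominus> y) = \<zero>"
  by (simp add: diff_eq_zero diff_closed)

text \<open>The vanishing of Ext^3 in elementary form. The composite g f is homotopic to the
  identity. It vanishes on the image of \<open>d' 2\<close>, because f takes this image to cycles of
  degree two, which are boundaries from \<open>P 3\<close> = 0. There the homotopy alone gives the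
  identity, and so it splits \<open>d' 2\<close>.\<close>

lemma split_of_short_resolution:
  fixes Q :: "nat \<Rightarrow> ('a, 'q) module"
  assumes M: "left_module R M"
    and P: "projective_resolution R M P d e" and Q: "projective_resolution R M Q d' e'"
    and P3: "carrier (P 3) = {\<zero>\<^bsub>P 3\<^esub>}" and Q4: "carrier (Q 4) = {\<zero>\<^bsub>Q 4\<^esub>}"
  obtains h where "h \<in> left_module_hom R (Q 2) (Q 3)" "\<And>x. x \<in> carrier (Q 3) \<Longrightarrow> h (d' 2 x) = x"
proof -
  note p = projective_resolutionD[OF P] and q = projective_resolutionD[OF Q]
  note q0 = boundary_zero[OF Q]
  interpret Q0: left_module R "Q 0" by (rule q)
  interpret Q1: left_module R "Q (Suc 0)" by (rule q)
  interpret Q2: left_module R "Q (Suc (Suc 0))" by (rule q)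
  interpret Q3: left_module R "Q (Suc (Suc (Suc 0)))" by (rule q)
  obtain f0 f1 f2 where
    f: "f0 \<in> left_module_hom R (Q 0) (P 0)" "f1 \<in> left_module_hom R (Q (Suc 0)) (P (Suc 0))"
    "f2 \<in> left_module_hom R (Q (Suc (Suc 0))) (P (Suc (Suc 0)))" and
    fd: "\<And>x. x \<in> carrier (Q 0) \<Longrightarrow> e (f0 x) = e' x"
    "\<And>x. x \<in> carrier (Q (Suc 0)) \<Longrightarrow> d 0 (f1 x) = f0 (d' 0 x)"
    "\<And>x. x \<in> carrier (Q (Suc (Suc 0))) \<Longrightarrow> d (Suc 0) (f2 x) = f1 (d' (Suc 0) x)"
    using chain_map[OF M P Q] by blast
  obtain g0 g1 g2 where
    g: "g0 \<in> left_module_hom R (P 0) (Q 0)" "g1 \<in> left_module_hom R (P (Suc 0)) (Q (Suc 0))"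
    "g2 \<in> left_module_hom R (P (Suc (Suc 0))) (Q (Suc (Suc 0)))" and
    gd: "\<And>x. x \<in> carrier (P 0) \<Longrightarrow> e' (g0 x) = e x"
    "\<And>x. x \<in> carrier (P (Suc 0)) \<Longrightarrow> d' 0 (g1 x) = g0 (d 0 x)"
    "\<And>x. x \<in> carrier (P (Suc (Suc 0))) \<Longrightarrow> d' (Suc 0) (g2 x) = g1 (d (Suc 0) x)"
    using chain_map[OF M Q P] by blast
  have gf: "(\<lambda>x. g0 (f0 x)) \<in> left_module_hom R (Q 0) (Q 0)"
    "(\<lambda>x. g1 (f1 x)) \<in> left_module_hom R (Q (Suc 0)) (Q (Suc 0))"
    "(\<lambda>x. g2 (f2 x)) \<in> left_module_hom R (Q (Suc (Suc 0))) (Q (Suc (Suc 0)))"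
    by (rule left_module_hom_comp[OF f(1) g(1)] left_module_hom_comp[OF f(2) g(2)]
        left_module_hom_comp[OF f(3) g(3)])+
  note mem = left_module_homD(1)[OF gf(1)] left_module_homD(1)[OF gf(2)] left_module_homD(1)[OF gf(3)]
    left_module_homD(1)[OF f(1)] left_module_homD(1)[OF f(2)] left_module_homD(1)[OF f(3)]
    left_module_homD(1)[OF q(3)]
  have id: "(\<lambda>x. x) \<in> left_module_hom R N N" for N :: "('a, 'q) module"
    by (simp add: left_module_hom_def)
  \<comment> \<open>The homotopy 1 - g f = d h + h d is built degree by degree: 1 - g f - h d takes
    values in cycles and lifts through the next differential.\<close>
  have k0: "(\<lambda>x. x \<ominus>\<^bsub>Q 0\<^esub> g0 (f0 x)) \<in> left_module_hom R (Q 0) (Q 0)"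
    by (rule Q0.left_module_hom_diff[OF id gf(1) q(2)])
  have "e' (x \<ominus>\<^bsub>Q 0\<^esub> g0 (f0 x)) = \<zero>\<^bsub>M\<^esub>" if x: "x \<in> carrier (Q 0)" for x
  proof -
    interpret M: left_module R M by (rule M)
    show ?thesis
      using x left_module_homD(1)[OF q(4) x]
      by (simp add: hom_diff[OF q(2) M q(4)] mem gd fd M.M.diff_eq_zero)
  qed
  then have "(\<lambda>x. x \<ominus>\<^bsub>Q 0\<^esub> g0 (f0 x)) ` carrier (Q 0) \<subseteq> d' 0 ` carrier (Q (Suc 0))"
    unfolding q(6) using left_module_homD(1)[OF k0] by auto
  then obtain h0 where h0: "h0 \<in> left_module_hom R (Q 0) (Q (Suc 0))"
    "\<And>x. x \<in> carrier (Q 0) \<Longrightarrow> d' 0 (h0 x) = x \<ominus>\<^bsub>Q 0\<^esub> g0 (f0 x)"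
    using projective_lift[OF q(1) q(2) q(2) q(3) k0] by blast
  have hd0: "(\<lambda>x. h0 (d' 0 x)) \<in> left_module_hom R (Q (Suc 0)) (Q (Suc 0))"
    by (rule left_module_hom_comp[OF q(3) h0(1)])
  let ?k1 = "\<lambda>x. x \<ominus>\<^bsub>Q (Suc 0)\<^esub> g1 (f1 x) \<ominus>\<^bsub>Q (Suc 0)\<^esub> h0 (d' 0 x)"
  have k1: "?k1 \<in> left_module_hom R (Q (Suc 0)) (Q (Suc 0))"
    by (intro Q1.left_module_hom_diff id gf(2) q(2) hd0)
  have "d' 0 (?k1 x) = \<zero>\<^bsub>Q 0\<^esub>" if x: "x \<in> carrier (Q (Suc 0))" for x
    using x by (simp add: hom_diff[OF q(2) q(2) q(3)] mem left_module_homD(1)[OF hd0]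
        Q1.M.diff_closed h0(2) gd fd Q0.M.diff_diff_self)
  then have "?k1 ` carrier (Q (Suc 0)) \<subseteq> d' (Suc 0) ` carrier (Q (Suc (Suc 0)))"
    unfolding q(7) using left_module_homD(1)[OF k1] by auto
  then obtain h1 where h1: "h1 \<in> left_module_hom R (Q (Suc 0)) (Q (Suc (Suc 0)))"
    "\<And>x. x \<in> carrier (Q (Suc 0)) \<Longrightarrow> d' (Suc 0) (h1 x) = ?k1 x"
    using projective_lift[OF q(1) q(2) q(2) q(3) k1] by blast
  have hd1: "(\<lambda>x. h1 (d' (Suc 0) x)) \<in> left_module_hom R (Q (Suc (Suc 0))) (Q (Suc (Suc 0)))"
    by (rule left_module_hom_comp[OF q(3) h1(1)])
  let ?k2 = "\<lambda>x. x \<ominus>\<^bsub>Q (Suc (Suc 0))\<^esub> g2 (f2 x) \<ominus>\<^bsub>Q (Suc (Suc 0))\<^esub> h1 (d' (Suc 0) x)"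
  have k2: "?k2 \<in> left_module_hom R (Q (Suc (Suc 0))) (Q (Suc (Suc 0)))"
    by (intro Q2.left_module_hom_diff id gf(3) q(2) hd1)
  have "d' (Suc 0) (?k2 x) = \<zero>\<^bsub>Q (Suc 0)\<^esub>" if x: "x \<in> carrier (Q (Suc (Suc 0)))" for x
  proof -
    have "h0 (d' 0 (d' (Suc 0) x)) = \<zero>\<^bsub>Q (Suc 0)\<^esub>"
      using x by (simp add: q0 left_module_hom_zero[OF q(2) q(2) h0(1)])
    then show ?thesis
      using x by (simp add: hom_diff[OF q(2) q(2) q(3)] mem left_module_homD(1)[OF hd1]
          Q2.M.diff_closed h1(2) gd fd Q1.M.diff_closed Q1.M.diff_eq_zero)
        (simp add: a_minus_def mem Q1.M.a_ac Q1.M.r_neg)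
  qed
  then have "?k2 ` carrier (Q (Suc (Suc 0))) \<subseteq> d' (Suc (Suc 0)) ` carrier (Q (Suc (Suc (Suc 0))))"
    unfolding q(7) using left_module_homD(1)[OF k2] by auto
  then obtain h2 where h2: "h2 \<in> left_module_hom R (Q (Suc (Suc 0))) (Q (Suc (Suc (Suc 0))))"
    "\<And>x. x \<in> carrier (Q (Suc (Suc 0))) \<Longrightarrow> d' (Suc (Suc 0)) (h2 x) = ?k2 x"
    using projective_lift[OF q(1) q(2) q(2) q(3) k2] by blast
  have split: "h2 (d' (Suc (Suc 0)) x) = x" if x: "x \<in> carrier (Q (Suc (Suc (Suc 0))))" for x
  proof -
    let ?dx = "d' (Suc (Suc 0)) x"
    have dx: "?dx \<in> carrier (Q (Suc (Suc 0)))"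
      by (rule mem(7)[OF x])
    have zero: "d' (Suc 0) ?dx = \<zero>\<^bsub>Q (Suc 0)\<^esub>"
      by (rule q0(2)[OF x])
    \<comment> \<open>A cycle of P in degree two is a boundary, hence zero.\<close>
    have "d (Suc 0) (f2 ?dx) = \<zero>\<^bsub>P (Suc 0)\<^esub>"
      using dx zero by (simp add: fd left_module_hom_zero[OF q(2) p(2) f(2)])
    then have "f2 ?dx \<in> d (Suc (Suc 0)) ` carrier (P (Suc (Suc (Suc 0))))"
      unfolding p(7) using mem(6)[OF dx] by simp
    then have "f2 ?dx = \<zero>\<^bsub>P (Suc (Suc 0))\<^esub>"
      using P3 left_module_hom_zero[OF p(2) p(2) p(3)] by (auto simp: numeral_3_eq_3)
    then have "g2 (f2 ?dx) = \<zero>\<^bsub>Q (Suc (Suc 0))\<^esub>"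
      using left_module_hom_zero[OF p(2) q(2) g(3)] by simp
    moreover have "h1 (d' (Suc 0) ?dx) = \<zero>\<^bsub>Q (Suc (Suc 0))\<^esub>"
      using zero left_module_hom_zero[OF q(2) q(2) h1(1)] by simp
    ultimately have "d' (Suc (Suc 0)) (h2 ?dx) = ?dx"
      using dx by (simp add: h2 Q2.M.diff_zero)
    moreover have h2x: "h2 ?dx \<in> carrier (Q (Suc (Suc (Suc 0))))"
      by (rule left_module_homD(1)[OF h2(1) dx])
    \<comment> \<open>As \<open>Q 4\<close> is zero, \<open>d' 2\<close> is injective and may be
      cancelled.\<close>
    ultimately have "d' (Suc (Suc 0)) (h2 ?dx \<ominus>\<^bsub>Q (Suc (Suc (Suc 0)))\<^esub> x) = \<zero>\<^bsub>Q (Suc (Suc 0))\<^esub>"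
      using x dx by (simp add: hom_diff[OF q(2) q(2) q(3)] Q2.M.diff_eq_zero)
    then have "h2 ?dx \<ominus>\<^bsub>Q (Suc (Suc (Suc 0)))\<^esub> x
        \<in> d' (Suc (Suc (Suc 0))) ` carrier (Q (Suc (Suc (Suc (Suc 0)))))"
      unfolding q(7) using Q3.M.diff_closed[OF h2x x] by simp
    then have "h2 ?dx \<ominus>\<^bsub>Q (Suc (Suc (Suc 0)))\<^esub> x = \<zero>\<^bsub>Q (Suc (Suc (Suc 0)))\<^esub>"
      using Q4 left_module_hom_zero[OF q(2) q(2) q(3)] by (auto simp: eval_nat_numeral)
    then show ?thesis
      using Q3.M.diff_eq_zero[OF h2x x] by simp
  qed
  show ?thesis
    using that[of h2] h2(1) split by (simp add: eval_nat_numeral)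
qed

section \<open>Operator modules carried over to a given type\<close>

definition enc_module ::
  "'q::ab_group_add set \<Rightarrow> ('q \<Rightarrow> 'p) \<Rightarrow> ('p \<Rightarrow> 'q) \<Rightarrow> ('a \<Rightarrow> 'q \<Rightarrow> 'q) \<Rightarrow> ('a, 'p) module" where
  "enc_module Q enc dec act = \<lparr>carrier = enc ` Q, monoid.mult = undefined, one = undefined,
     ring.zero = enc 0, add = \<lambda>x y. enc (dec x + dec y), module.smult = \<lambda>a x. enc (act a (dec x))\<rparr>"

lemma enc_module_simps [simp]:
  "carrier (enc_module Q enc dec act) = enc ` Q"
  "\<zero>\<^bsub>enc_module Q enc dec act\<^esub> = enc 0"
  "x \<oplus>\<^bsub>enc_module Q enc dec act\<^esub> y = enc (dec x + dec y)"
  "a \<odot>\<^bsub>enc_module Q enc dec act\<^esub> x = enc (act a (dec x))"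
  by (simp_all add: enc_module_def)

context conifold_module
begin

definition op_submodule :: "'w set \<Rightarrow> bool" where
  "op_submodule Q \<longleftrightarrow> 0 \<in> Q \<and> (\<forall>x\<in>Q. \<forall>y\<in>Q. x + y \<in> Q) \<and>
     (\<forall>x\<in>Q. (\<forall>c. sc c x \<in> Q) \<and> Zo x \<in> Q \<and> Xo x \<in> Q \<and> Yo x \<in> Q)"

lemma op_submodule_sum:
  assumes "op_submodule Q" "\<And>i. i \<in> A \<Longrightarrow> F i \<in> Q"
  shows "sum F A \<in> Q"
  using assms(2)
  by (induction A rule: infinite_finite_induct) (use assms(1) in \<open>auto simp: op_submodule_def\<close>)

lemma op_submodule_uminus: "op_submodule Q \<Longrightarrow> x \<in> Q \<Longrightarrow> - x \<in> Q"
proof -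
  have "sc (- 1) x + x = sc 0 x"
    using sc_add_left[of "- 1" 1 x] by (simp add: sc_one)
  then have "- x = sc (- 1) x"
    by (simp add: sc_zero_left eq_neg_iff_add_eq_0[symmetric])
  then show "op_submodule Q \<Longrightarrow> x \<in> Q \<Longrightarrow> - x \<in> Q"
    by (simp add: op_submodule_def)
qed

lemma op_submodule_free_op:
  assumes "op_submodule Q" "w \<in> Q"
  shows "free_op p w \<in> Q"
proof -
  have "word_op us w \<in> Q" for us
  proof (induction us)
    case (Cons g us)
    then show ?case
      using assms(1) by (cases g) (auto simp: word_act_def op_submodule_def)
  qed (simp add: word_act_def assms)
  then show ?thesis
    unfolding free_act_def
    using assms(1) by (intro op_submodule_sum) (auto simp: op_submodule_def)
qed

end

context conifold_quotient
begin

definition ring_act ::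
  "(complex \<Rightarrow> 'w::ab_group_add \<Rightarrow> 'w) \<Rightarrow> ('w \<Rightarrow> 'w) \<Rightarrow> ('w \<Rightarrow> 'w) \<Rightarrow> ('w \<Rightarrow> 'w) \<Rightarrow> 'a \<Rightarrow> 'w \<Rightarrow> 'w" where
  "ring_act sc Zo Xo Yo a = free_act sc Zo Xo Yo (rep a)"

text \<open>The chosen representative differs from p by an element of the ideal, which acts by
  zero.\<close>

lemma ring_act_cl:
  assumes "conifold_module sc Zo Xo Yo"
  shows "ring_act sc Zo Xo Yo (cl p) w = free_act sc Zo Xo Yo p w"
proof -
  interpret conifold_module sc Zo Xo Yo by fact
  have "rep (cl p) - p \<in> conifold_ideal"
    using cl_rep[of "cl p"] by (simp add: cl_eq_iff)
  then show ?thesis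
    using free_op_ideal[of "rep (cl p) - p" w] by (simp add: ring_act_def free_op_diff)
qed

lemma enc_left_module:
  assumes "conifold_module sc Zo Xo Yo"
    and Q: "conifold_module.op_submodule sc Zo Xo Yo Q" and dec: "\<And>q. q \<in> Q \<Longrightarrow> dec (enc q) = q"
  shows "left_module R (enc_module Q enc dec (ring_act sc Zo Xo Yo))"
proof -
  interpret conifold_module sc Zo Xo Yo by fact
  let ?M = "enc_module Q enc dec (ring_act sc Zo Xo Yo)"
  have Q': "0 \<in> Q" "\<And>x y. x \<in> Q \<Longrightarrow> y \<in> Q \<Longrightarrow> x + y \<in> Q"
    using Q by (auto simp: op_submodule_def)
  have ab: "abelian_group ?M"
  proof (rule abelian_groupI)
    fix x assume "x \<in> carrier ?M"
    then obtain q where "x = enc q" "q \<in> Q" by auto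
    then show "\<exists>y\<in>carrier ?M. y \<oplus>\<^bsub>?M\<^esub> x = \<zero>\<^bsub>?M\<^esub>"
      using op_submodule_uminus[OF Q, of q] by (intro bexI[of _ "enc (- q)"]) (auto simp: dec)
  qed (use Q' in \<open>auto simp: dec add_ac\<close>)
  note act = ring_act_cl[OF assms(1)]
  show ?thesis
  proof (intro left_module.intro left_module_axioms.intro ab local.ring_axioms, goal_cases)
    case (1 a x)
    then show ?case
      using op_submodule_free_op[OF Q] by (auto simp: dec act elim!: carrier_cases)
  next
    case (2 a b x)
    then show ?case
      using op_submodule_free_op[OF Q] by (auto simp: dec act free_op_add simp flip: cl_add elim!: carrier_cases)
  next
    case (3 a x y)
    then show ?case
      using op_submodule_free_op[OF Q] Q'
      by (auto simp: dec act free_op_add_right elim!: carrier_cases)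
  next
    case (4 a b x)
    then show ?case
      using op_submodule_free_op[OF Q] by (auto simp: dec act free_op_mult simp flip: cl_mult elim!: carrier_cases)
  next
    case (5 x)
    then show ?case
      by (auto simp: dec act free_op_one simp flip: cl_one)
  qed
qed

lemma enc_hom:
  assumes "conifold_hom sc Zo Xo Yo sc' Zo' Xo' Yo' h"
    and dec: "\<And>q. q \<in> Q \<Longrightarrow> dec (enc q) = q" "\<And>q. q \<in> Q' \<Longrightarrow> dec' (enc' q) = q"
    and Q: "conifold_module.op_submodule sc Zo Xo Yo Q" and hQ: "\<And>q. q \<in> Q \<Longrightarrow> h q \<in> Q'"
  shows "(\<lambda>x. enc' (h (dec x))) \<in> left_module_hom R
    (enc_module Q enc dec (ring_act sc Zo Xo Yo)) (enc_module Q' enc' dec' (ring_act sc' Zo' Xo' Yo'))"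
proof -
  interpret conifold_hom sc Zo Xo Yo sc' Zo' Xo' Yo' h by fact
  have "x + y \<in> Q" if "x \<in> Q" "y \<in> Q" for x y
    using Q that by (simp add: A.op_submodule_def)
  then show ?thesis
    using A.op_submodule_free_op[OF Q]
    by (intro left_module_homI)
      (auto simp: dec hQ additive.add[OF additive_hom] ring_act_cl[OF A.conifold_module_axioms]
        ring_act_cl[OF B.conifold_module_axioms] hom_free_op elim!: carrier_cases)
qed

lemma enc_finsum:
  assumes "conifold_module sc Zo Xo Yo"
    and Q: "conifold_module.op_submodule sc Zo Xo Yo Q" and dec: "\<And>q. q \<in> Q \<Longrightarrow> dec (enc q) = q"
    and F: "finite A" "\<And>i. i \<in> A \<Longrightarrow> F i \<in> Q"
  shows "finsum (enc_module Q enc dec (ring_act sc Zo Xo Yo)) (\<lambda>i. enc (F i)) A = enc (sum F A)"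
proof -
  interpret conifold_module sc Zo Xo Yo by fact
  interpret M: left_module R "enc_module Q enc dec (ring_act sc Zo Xo Yo)"
    by (rule enc_left_module) (use assms in auto)
  show ?thesis
    using F
  proof (induction A rule: finite_induct)
    case (insert k A)
    then have "sum F A \<in> Q"
      using op_submodule_sum[OF Q] by blast
    with insert show ?case
      by (subst M.M.finsum_insert) (auto simp: dec)
  qed simp
qed

end

section \<open>The projective resolution of a module\<close>

text \<open>Indices from 2 on all denote the third entry; sums run over t < 3.\<close>

definition comp3 :: "nat \<Rightarrow> 'w triple \<Rightarrow> 'w poly3" where
  "comp3 t q = (case q of (a, b, c) \<Rightarrow> if t = 0 then a else if t = 1 then b else c)"

definition inject3 :: "nat \<Rightarrow> 'w::ab_group_add poly3 \<Rightarrow> 'w triple" where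
  "inject3 t f = (if t = 0 then f else 0, if t = 1 then f else 0, if t = 0 \<or> t = 1 then 0 else f)"

definition degree_sign :: "nat \<Rightarrow> nat \<Rightarrow> bool" where
  "degree_sign n t = (case degree_signs n of (s1, s2, s3) \<Rightarrow> if t = 0 then s1 else if t = 1 then s2 else s3)"

lemma sum_inject3_comp3: "(\<Sum>t<3. inject3 t (comp3 t q)) = (q :: 'w::ab_group_add triple)"
  by (cases q) (simp add: eval_nat_numeral inject3_def comp3_def)

lemma degree_shape_inject3:
  "degree_shape n q \<Longrightarrow> comp3 t q \<noteq> 0 \<Longrightarrow> degree_shape n (inject3 t f)"
  by (cases q) (auto simp: degree_shape_def comp3_def inject3_def split: if_splits)

context sign_module
begin

interpretation T: conifold_module "\<lambda>c. triple_map (sc3 c)" "triple_Z n" "triple_map left_X" "triple_map left_Y"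
  for n
  by (rule triple_module)

lemma comp3_hom:
  "conifold_hom (\<lambda>c. triple_map (sc3 c)) (triple_Z n) (triple_map left_X) (triple_map left_Y)
     sc3 (signed (degree_sign n t) Z3) left_X left_Y (comp3 t)"
proof -
  interpret F: conifold_module sc3 "signed (degree_sign n t) Z3" left_X left_Y
    by (rule signed_induced_module)
  show ?thesis
    by unfold_locales
      (auto simp: additive_def comp3_def triple_Z_def degree_sign_def signed_def split: prod.splits)
qed

lemma inject3_hom:
  "conifold_hom sc3 (signed (degree_sign n t) Z3) left_X left_Y
     (\<lambda>c. triple_map (sc3 c)) (triple_Z n) (triple_map left_X) (triple_map left_Y) (inject3 t)"
proof -
  interpret F: conifold_module sc3 "signed b Z3" left_X left_Y for b
    by (rule signed_induced_module)
  interpret F0: conifold_module sc3 Z3 left_X left_Y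
    by (rule induced_module)
  show ?thesis
    by unfold_locales
      (auto simp: additive_def inject3_def triple_Z_def degree_sign_def signed_def F0.Z_zero
        F0.X_zero F0.Y_zero F0.sc_zero split: prod.splits)
qed

end

text \<open>The module \<open>M\<close> is the image of the projection \<open>pr\<close> of \<open>W\<close>, up to the isomorphism induced by \<open>to_M\<close>;
  \<open>cf\<close> and \<open>bv\<close> form a dual basis for this image over \<open>\<complex>\<close>. The elements of the resolution are
  encoded in the type \<open>'p\<close> by \<open>enc\<close>.\<close>

locale conifold_resolution =
  conifold_quotient R cl + W: conifold_module sc Zo Xo Yo + M: left_module R M
  for R :: "('a, 'b) ring_scheme" (structure) and cl
    and sc :: "complex \<Rightarrow> 'w::ab_group_add \<Rightarrow> 'w" and Zo Xo Yo
    and M :: "('a, 'm, 'c) module_scheme" +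
  fixes pr :: "'w \<Rightarrow> 'w" and cf :: "'i \<Rightarrow> 'w \<Rightarrow> complex" and bv :: "'i \<Rightarrow> 'w"
    and to_M :: "'w \<Rightarrow> 'm" and enc :: "'w triple \<Rightarrow> 'p" and idx :: "'i \<times> nat \<Rightarrow> 'p"
  assumes additive_pr: "additive pr" and pr_sc: "pr (sc c w) = sc c (pr w)"
    and pr_Z: "pr (Zo w) = Zo (pr w)" and pr_X: "pr (Xo w) = Xo (pr w)" and pr_Y: "pr (Yo w) = Yo (pr w)"
    and pr_bv: "pr (bv i) = bv i"
    and pr_pr: "pr (pr w) = pr w"
    and additive_cf: "additive (cf i)" and cf_sc: "cf i (sc c w) = c * cf i w"
    and finite_cf: "finite {i. cf i w \<noteq> 0}"
    and pr_eq_sum: "pr w = (\<Sum>i | cf i w \<noteq> 0. sc (cf i w) (bv i))"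
    and to_M_closed: "to_M w \<in> carrier M" and to_M_surj: "x \<in> carrier M \<Longrightarrow> \<exists>w. to_M w = x"
    and to_M_add: "to_M (v + w) = to_M v \<oplus>\<^bsub>M\<^esub> to_M w"
    and to_M_act: "to_M (W.free_op p w) = cl p \<odot>\<^bsub>M\<^esub> to_M w"
    and to_M_eq_zero: "to_M w = \<zero>\<^bsub>M\<^esub> \<longleftrightarrow> pr w = 0"
    and inj_enc: "inj_on enc {q. triple_map (lift3 pr) q = q}" and inj_idx: "inj idx"
begin

interpretation T: conifold_module "\<lambda>c. triple_map (W.sc3 c)" "W.triple_Z n" "triple_map left_X" "triple_map left_Y"
  for n
  by (rule W.triple_module)

definition fixed :: "nat \<Rightarrow> 'w triple set" where
  "fixed n = {q. triple_map (lift3 pr) q = q \<and> degree_shape n q}"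

definition dec :: "'p \<Rightarrow> 'w triple" where
  "dec = inv_into {q. triple_map (lift3 pr) q = q} enc"

lemma dec_enc: "q \<in> fixed n \<Longrightarrow> dec (enc q) = q"
  by (simp add: fixed_def dec_def inj_enc)

definition P :: "nat \<Rightarrow> ('a, 'p) module" where
  "P n = enc_module (fixed n) enc dec
     (ring_act (\<lambda>c. triple_map (W.sc3 c)) (W.triple_Z n) (triple_map left_X) (triple_map left_Y))"

lemma lift3_pr: "lift3 pr (left_X f) = left_X (lift3 pr f)" "lift3 pr (left_Y f) = left_Y (lift3 pr f)"
  "lift3 pr (W.sc3 c f) = W.sc3 c (lift3 pr f)" "lift3 pr (W.Z3 f) = W.Z3 (lift3 pr f)"
  by (simp_all add: lift3_ops[OF additive_pr] lift3_comp additive.zero[OF additive_pr] W.sc_zero W.Z_zero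
      pr_sc pr_Z)

lemma degree_shape_ops:
  shows "degree_shape n q \<Longrightarrow> h 0 = 0 \<Longrightarrow> degree_shape n (triple_map h q)"
    and "degree_shape n q \<Longrightarrow> degree_shape n (W.triple_Z n q)"
    and "degree_shape n q \<Longrightarrow> degree_shape n r \<Longrightarrow> degree_shape n (q + r)"
    and "degree_shape n 0"
proof -
  have "W.Z3 0 = 0"
    by (rule poly3_eqI) (simp add: c3_flip_XY c3_lift3 W.Z_zero)
  then have "signed b W.Z3 0 = 0" for b
    by (simp add: signed_def)
  then show "degree_shape n q \<Longrightarrow> degree_shape n (W.triple_Z n q)"
    by (cases q; cases "degree_signs n") (auto simp: degree_shape_def W.triple_Z_def)
qed (cases q; cases r; auto simp: degree_shape_def zero_prod_def split: if_splits)+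

lemma triple_pr_Z: "triple_map (lift3 pr) (W.triple_Z n q) = W.triple_Z n (triple_map (lift3 pr) q)"
  by (cases q; cases "degree_signs n")
    (simp add: W.triple_Z_def signed_def lift3_pr(4) lift3_minus[OF additive_pr])

lemma fixed_submodule: "T.op_submodule n (fixed n)"
proof -
  have zero: "lift3 pr 0 = 0" by (rule lift3_zero[OF additive_pr])
  have h: "triple_map h q \<in> fixed n"
    if "q \<in> fixed n" "h 0 = 0" "\<And>f. lift3 pr (h f) = h (lift3 pr f)" for h q
    using that degree_shape_ops(1)[of n q h] by (cases q) (simp add: fixed_def)
  have ops0: "left_X 0 = 0" "left_Y 0 = 0" "W.sc3 c 0 = 0" for c
    by (rule poly3_eqI; simp add: c3_simps c3_lift3 W.sc_zero split: nat.split)+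
  show ?thesis
    unfolding T.op_submodule_def
  proof (intro conjI ballI allI)
    show "0 \<in> fixed n"
      by (simp add: fixed_def degree_shape_ops zero_prod_def zero) (simp add: degree_shape_def)
    show "x + y \<in> fixed n" if xy: "x \<in> fixed n" "y \<in> fixed n" for x y
    proof -
      have "degree_shape n (x + y)"
        using xy by (intro degree_shape_ops(3)) (simp_all add: fixed_def)
      moreover have "triple_map (lift3 pr) (x + y) = x + y"
        using xy by (cases x; cases y) (simp add: fixed_def lift3_add[OF additive_pr])
      ultimately show ?thesis
        by (simp add: fixed_def)
    qed
    show "W.triple_Z n x \<in> fixed n" if "x \<in> fixed n" for x
      using that by (simp add: fixed_def degree_shape_ops triple_pr_Z)
  qed (rule h; simp add: lift3_pr ops0)+
qed

lemma P_module: "left_module R (P n)"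
  unfolding P_def by (rule enc_left_module) (use W.triple_module fixed_submodule dec_enc in auto)

lemma pr_zop: "pr (W.zop w) = W.zop (pr w)"
  by (simp add: W.zop_def pr_sc additive.add[OF additive_pr] pr_X pr_Y)

lemma boundary_fixed: "q \<in> fixed (Suc n) \<Longrightarrow> W.boundary n q \<in> fixed n"
  using W.lift3_boundary[OF additive_pr pr_X pr_Y pr_zop, of n q] W.boundary_shape[of n q]
  by (simp add: fixed_def)

definition d :: "nat \<Rightarrow> 'p \<Rightarrow> 'p" where
  "d n x = enc (W.boundary n (dec x))"

lemma d_hom: "d n \<in> left_module_hom R (P (Suc n)) (P n)"
  unfolding d_def[abs_def] P_def
  by (rule enc_hom[OF W.boundary_hom]) (use fixed_submodule dec_enc boundary_fixed in auto)

lemma d_enc: "q \<in> fixed (Suc n) \<Longrightarrow> d n (enc q) = enc (W.boundary n q)"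
  by (simp add: d_def dec_enc)

lemma carrier_P: "carrier (P n) = enc ` fixed n"
  by (simp add: P_def)

lemma zero_P: "\<zero>\<^bsub>P n\<^esub> = enc 0"
  by (simp add: P_def)

lemma zero_fixed: "0 \<in> fixed n"
  using fixed_submodule by (simp add: T.op_submodule_def)

lemma enc_eq_zero_iff: "q \<in> fixed n \<Longrightarrow> enc q = enc 0 \<longleftrightarrow> q = 0"
  using dec_enc zero_fixed by metis

definition e :: "'p \<Rightarrow> 'm" where
  "e x = to_M (W.aug (comp3 0 (dec x)))"

lemma e_enc: "q \<in> fixed 0 \<Longrightarrow> e (enc q) = to_M (W.aug (comp3 0 q))"
  by (simp add: e_def dec_enc)

lemma aug_comp3_act:
  "W.aug (comp3 0 (T.free_op 0 p q)) = W.free_op p (W.aug (comp3 0 q))"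
proof -
  interpret c: conifold_hom "\<lambda>c. triple_map (W.sc3 c)" "W.triple_Z 0" "triple_map left_X" "triple_map left_Y"
    W.sc3 "signed (degree_sign 0 0) W.Z3" left_X left_Y "comp3 0"
    by (rule W.comp3_hom)
  interpret a: conifold_hom W.sc3 W.Z3 left_X left_Y sc Zo Xo Yo W.aug
    by (rule W.aug_hom)
  have "signed (degree_sign 0 0) W.Z3 = W.Z3"
    by (simp add: degree_sign_def signed_def[abs_def])
  then show ?thesis
    using c.hom_free_op[of p q] by (simp add: a.hom_free_op)
qed

lemma aug_pr: "W.aug (lift3 pr f) = pr (W.aug f)"
  by (rule W.aug_coeffwise) (simp_all add: additive_pr pr_X pr_Y pr_zop)

lemma e_hom: "e \<in> left_module_hom R (P 0) M"
proof (rule left_module_homI)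
  fix x y assume "x \<in> carrier (P 0)" "y \<in> carrier (P 0)"
  then obtain q r where qr: "x = enc q" "y = enc r" "q \<in> fixed 0" "r \<in> fixed 0"
    by (auto simp: carrier_P)
  moreover have "q + r \<in> fixed 0"
    using fixed_submodule[of 0] qr by (simp add: T.op_submodule_def)
  moreover have "comp3 0 (q + r) = comp3 0 q + comp3 0 r"
    by (cases q; cases r) (simp add: comp3_def)
  ultimately show "e (x \<oplus>\<^bsub>P 0\<^esub> y) = e x \<oplus>\<^bsub>M\<^esub> e y"
    by (simp add: P_def dec_enc e_enc additive.add[OF W.additive_aug(1)] to_M_add)
next
  fix a x assume "a \<in> carrier R" "x \<in> carrier (P 0)"
  then obtain p q where "a = cl p" "x = enc q" "q \<in> fixed 0"
    by (auto simp: carrier_P carrier_eq)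
  moreover have "T.free_op 0 p q \<in> fixed 0"
    using T.op_submodule_free_op fixed_submodule calculation by blast
  ultimately show "e (a \<odot>\<^bsub>P 0\<^esub> x) = a \<odot>\<^bsub>M\<^esub> e x"
    by (simp add: P_def dec_enc e_enc ring_act_cl[OF W.triple_module] aug_comp3_act to_M_act)
qed (simp add: e_def to_M_closed)

lemma to_M_pr: "to_M (pr w) = to_M w"
proof -
  have "to_M (w - pr w) = \<zero>\<^bsub>M\<^esub>"
    by (simp add: to_M_eq_zero additive.diff[OF additive_pr] pr_pr)
  moreover have "to_M w = to_M (w - pr w) \<oplus>\<^bsub>M\<^esub> to_M (pr w)"
    by (simp flip: to_M_add)
  ultimately show ?thesis
    by (simp add: to_M_closed)
qed

lemma e_surj: "e ` carrier (P 0) = carrier M"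
proof -
  have "x \<in> e ` carrier (P 0)" if x: "x \<in> carrier M" for x
  proof -
    obtain w where w: "to_M w = x"
      using to_M_surj[OF x] by blast
    have "(const3 (pr w), 0, 0) \<in> fixed 0"
      by (simp add: fixed_def degree_shape_def lift3_const[OF additive_pr] lift3_zero[OF additive_pr] pr_pr)
    moreover from this have "e (enc (const3 (pr w), 0, 0)) = x"
      by (simp add: e_enc comp3_def W.aug_const3 to_M_pr w)
    ultimately show ?thesis
      by (force simp: carrier_P)
  qed
  then show ?thesis
    using left_module_homD(1)[OF e_hom] by blast
qed

text \<open>Exactness is known for all triples. Applying \<open>pr\<close> to a preimage of a fixed
  q gives a preimage that is fixed too, so the fixed points inherit exactness.\<close>

lemma boundary_fixed_preimage:
  assumes "W.boundary n u = q" "q \<in> fixed n" "degree_shape (Suc n) u"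
  obtains v where "v \<in> fixed (Suc n)" "W.boundary n v = q"
proof
  let ?v = "triple_map (lift3 pr) u"
  show "W.boundary n ?v = q"
    using W.lift3_boundary[OF additive_pr pr_X pr_Y pr_zop, of n u] assms by (simp add: fixed_def)
  have "lift3 pr (lift3 pr f) = lift3 pr f" for f
    by (simp add: lift3_comp additive.zero[OF additive_pr] pr_pr)
  then show "?v \<in> fixed (Suc n)"
    using assms(3)
    by (cases u) (auto simp: fixed_def degree_shape_def lift3_zero[OF additive_pr] split: if_splits)
qed

lemma exact_at_0: "d 0 ` carrier (P (Suc 0)) = {x \<in> carrier (P 0). e x = \<zero>\<^bsub>M\<^esub>}"
proof (intro equalityI subsetI)
  fix x assume "x \<in> d 0 ` carrier (P (Suc 0))"
  then obtain q where q: "q \<in> fixed (Suc 0)" "x = enc (W.boundary 0 q)"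
    by (auto simp: carrier_P d_enc)
  have "comp3 0 t = fst t" for t :: "'w triple"
    by (cases t) (simp add: comp3_def)
  then have "e x = to_M 0"
    using q boundary_fixed[OF q(1)] by (simp add: e_enc W.aug_boundary)
  then show "x \<in> {x \<in> carrier (P 0). e x = \<zero>\<^bsub>M\<^esub>}"
    using q boundary_fixed[OF q(1)] to_M_eq_zero[of 0] by (auto simp: carrier_P additive.zero[OF additive_pr])
next
  fix x assume "x \<in> {x \<in> carrier (P 0). e x = \<zero>\<^bsub>M\<^esub>}"
  then obtain q where q: "q \<in> fixed 0" "x = enc q" "e (enc q) = \<zero>\<^bsub>M\<^esub>"
    by (auto simp: carrier_P)
  then obtain f where f: "q = (f, 0, 0)" "lift3 pr f = f"
    by (cases q) (auto simp: fixed_def degree_shape_def)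
  have "pr (W.aug f) = 0"
    using q by (simp add: e_enc to_M_eq_zero) (simp add: f comp3_def)
  then have "W.aug f = 0"
    using aug_pr[of f] f by simp
  then obtain u where "W.boundary 0 u = q"
    using W.aug_exact f by metis
  then obtain v where "v \<in> fixed (Suc 0)" "W.boundary 0 v = q"
    using boundary_fixed_preimage[of 0 u q] q(1) by (auto simp: degree_shape_def split: prod.split)
  then show "x \<in> d 0 ` carrier (P (Suc 0))"
    using q by (force simp: carrier_P d_enc)
qed

lemma exact_at_Suc: "d (Suc n) ` carrier (P (Suc (Suc n))) = {x \<in> carrier (P (Suc n)). d n x = \<zero>\<^bsub>P n\<^esub>}"
proof (intro equalityI subsetI)
  fix x assume "x \<in> d (Suc n) ` carrier (P (Suc (Suc n)))"
  then obtain q where q: "q \<in> fixed (Suc (Suc n))" "x = enc (W.boundary (Suc n) q)"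
    by (auto simp: carrier_P d_enc)
  then have "W.boundary n (W.boundary (Suc n) q) = 0"
    by (intro W.boundary_boundary) (simp add: fixed_def)
  then show "x \<in> {x \<in> carrier (P (Suc n)). d n x = \<zero>\<^bsub>P n\<^esub>}"
    using q boundary_fixed[OF q(1)] by (simp add: carrier_P d_enc zero_P)
next
  fix x assume "x \<in> {x \<in> carrier (P (Suc n)). d n x = \<zero>\<^bsub>P n\<^esub>}"
  then obtain q where q: "q \<in> fixed (Suc n)" "x = enc q" "enc (W.boundary n q) = enc 0"
    by (auto simp: carrier_P d_enc zero_P)
  then have "W.boundary n q = 0"
    using enc_eq_zero_iff[OF boundary_fixed[OF q(1)]] by simp
  moreover have "degree_shape (Suc n) q"
    using q(1) by (simp add: fixed_def)
  ultimately obtain u where "degree_shape (Suc (Suc n)) u" "W.boundary (Suc n) u = q"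
    by (rule W.boundary_exact)
  then obtain v where "v \<in> fixed (Suc (Suc n))" "W.boundary (Suc n) v = q"
    using boundary_fixed_preimage q(1) by metis
  then show "x \<in> d (Suc n) ` carrier (P (Suc (Suc n)))"
    using q by (force simp: carrier_P d_enc)
qed

end

lemma conifold_hom_comp:
  assumes "conifold_hom s1 Z1 X1 Y1 s2 Z2 X2 Y2 g" "conifold_hom s2 Z2 X2 Y2 s3 Z3 X3 Y3 h"
  shows "conifold_hom s1 Z1 X1 Y1 s3 Z3 X3 Y3 (\<lambda>x. h (g x))"
proof -
  interpret g: conifold_hom s1 Z1 X1 Y1 s2 Z2 X2 Y2 g by fact
  interpret h: conifold_hom s2 Z2 X2 Y2 s3 Z3 X3 Y3 h by fact
  show ?thesis
    by unfold_locales
      (simp_all add: additive.add[OF g.additive_hom] additive.add[OF h.additive_hom]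
        g.hom_sc h.hom_sc g.hom_Z h.hom_Z g.hom_X h.hom_X g.hom_Y h.hom_Y)
qed

section \<open>Projectivity of the terms\<close>

context conifold_resolution
begin

interpretation T: conifold_module "\<lambda>c. triple_map (W.sc3 c)" "W.triple_Z n" "triple_map left_X" "triple_map left_Y"
  for n
  by (rule W.triple_module)

interpretation S: sign_module sc "signed s Zo" for s
  by (rule W.signed_sign_module)

text \<open>Averaging the coordinates \<open>cf\<close> over the group \<open>{1, Z}\<close> gives maps to the group algebra that
  commute with \<open>Z\<close>; they extend to a dual basis over the conifold algebra.\<close>

definition theta :: "bool \<Rightarrow> 'i \<Rightarrow> 'w \<Rightarrow> complex \<times> complex" where
  "theta s i w = (cf i w / 2, cf i (signed s Zo w) / 2)"

lemma additive_theta: "additive (theta s i)"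
  by (simp add: additive_def theta_def additive.add[OF additive_cf] S.Z_add add_divide_distrib)

lemma theta_hom:
  "conifold_hom W.sc3 (signed s W.Z3) left_X left_Y group_alg.sc3 group_alg.Z3 left_X left_Y (lift3 (theta s i))"
  unfolding W.signed_Z3[abs_def]
  by (rule lift3_hom[OF S.sign_module_axioms group_alg.sign_module_axioms additive_theta])
    (simp_all add: theta_def cf_sc S.Z_sc S.Z_Z)

lemma finite_theta: "finite {i. theta s i w \<noteq> 0}"
  by (rule finite_subset[of _ "{i. cf i w \<noteq> 0} \<union> {i. cf i (signed s Zo w) \<noteq> 0}"])
    (auto simp: theta_def zero_prod_def finite_cf)

lemma finite_lift3_theta: "finite {i. lift3 (theta s i) f \<noteq> 0}"
proof (induction f rule: poly3_mono_induct)
  case (1 w k j l)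
  have "lift3 (theta s i) (mono3 w k j l) = mono3 (theta s i w) k j l" for i
    by (rule poly3_eqI) (simp add: c3_lift3 c3_mono3 additive.zero[OF additive_theta])
  then show ?case
    by (intro finite_subset[OF _ finite_theta[of s w]]) (auto simp: mono3_def)
next
  case (2 f g)
  then show ?case
    by (intro finite_subset[OF _ finite_UnI[OF 2]]) (auto simp: lift3_add[OF additive_theta])
qed

text \<open>The first halves add up to half of pr w, the second ones to half of Z pr (Z w), which is
  the same since \<open>pr\<close> commutes with Z and Z is an involution.\<close>

lemma sum_dual:
  assumes A: "finite A" "{i. theta s i w \<noteq> 0} \<subseteq> A"
  shows "(\<Sum>i\<in>A. S.orbit_map s (bv i) (theta s i w)) = pr w"
proof -
  have sub: "{i. cf i w \<noteq> 0} \<subseteq> A" "{i. cf i (signed s Zo w) \<noteq> 0} \<subseteq> A"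
    using A(2) by (auto simp: theta_def zero_prod_def)
  have pr: "pr v = (\<Sum>i\<in>A. sc (cf i v) (bv i))" if "{i. cf i v \<noteq> 0} \<subseteq> A" for v
    unfolding pr_eq_sum using that A(1) by (intro sum.mono_neutral_left) (auto simp: W.sc_zero_left)
  have half: "sc (a / 2) v = sc (1/2) (sc a v)" for a v
    using W.sc_mult[of "1/2" a v] by simp
  have "signed s Zo (pr (signed s Zo w)) = pr w"
    by (simp add: signed_def pr_Z additive.minus[OF additive_pr] W.Z_minus W.Z_Z)
  then have "pr w = (\<Sum>i\<in>A. sc (cf i (signed s Zo w)) (signed s Zo (bv i)))"
    using pr[OF sub(2)] by (simp add: additive.sum[OF S.additive_Z] S.Z_sc)
  note sum2 = this
  have "S.orbit_map s (bv i) (theta s i w) =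
      sc (1/2) (sc (cf i w) (bv i)) + sc (1/2) (sc (cf i (signed s Zo w)) (signed s Zo (bv i)))" for i
    by (simp add: S.orbit_map_def theta_def half[of "cf i _"])
  then have "(\<Sum>i\<in>A. S.orbit_map s (bv i) (theta s i w)) =
      sc (1/2) (\<Sum>i\<in>A. sc (cf i w) (bv i)) + sc (1/2) (\<Sum>i\<in>A. sc (cf i (signed s Zo w)) (signed s Zo (bv i)))"
    by (simp add: sum.distrib W.sc_sum)
  then have "(\<Sum>i\<in>A. S.orbit_map s (bv i) (theta s i w)) = sc (1/2) (pr w) + sc (1/2) (pr w)"
    using pr[OF sub(1)] sum2 by metis
  then show ?thesis
    using W.sc_half by simp
qed

lemma sum_lift3_dual:
  assumes A: "finite A" "{i. lift3 (theta s i) f \<noteq> 0} \<subseteq> A"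
  shows "(\<Sum>i\<in>A. lift3 (S.orbit_map s (bv i)) (lift3 (theta s i) f)) = lift3 pr f"
proof (rule poly3_eqI)
  fix k j l
  have "{i. theta s i (c3 f k j l) \<noteq> 0} \<subseteq> A"
  proof
    fix i assume "i \<in> {i. theta s i (c3 f k j l) \<noteq> 0}"
    then have "c3 (lift3 (theta s i) f) k j l \<noteq> 0"
      by (simp add: c3_lift3 additive.zero[OF additive_theta])
    then have "lift3 (theta s i) f \<noteq> 0" by auto
    then show "i \<in> A" using A(2) by auto
  qed
  then show "c3 (\<Sum>i\<in>A. lift3 (S.orbit_map s (bv i)) (lift3 (theta s i) f)) k j l = c3 (lift3 pr f) k j l"
    using sum_dual[OF A(1)]
    by (simp add: c3_sum c3_lift3 additive.zero[OF additive_theta] additive.zero[OF S.additive_orbit_map]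
        additive.zero[OF additive_pr])
qed

definition dual_coord :: "nat \<Rightarrow> 'i \<times> nat \<Rightarrow> 'w triple \<Rightarrow> (complex \<times> complex) poly3" where
  "dual_coord n k q = lift3 (theta (degree_sign n (snd k)) (fst k)) (comp3 (snd k) q)"

text \<open>A slot that does not occur in degree n is given the vector 0, so that all vectors lie in
  the n-th term.\<close>

definition dual_vector :: "nat \<Rightarrow> 'i \<times> nat \<Rightarrow> 'w triple" where
  "dual_vector n k = (let v = inject3 (snd k) (const3 (bv (fst k))) in if degree_shape n v then v else 0)"

lemma dual_coord_hom:
  "conifold_hom (\<lambda>c. triple_map (W.sc3 c)) (W.triple_Z n) (triple_map left_X) (triple_map left_Y)
    group_alg.sc3 group_alg.Z3 left_X left_Y (dual_coord n k)"
  unfolding dual_coord_def[abs_def] by (rule conifold_hom_comp[OF W.comp3_hom theta_hom])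

lemma dual_vector_fixed: "dual_vector n k \<in> fixed n"
proof -
  have "triple_map (lift3 pr) (inject3 t (const3 (bv i))) = inject3 t (const3 (bv i))" for t i
    by (simp add: inject3_def lift3_const[OF additive_pr] lift3_zero[OF additive_pr] pr_bv)
  then show ?thesis
    using zero_fixed by (auto simp: dual_vector_def Let_def fixed_def)
qed

text \<open>A ring element acts on 1 \<otimes> b through its normal form and
  \<open>orbit_map b\<close>, by \<open>free_op_const3\<close>. This translates the sums of
  \<open>sum_lift3_dual\<close> into linear combinations over the ring.\<close>

lemma dual_act:
  assumes "degree_shape n q" "dual_coord n k q \<noteq> 0" "nf p = dual_coord n k q"
  shows "T.free_op n p (dual_vector n k) = inject3 (snd k)
    (lift3 (S.orbit_map (degree_sign n (snd k)) (bv (fst k))) (dual_coord n k q))"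
proof -
  interpret inj: conifold_hom W.sc3 "signed (degree_sign n (snd k)) W.Z3" left_X left_Y
    "\<lambda>c. triple_map (W.sc3 c)" "W.triple_Z n" "triple_map left_X" "triple_map left_Y" "inject3 (snd k)"
    by (rule W.inject3_hom)
  have "comp3 (snd k) q \<noteq> 0"
    using assms(2) by (auto simp: dual_coord_def lift3_zero[OF additive_theta])
  then have "dual_vector n k = inject3 (snd k) (const3 (bv (fst k)))"
    using degree_shape_inject3[OF assms(1), of "snd k" "const3 (bv (fst k))"] by (simp add: dual_vector_def Let_def)
  then show ?thesis
    using S.free_op_const3[of "degree_sign n (snd k)" p "bv (fst k)"]
    by (simp add: assms(3) W.signed_Z3[abs_def] flip: inj.hom_free_op)
qed

lemma additive_inject3: "additive (inject3 t)"
  by (simp add: additive_def inject3_def)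

lemma sum_dual_triple:
  assumes q: "q \<in> fixed n"
  defines "K \<equiv> {k. snd k < 3 \<and> dual_coord n k q \<noteq> 0}"
  shows "finite K" and "(\<Sum>k\<in>K. inject3 (snd k)
    (lift3 (S.orbit_map (degree_sign n (snd k)) (bv (fst k))) (dual_coord n k q))) = q"
proof -
  define A where "A = (\<Union>t<3. {i. lift3 (theta (degree_sign n t) i) (comp3 t q) \<noteq> 0})"
  have A: "finite A"
    unfolding A_def by (intro finite_UN_I finite_lift3_theta) simp
  have sub: "K \<subseteq> A \<times> {..<3}"
    by (auto simp: K_def A_def dual_coord_def)
  then show "finite K"
    by (rule finite_subset) (use A in simp)
  let ?F = "\<lambda>k. inject3 (snd k) (lift3 (S.orbit_map (degree_sign n (snd k)) (bv (fst k))) (dual_coord n k q))"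
  have "sum ?F K = sum ?F (A \<times> {..<3})"
    using sub A
    by (intro sum.mono_neutral_left)
      (auto simp: K_def lift3_zero[OF S.additive_orbit_map] additive.zero[OF additive_inject3])
  also have "\<dots> = (\<Sum>t<3. \<Sum>i\<in>A. ?F (i, t))"
    unfolding sum.cartesian_product' by (subst sum.swap) simp
  also have "\<dots> = (\<Sum>t<3. inject3 t (lift3 pr (comp3 t q)))"
  proof (rule sum.cong[OF refl])
    fix t :: nat assume "t \<in> {..<3}"
    then have "{i. lift3 (theta (degree_sign n t) i) (comp3 t q) \<noteq> 0} \<subseteq> A"
      by (auto simp: A_def)
    from sum_lift3_dual[OF A this] show "(\<Sum>i\<in>A. ?F (i, t)) = inject3 t (lift3 pr (comp3 t q))"
      by (simp add: dual_coord_def flip: additive.sum[OF additive_inject3])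
  qed
  also have "\<dots> = (\<Sum>t<3. inject3 t (comp3 t q))"
    using q by (intro sum.cong refl arg_cong[where f = "inject3 _"])
      (cases q; auto simp: fixed_def comp3_def)
  finally show "sum ?F K = q"
    by (simp add: sum_inject3_comp3)
qed

text \<open>The values of \<open>dual_coord\<close> are normal forms and are read as ring elements
  by \<open>elt\<close>. These coordinates are linear over the ring because averaging made them
  commute with Z.\<close>

lemma P_projective: "projective_left_module R (P n)"
proof -
  interpret P: left_module R "P n" by (rule P_module)
  define unidx where "unidx = inv_into UNIV idx"
  have unidx: "unidx (idx k) = k" for k
    by (simp add: unidx_def inj_idx)
  define j where "j k x = elt (dual_coord n (unidx k) (dec x))" for k x
  \<comment> \<open>The index set has to lie in the type of the module elements, hence the injection
    \<open>idx\<close>.\<close>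
  define I where "I = idx ` {k. snd k < 3}"
  define v where "v k = enc (dual_vector n (unidx k))" for k
  have supp: "{k \<in> I. j k (enc q) \<noteq> \<zero>\<^bsub>R\<^esub>} = idx ` {k. snd k < 3 \<and> dual_coord n k q \<noteq> 0}"
    if "q \<in> fixed n" for q
  proof -
    have "j (idx k) (enc q) = \<zero>\<^bsub>R\<^esub> \<longleftrightarrow> dual_coord n k q = 0" for k
      unfolding j_def unidx dec_enc[OF that] using coords_elt elt_zero by metis
    then show ?thesis
      unfolding I_def by blast
  qed
  show ?thesis
  proof (rule P.projective_dual_basis[of I j v])
    fix k assume "k \<in> I"
    interpret D: conifold_hom "\<lambda>c. triple_map (W.sc3 c)" "W.triple_Z n" "triple_map left_X" "triple_map left_Y"
      group_alg.sc3 group_alg.Z3 left_X left_Y "dual_coord n (unidx k)"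
      by (rule dual_coord_hom)
    show "j k \<in> left_module_hom R (P n) (regular_module R)"
    proof (rule left_module_homI)
      fix x y assume "x \<in> carrier (P n)" "y \<in> carrier (P n)"
      then obtain q r where "x = enc q" "y = enc r" "q \<in> fixed n" "r \<in> fixed n"
        by (auto simp: carrier_P)
      moreover from this have "q + r \<in> fixed n"
        using fixed_submodule by (simp add: T.op_submodule_def)
      ultimately show "j k (x \<oplus>\<^bsub>P n\<^esub> y) = j k x \<oplus>\<^bsub>regular_module R\<^esub> j k y"
        by (simp add: j_def P_def dec_enc additive.add[OF D.additive_hom] elt_add regular_module_def)
    next
      fix a x assume "a \<in> carrier R" "x \<in> carrier (P n)"
      then obtain p q where "a = cl p" "x = enc q" "q \<in> fixed n"
        by (auto simp: carrier_P carrier_eq)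
      moreover from this have "T.free_op n p q \<in> fixed n"
        using T.op_submodule_free_op fixed_submodule by blast
      ultimately show "j k (a \<odot>\<^bsub>P n\<^esub> x) = a \<odot>\<^bsub>regular_module R\<^esub> j k x"
        by (simp add: j_def P_def dec_enc ring_act_cl[OF W.triple_module] D.hom_free_op elt_act
            regular_module_def)
    qed (simp add: j_def regular_module_def)
  next
    fix x assume "x \<in> carrier (P n)"
    then obtain q where q: "x = enc q" "q \<in> fixed n"
      by (auto simp: carrier_P)
    show "finite {i \<in> I. j i x \<noteq> \<zero>\<^bsub>R\<^esub>}"
      unfolding q(1) supp[OF q(2)] using sum_dual_triple(1)[OF q(2)] by simp
    let ?K = "{k. snd k < 3 \<and> dual_coord n k q \<noteq> 0}"
    let ?F = "\<lambda>k. inject3 (snd k) (lift3 (S.orbit_map (degree_sign n (snd k)) (bv (fst k))) (dual_coord n k q))"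
    have F: "T.free_op n (rep (j (idx k) x)) (dual_vector n k) = ?F k" if "k \<in> ?K" for k
    proof (rule dual_act)
      show "degree_shape n q" using q(2) by (simp add: fixed_def)
      show "nf (rep (j (idx k) x)) = dual_coord n k q"
        using coords_elt[of "dual_coord n k q"] by (simp add: coords_def j_def unidx q(1) dec_enc[OF q(2)])
    qed (use that in simp)
    have Fix: "?F k \<in> fixed n" if "k \<in> ?K" for k
      using F[OF that] T.op_submodule_free_op[OF fixed_submodule dual_vector_fixed] by metis
    have "finsum (P n) (\<lambda>i. j i x \<odot>\<^bsub>P n\<^esub> v i) {i \<in> I. j i x \<noteq> \<zero>\<^bsub>R\<^esub>} =
        finsum (P n) (\<lambda>i. enc (?F (unidx i))) (idx ` ?K)"
      unfolding q(1) supp[OF q(2)]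
    proof (rule P.M.finsum_cong'[OF refl])
      fix i assume "i \<in> idx ` ?K"
      then obtain k where k: "k \<in> ?K" "i = idx k" by blast
      then show "j i (enc q) \<odot>\<^bsub>P n\<^esub> v i = enc (?F (unidx i))"
        using F[OF k(1)] by (simp add: P_def v_def unidx dec_enc[OF dual_vector_fixed] ring_act_def q)
    qed (use Fix in \<open>auto simp: carrier_P unidx\<close>)
    also have "\<dots> = enc (\<Sum>i\<in>idx ` ?K. ?F (unidx i))"
      unfolding P_def
      by (rule enc_finsum) (use W.triple_module fixed_submodule dec_enc Fix sum_dual_triple(1)[OF q(2)] in \<open>auto simp: unidx\<close>)
    also have "(\<Sum>i\<in>idx ` ?K. ?F (unidx i)) = sum ?F ?K"
      by (subst sum.reindex) (use inj_idx in \<open>auto simp: unidx inj_on_def\<close>)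
    also have "\<dots> = q"
      by (rule sum_dual_triple(2)[OF q(2)])
    finally show "finsum (P n) (\<lambda>i. j i x \<odot>\<^bsub>P n\<^esub> v i) {i \<in> I. j i x \<noteq> \<zero>\<^bsub>R\<^esub>} = x"
      using q by simp
  qed (simp add: v_def carrier_P dual_vector_fixed)
qed

theorem resolution: "projective_resolution R M P d e"
  unfolding projective_resolution_def
  using P_projective d_hom e_hom e_surj exact_at_0 exact_at_Suc by simp

lemma P_trivial: "n > 3 \<Longrightarrow> carrier (P n) = {\<zero>\<^bsub>P n\<^esub>}"
proof -
  assume "n > 3"
  then have "fixed n = {0}"
    using zero_fixed[of n] by (auto simp: fixed_def degree_shape_def zero_prod_def)
  then show ?thesis
    by (simp add: carrier_P zero_P)
qed

end

section \<open>Global dimension\<close>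

lemma finite_support3:
  fixes f :: "'w::ab_group_add poly3"
  shows "finite {(k, j, i). c3 f k j i \<noteq> 0}"
proof (induction f rule: poly3_mono_induct)
  case (1 w k j i)
  show ?case
    by (rule finite_subset[of _ "{(k, j, i)}"]) (auto simp: c3_mono3 split: if_splits)
next
  case (2 f g)
  show ?case
    by (rule finite_subset[OF _ finite_UnI[OF 2]]) auto
qed

text \<open>Slot and exponents are packed into one number by the pairing function; this prepares the
  coding of triples as lists.\<close>

definition coeff_seq :: "'w::ab_group_add triple \<Rightarrow> nat \<Rightarrow> 'w" where
  "coeff_seq q n = (let (t, n') = prod_decode n; (k, n'') = prod_decode n'; (j, i) = prod_decode n''
     in if t < 3 then c3 (comp3 t q) k j i else 0)"

lemma coeff_seq_encode:
  "t < 3 \<Longrightarrow> coeff_seq q (prod_encode (t, prod_encode (k, prod_encode (j, i)))) = c3 (comp3 t q) k j i"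
  by (simp add: coeff_seq_def)

lemma coeff_seq_eqD: "coeff_seq q = coeff_seq r \<Longrightarrow> q = r"
proof -
  assume eq: "coeff_seq q = coeff_seq r"
  have "comp3 t q = comp3 t r" if "t < 3" for t
    using coeff_seq_encode[OF that, of q] coeff_seq_encode[OF that, of r] eq
    by (intro poly3_eqI) metis
  from this[of 0] this[of 1] this[of 2] show "q = r"
    by (cases q; cases r) (simp add: comp3_def)
qed

lemma finite_coeff_seq: "finite {n. coeff_seq q n \<noteq> 0}"
proof (rule finite_subset)
  show "{n. coeff_seq q n \<noteq> 0} \<subseteq> (\<Union>t<3. (\<lambda>(k, j, i). prod_encode (t, prod_encode (k, prod_encode (j, i)))) `
      {(k, j, i). c3 (comp3 t q) k j i \<noteq> 0})"
  proof
    fix n assume n: "n \<in> {n. coeff_seq q n \<noteq> 0}"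
    obtain t k j i where "n = prod_encode (t, prod_encode (k, prod_encode (j, i)))"
      by (metis prod_decode_inverse surj_pair)
    moreover from this have "t < 3" "c3 (comp3 t q) k j i \<noteq> 0"
      using n by (auto simp: coeff_seq_def split: if_splits)
    ultimately show "n \<in> (\<Union>t<3. (\<lambda>(k, j, i). prod_encode (t, prod_encode (k, prod_encode (j, i)))) `
      {(k, j, i). c3 (comp3 t q) k j i \<noteq> 0})"
      by force
  qed
qed (intro finite_UN_I finite_imageI finite_support3, simp)

definition seq_bound :: "'w::ab_group_add triple \<Rightarrow> nat" where
  "seq_bound q = (LEAST N. \<forall>n\<ge>N. coeff_seq q n = 0)"

lemma seq_bound: "n \<ge> seq_bound q \<Longrightarrow> coeff_seq q n = 0"
proof -
  obtain N where "\<forall>n\<in>{n. coeff_seq q n \<noteq> 0}. n < N"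
    using finite_nat_set_iff_bounded finite_coeff_seq by metis
  then have "\<forall>n\<ge>N. coeff_seq q n = 0"
    using leD by blast
  then have "\<forall>n\<ge>seq_bound q. coeff_seq q n = 0"
    unfolding seq_bound_def by (rule LeastI)
  then show "n \<ge> seq_bound q \<Longrightarrow> coeff_seq q n = 0" by blast
qed

definition list_code :: "('w \<Rightarrow> 'b) \<Rightarrow> 'w::ab_group_add triple \<Rightarrow> 'b list" where
  "list_code g q = map (\<lambda>n. g (coeff_seq q n)) [0..<seq_bound q]"

text \<open>Equal lists have equal lengths, hence equal bounds, beyond which all coefficients
  vanish.\<close>

lemma inj_list_code:
  assumes "\<And>q n. q \<in> Q \<Longrightarrow> coeff_seq q n \<in> V" "inj_on g V"
  shows "inj_on (list_code g) Q"
proof (rule inj_onI)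
  fix q r assume qr: "q \<in> Q" "r \<in> Q" and eq: "list_code g q = list_code g r"
  have len: "seq_bound q = seq_bound r"
    using arg_cong[OF eq, of length] by (simp add: list_code_def)
  have "coeff_seq q n = coeff_seq r n" for n
  proof (cases "n < seq_bound q")
    case True
    then have "g (coeff_seq q n) = g (coeff_seq r n)"
      using eq len by (auto simp: list_code_def)
    then show ?thesis
      using assms(2) assms(1)[OF qr(1)] assms(1)[OF qr(2)] by (auto dest: inj_onD)
  next
    case False
    then show ?thesis
      using seq_bound[of q n] seq_bound[of r n] len by simp
  qed
  then show "q = r"
    by (intro coeff_seq_eqD ext)
qed

context conifold_quotient
begin

lemma projective_dimension_le_3:
  fixes M :: "('a, 'm) module"
  assumes "left_module R M"
  shows "projective_dimension R M \<le> 3"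
proof -
  interpret M: left_module R M by fact
  interpret L: conifold_left_module R cl M
    by (intro conifold_left_module.intro conifold_quotient_axioms assms)
  interpret W: conifold_module cscale L.Z_op "L.op free_X" "L.op free_Y"
    by (rule L.op_module)
  \<comment> \<open>A coefficient fixed by \<open>proj\<close> is determined by its image under
    \<open>realize\<close>, so an element of M can stand for it in the list; the ring component is a
    filler.\<close>
  define enc :: "('m \<Rightarrow>\<^sub>0 complex) triple \<Rightarrow> ('m \<times> 'a) list" where
    "enc = list_code (\<lambda>w. (L.realize w, undefined))"
  \<comment> \<open>The length of the list records t, and \<open>Suc\<close> keeps the list nonempty
    so that m can be recovered.\<close>
  define idx :: "'m \<times> nat \<Rightarrow> ('m \<times> 'a) list" where
    "idx = (\<lambda>(m, t). replicate (Suc t) (m, undefined))"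
  \<comment> \<open>The dual basis for the image of \<open>proj\<close> consists of the coordinate
    functions and the projected point masses.\<close>
  interpret res: conifold_resolution R cl cscale L.Z_op "L.op free_X" "L.op free_Y" M L.proj
    "\<lambda>m w. Poly_Mapping.lookup w m" "\<lambda>m. L.proj (Poly_Mapping.single m 1)" L.realize enc idx
  proof (unfold_locales, goal_cases)
    case (1 x y) then show ?case by (rule L.proj_add)
  next
    case (2 c w) then show ?case by (rule L.proj_cscale)
  next
    case (3 w) then show ?case by (simp add: L.proj_Z_op L.Z_op_proj)
  next
    case (4 w) then show ?case by (simp add: L.op_proj)
  next
    case (5 w) then show ?case by (simp add: L.op_proj)
  next
    case (6 i) then show ?case by (simp add: L.proj_eq_op L.op_mult)
  next
    case (7 w) then show ?case by (simp add: L.proj_eq_op L.op_mult)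
  next
    case (8 i x y) then show ?case by (simp add: lookup_add)
  next
    case (9 i c w) then show ?case by simp
  next
    case (10 w)
    then show ?case by simp
  next
    case (11 w)
    have "L.proj w = L.proj (\<Sum>u\<in>Poly_Mapping.keys w. Poly_Mapping.single u (Poly_Mapping.lookup w u))"
      by (subst poly_mapping_eq_sum_single[of w]) simp
    also have "\<dots> = (\<Sum>u\<in>Poly_Mapping.keys w. cscale (Poly_Mapping.lookup w u) (L.proj (Poly_Mapping.single u 1)))"
      by (simp add: additive.sum[of L.proj] additive_def L.proj_add cscale_single flip: L.proj_cscale)
    also have "Poly_Mapping.keys w = {i. Poly_Mapping.lookup w i \<noteq> 0}"
      by (auto simp: in_keys_iff)
    finally show ?case .
  next
    case (12 w) then show ?case by simp
  next
    case (13 x) then show ?case using L.realize_section by blast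
  next
    case (14 v w) then show ?case by (rule L.realize_add)
  next
    case (15 p w) then show ?case by (rule L.realize_free_op)
  next
    case (16 w)
    then show ?case
      by (metis L.proj_def L.realize_proj L.realize_zero L.section_zero)
  next
    case 17
    have "coeff_seq q n = L.proj (coeff_seq q n)" if "triple_map (lift3 L.proj) q = q" for q n
    proof -
      have "comp3 t q = lift3 L.proj (comp3 t q)" for t
        using that by (cases q) (auto simp: comp3_def)
      then have "c3 (comp3 t q) k j i = L.proj (c3 (comp3 t q) k j i)" for t k j i
        using c3_lift3[of L.proj "comp3 t q" k j i] L.proj_add[of 0 0] by simp
      moreover have "L.proj 0 = 0"
        using L.proj_add[of 0 0] by simp
      ultimately show ?thesis
        by (auto simp: coeff_seq_def split: prod.split)
    qed
    then show ?case
      unfolding enc_def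
      by (intro inj_list_code[where V = "{w. w = L.proj w}"])
        (auto intro!: inj_onI simp: L.proj_def)
  next
    case 18
    show ?case
      by (rule injI) (auto simp: idx_def dest: arg_cong[of _ _ length])
  qed
  have "projective_resolution R M res.P res.d res.e" "\<forall>i>3. carrier (res.P i) = {\<zero>\<^bsub>res.P i\<^esub>}"
    using res.resolution res.P_trivial by auto
  then have "projective_dimension R M \<le> enat 3"
    unfolding projective_dimension_def by (intro Inf_lower) blast
  then show ?thesis
    by (simp add: numeral_eq_enat)
qed

lemma inj_scalar: "cl (Poly_Mapping.single 0 a) = cl (Poly_Mapping.single 0 b) \<longleftrightarrow> a = b"
proof -
  have "nf (Poly_Mapping.single 0 a) = const3 (a, 0)" for a
    by (rule poly3_eqI)
      (auto simp: nf_def nf.free_op_simps nf_one_def c3_lift3 c3_const3 group_alg.sc_zero)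
  then show ?thesis
    by (auto simp: cl_eq_iff_nf const3_def)
qed

end

section \<open>The lower bound from the trivial module\<close>

interpretation trivial: conifold_module "(*) :: complex \<Rightarrow> complex \<Rightarrow> complex" "\<lambda>w. w" "\<lambda>_. 0" "\<lambda>_. 0"
  by unfold_locales (simp_all add: algebra_simps)

interpretation trivial_triple: conifold_module "\<lambda>c. triple_map (trivial.sc3 c)" "trivial.triple_Z n"
    "triple_map left_X" "triple_map left_Y" for n
  by (rule trivial.triple_module)

context conifold_quotient
begin

text \<open>The complex numbers are copied onto the scalars of the ring, in the right summand of the
  type, which has room for them whatever \<open>'m\<close> is. So this module takes part in the
  supremum.\<close>

definition trivial_module :: "('a, 'm + 'a) module" where
  "trivial_module = enc_module UNIV (\<lambda>c. Inr (cl (Poly_Mapping.single 0 c)))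
     (\<lambda>x. SOME c. x = Inr (cl (Poly_Mapping.single 0 c))) (ring_act (*) (\<lambda>w. w) (\<lambda>_. 0) (\<lambda>_. 0))"

lemma trivial_module: "left_module R (trivial_module :: ('a, 'm + 'a) module)"
  unfolding trivial_module_def
  by (rule enc_left_module[OF trivial.conifold_module_axioms])
    (simp_all add: trivial.op_submodule_def inj_scalar)

lemma projective_dimension_trivial: "3 \<le> projective_dimension R (trivial_module :: ('a, 'm + 'a) module)"
proof -
  let ?M = "trivial_module :: ('a, 'm + 'a) module"
  interpret M: left_module R ?M by (rule trivial_module)
  \<comment> \<open>The competing resolution lives on lists, but this one may stay on triples, since
    the comparison allows different types.\<close>
  define enc :: "complex triple \<Rightarrow> complex triple" where "enc = (\<lambda>q. q)"
  define idx :: "unit \<times> nat \<Rightarrow> complex triple" where "idx = (\<lambda>(_, n). (const3 (of_nat n), 0, 0))"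
  interpret res: conifold_resolution R cl "(*)" "\<lambda>w. w" "\<lambda>_. 0" "\<lambda>_. 0" ?M "\<lambda>w. w"
    "\<lambda>_ w. w" "\<lambda>_ :: unit. 1" "\<lambda>c. Inr (cl (Poly_Mapping.single 0 c))" enc idx
  proof (intro conifold_resolution.intro conifold_resolution_axioms.intro conifold_quotient_axioms
      trivial.conifold_module_axioms trivial_module, goal_cases)
    case (11 w)
    have "{i :: unit. w \<noteq> 0} = (if w = 0 then {} else {()})" by auto
    then show ?case by simp
  next
    case (12 w) then show ?case by (simp add: trivial_module_def)
  next
    case (13 x) then show ?case by (auto simp: trivial_module_def)
  next
    case (14 v w) then show ?case by (simp add: trivial_module_def inj_scalar)
  next
    case (15 p w)
    then show ?case
      by (simp add: trivial_module_def inj_scalar ring_act_cl[OF trivial.conifold_module_axioms])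
  next
    case (16 w) then show ?case using inj_scalar[of w 0] by (simp add: trivial_module_def)
  next
    case 18
    show ?case
      by (rule injI) (auto simp: idx_def const3_def)
  qed (auto simp: enc_def additive_def)
  have enc_apply: "enc q = q" for q
    by (simp add: enc_def)
  have fixed: "q \<in> res.fixed n \<longleftrightarrow> degree_shape n q" for q n
    by (cases q) (simp add: res.fixed_def lift3_id)
  have dec: "res.dec q = q" if "q \<in> res.fixed n" for q n
    using res.dec_enc[OF that] by (simp add: enc_apply)
  have "3 \<le> n" if P: "projective_resolution R ?M P d e" and triv: "\<forall>i>n. carrier (P i) = {\<zero>\<^bsub>P i\<^esub>}"
    for n and P :: "nat \<Rightarrow> ('a, (('m + 'a) \<times> 'a) list) module" and d e
  proof (rule ccontr)
    assume "\<not> 3 \<le> n"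
    then have P3: "carrier (P 3) = {\<zero>\<^bsub>P 3\<^esub>}"
      using triv by simp
    obtain h where h: "h \<in> left_module_hom R (res.P 2) (res.P 3)"
      and split: "\<And>x. x \<in> carrier (res.P 3) \<Longrightarrow> h (res.d 2 x) = x"
      using split_of_short_resolution[OF trivial_module P res.resolution P3 res.P_trivial] by auto
    let ?t = "const3 1 :: complex poly3"
    have shape: "degree_shape 2 q" "degree_shape 3 (?t, 0, 0)" for q :: "complex triple"
      by (auto simp: degree_shape_def split: prod.split)
    have carrier: "carrier (res.P n) = res.fixed n" for n
      unfolding res.carrier_P by (simp add: enc_apply)
    have add: "x \<oplus>\<^bsub>res.P n\<^esub> y = x + y" if "x \<in> res.fixed n" "y \<in> res.fixed n" for n x y
      using that by (simp add: res.P_def dec) (simp add: enc_apply)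
    have act: "cl p \<odot>\<^bsub>res.P n\<^esub> x = trivial_triple.free_op n p x" if "x \<in> res.fixed n" for n p x
      using that by (simp add: res.P_def dec ring_act_cl[OF trivial.triple_module]) (simp add: enc_apply)
    have zero: "lift3 (\<lambda>_. 0) f = (0 :: complex poly3)" for f :: "complex poly3"
      by (rule poly3_eqI) (simp add: c3_lift3)
    have zop0: "trivial.zop = (\<lambda>_. 0)"
      by (simp add: fun_eq_iff trivial.zop_def)
    have ops0: "left_X 0 = (0 :: complex poly3)" "left_Y 0 = (0 :: complex poly3)" "left_z 0 = (0 :: complex poly3)"
      by (rule poly3_eqI; simp add: c3_simps split: nat.split)+
    have half: "trivial.sc3 (1/2) (left_X (left_Y f) + left_Y (left_X f)) = left_z f" for f
      using fun_cong[OF trivial.zop_induced, of f]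
      by (simp only: conifold_module.zop_def[OF trivial.induced_module])
    have zop: "trivial_triple.zop q = triple_map left_z q" for q
      by (cases q) (simp add: trivial_triple.zop_def half)
    \<comment> \<open>The leftmost map sends 1 to z E1 - Y E2 - X E3. A splitting h would make (1,
      0, 0) equal to z h(E1) - Y h(E2) - X h(E3).\<close>
    define E1 :: "complex triple" where "E1 = (?t, 0, 0)"
    define E2 :: "complex triple" where "E2 = (0, ?t, 0)"
    define E3 :: "complex triple" where "E3 = (0, 0, ?t)"
    note E = E1_def E2_def E3_def
    have Efix: "E1 \<in> res.fixed 2" "E2 \<in> res.fixed 2" "E3 \<in> res.fixed 2"
      by (simp_all add: fixed shape)
    define A where "A = trivial_triple.free_op 2 free_z E1"
    define B where "B = trivial_triple.free_op 2 free_Y E2"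
    define C where "C = trivial_triple.free_op 2 free_X E3"
    have abc: "A \<in> res.fixed 2" "B \<in> res.fixed 2" "C \<in> res.fixed 2"
      by (simp_all add: fixed shape)
    have "res.d 2 (?t, 0, 0) = (left_z ?t, - left_Y ?t, - left_X ?t)"
    proof -
      have "(?t, 0, 0) \<in> res.fixed (Suc 2)"
        using shape(2) by (simp add: fixed eval_nat_numeral)
      then have "res.d 2 (?t, 0, 0) = trivial.boundary 2 (?t, 0, 0)"
        using res.d_enc[of "(?t, 0, 0)" 2] by (simp add: enc_apply)
      also have "\<dots> = (left_z ?t, - left_Y ?t, - left_X ?t)"
        by (simp add: eval_nat_numeral trivial.dz_def trivial.eY_def trivial.eX_def zero
            zop0 trivial.right_const3)
      finally show ?thesis .
    qed
    moreover have "A = (left_z ?t, 0, 0)" "B = (0, left_Y ?t, 0)" "C = (0, 0, left_X ?t)"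
      by (simp_all add: A_def B_def C_def E trivial_triple.free_op_z zop ops0 trivial_triple.free_op_X
          trivial_triple.free_op_Y)
    ultimately have "A = res.d 2 (?t, 0, 0) + (B + C)"
      by simp
    moreover have "res.d 2 (?t, 0, 0) \<in> res.fixed 2" "B + C \<in> res.fixed 2"
      by (simp_all add: fixed shape)
    ultimately have "h A = h (res.d 2 (?t, 0, 0)) \<oplus>\<^bsub>res.P 3\<^esub> (h B \<oplus>\<^bsub>res.P 3\<^esub> h C)"
      using left_module_homD(2)[OF h, of "res.d 2 (?t, 0, 0)" "B + C"] left_module_homD(2)[OF h, of B C] abc
      by (simp add: carrier add)
    moreover have "h (res.d 2 (?t, 0, 0)) = (?t, 0, 0)"
      by (rule split) (simp add: carrier fixed shape)
    moreover have hfix: "h x \<in> res.fixed 3" if "x \<in> res.fixed 2" for x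
      using left_module_homD(1)[OF h, of x] that by (simp add: carrier)
    moreover have "h B + h C \<in> res.fixed 3"
      using hfix[OF abc(2)] hfix[OF abc(3)] by (cases "h B"; cases "h C") (simp add: fixed degree_shape_def)
    ultimately have eq: "h A = (?t, 0, 0) + (h B + h C)"
      using abc shape(2) by (simp add: add fixed)
    have hact: "h (trivial_triple.free_op 2 p x) = trivial_triple.free_op 3 p (h x)" if "x \<in> res.fixed 2" for p x
      using left_module_homD(3)[OF h, of "cl p" x] that hfix[OF that] by (simp add: carrier act)
    have "h A = triple_map left_z (h E1)" "h B = triple_map left_Y (h E2)" "h C = triple_map left_X (h E3)"
      unfolding A_def B_def C_def hact[OF Efix(1)] hact[OF Efix(2)] hact[OF Efix(3)]
      by (simp_all add: trivial_triple.free_op_z zop trivial_triple.free_op_X trivial_triple.free_op_Y)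
    then have "left_z (fst (h E1)) = ?t + (left_Y (fst (h E2)) + left_X (fst (h E3)))"
      using eq by (cases "h E1"; cases "h E2"; cases "h E3") simp
    \<comment> \<open>Left multiples of z, Y and X have no constant coefficient, so this equation
      reads 0 = 1.\<close>
    then have "c3 (left_z (fst (h E1))) 0 0 0 = c3 (?t + (left_Y (fst (h E2)) + left_X (fst (h E3)))) 0 0 0"
      by simp
    then show False
      by (simp add: c3_simps c3_const3)
  qed
  then have "enat 3 \<le> projective_dimension R ?M"
    unfolding projective_dimension_def by (intro Inf_greatest) auto
  then show ?thesis
    by (simp add: numeral_eq_enat)
qed

theorem left_global_dimension_eq_3: "left_global_dimension TYPE('m) R = 3"
  unfolding left_global_dimension_def
proof (rule antisym)
  show "(SUP M\<in>{M :: ('a, 'm + 'a) module. left_module R M}. projective_dimension R M) \<le> 3"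
    by (intro SUP_least) (simp add: projective_dimension_le_3)
  show "3 \<le> (SUP M\<in>{M :: ('a, 'm + 'a) module. left_module R M}. projective_dimension R M)"
    by (rule SUP_upper2[of trivial_module]) (simp_all add: trivial_module projective_dimension_trivial)
qed

end

section \<open>The opposite ring\<close>

definition rev_word :: "word \<Rightarrow> word" where
  "rev_word u = Word (rev (letters u))"

lemma rev_word_rev_word [simp]: "rev_word (rev_word u) = u"
  by (simp add: rev_word_def)

lemma inj_rev_word: "inj rev_word"
  by (metis injI rev_word_rev_word)

definition rev_alg :: "free_alg \<Rightarrow> free_alg" where
  "rev_alg = Poly_Mapping.map_key rev_word"

lemma rev_alg_single: "rev_alg (Poly_Mapping.single u c) = Poly_Mapping.single (rev_word u) c"
  using map_key_single[OF inj_rev_word, of "rev_word u" c] by (simp add: rev_alg_def)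

lemma rev_alg_add: "rev_alg (p + q) = rev_alg p + rev_alg q"
  by (simp add: rev_alg_def map_key_plus[OF inj_rev_word])

lemma additive_rev_alg: "additive rev_alg"
  by (simp add: additive_def rev_alg_add)

lemma rev_alg_mult: "rev_alg (p * q) = rev_alg q * rev_alg p"
proof -
  have single: "rev_alg (Poly_Mapping.single u c * Poly_Mapping.single v d) =
      rev_alg (Poly_Mapping.single v d) * rev_alg (Poly_Mapping.single u c)" for u c v d
    by (simp add: mult_single rev_alg_single rev_word_def plus_word_def mult.commute)
  have "rev_alg (Poly_Mapping.single u c * q) = rev_alg q * rev_alg (Poly_Mapping.single u c)" for u c
    by (rule additive_eqI_single[where p = q and f = "\<lambda>q. rev_alg (Poly_Mapping.single u c * q)"
          and g = "\<lambda>q. rev_alg q * rev_alg (Poly_Mapping.single u c)"])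
      (unfold additive_def distrib_left rev_alg_add distrib_right single, simp_all)
  then show ?thesis
    by (intro additive_eqI_single[where p = p and f = "\<lambda>p. rev_alg (p * q)"
          and g = "\<lambda>p. rev_alg q * rev_alg p"])
      (unfold additive_def distrib_left rev_alg_add distrib_right, simp_all)
qed

lemma rev_alg_rev_alg: "rev_alg (rev_alg p) = p"
  by (rule additive_eqI_single[where p = p and f = "\<lambda>p. rev_alg (rev_alg p)" and g = "\<lambda>p. p"])
    (simp_all add: additive_def rev_alg_add rev_alg_single)

text \<open>Reversal fixes the first three relations and changes the sign of the two
  commutators.\<close>

lemma rev_alg_ideal: "p \<in> conifold_ideal \<Longrightarrow> rev_alg p \<in> conifold_ideal"
proof -
  interpret I: ideal conifold_ideal "ring_of_type_algebra :: free_alg ring"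
    by (rule ideal_conifold)
  have I: "0 \<in> conifold_ideal" "a \<in> conifold_ideal \<Longrightarrow> b \<in> conifold_ideal \<Longrightarrow> a + b \<in> conifold_ideal"
    "a \<in> conifold_ideal \<Longrightarrow> r * a \<in> conifold_ideal" "a \<in> conifold_ideal \<Longrightarrow> a * r \<in> conifold_ideal"
    for a b r
    using I.zero_closed I.a_closed[of a b] I.I_l_closed[of a r] I.I_r_closed[of a r]
    by (simp_all add: ring_of_type_algebra_def)
  have gens: "rev_alg free_X = free_X" "rev_alg free_Y = free_Y" "rev_alg free_Z = free_Z" "rev_alg 1 = 1"
    by (simp_all add: free_X_def free_Y_def free_Z_def rev_alg_single rev_word_def zero_word_def
        flip: single_one)
  have "ideal {p. rev_alg p \<in> conifold_ideal} ring_of_type_algebra"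
    using additive.zero[OF additive_rev_alg]
    by (intro ideal_of_type_algebraI) (simp_all add: I rev_alg_add rev_alg_mult)
  moreover have "conifold_relations \<subseteq> {p. rev_alg p \<in> conifold_ideal}"
  proof -
    have minus: "- r \<in> conifold_ideal" if "r \<in> conifold_ideal" for r
      using I(3)[OF that, of "- 1"] by simp
    show ?thesis
      using relation_in_ideal[of "free_Z^2 - 1"] relation_in_ideal[of "free_X * free_Z + free_Z * free_X"]
        relation_in_ideal[of "free_Y * free_Z + free_Z * free_Y"]
        minus[OF relation_in_ideal[of "commutator (free_X^2) free_Y"]] minus[OF relation_in_ideal[of "commutator (free_Y^2) free_X"]]
      by (auto simp: conifold_relations_def additive.diff[OF additive_rev_alg] rev_alg_add rev_alg_mult gens
          power2_eq_square commutator_def add.commute mult.assoc)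
  qed
  ultimately have "conifold_ideal \<subseteq> {p. rev_alg p \<in> conifold_ideal}"
    unfolding conifold_ideal_def by (rule free_ring.genideal_minimal)
  then show "p \<in> conifold_ideal \<Longrightarrow> rev_alg p \<in> conifold_ideal" by blast
qed

lemma ring_opposite:
  assumes "ring R"
  shows "ring (opposite_ring R)"
proof -
  interpret ring R by fact
  show ?thesis
  proof (rule ringI)
    show "abelian_group (opposite_ring R)"
    proof (rule abelian_groupI)
      fix x assume "x \<in> carrier (opposite_ring R)"
      then show "\<exists>y\<in>carrier (opposite_ring R). y \<oplus>\<^bsub>opposite_ring R\<^esub> x = \<zero>\<^bsub>opposite_ring R\<^esub>"
        by (intro bexI[of _ "\<ominus>\<^bsub>R\<^esub> x"]) (simp_all add: opposite_ring_def l_neg)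
    qed (auto simp: opposite_ring_def a_ac)
    show "Group.monoid (opposite_ring R)"
      by (rule monoidI) (auto simp: opposite_ring_def m_assoc)
  qed (auto simp: opposite_ring_def l_distr r_distr)
qed

interpretation opposite: conifold_quotient "opposite_ring conifold" "\<lambda>p. conifold_class (rev_alg p)"
proof (intro conifold_quotient.intro conifold_quotient_axioms.intro)
  show "ring (opposite_ring conifold)"
    by (rule ring_opposite) (rule conifold.ring_axioms)
  show "carrier (opposite_ring conifold) = range (\<lambda>p. conifold_class (rev_alg p))"
    using rev_alg_rev_alg by (auto simp: opposite_ring_def conifold.carrier_eq) (metis rangeI)
  show "conifold_class (rev_alg p) = \<zero>\<^bsub>opposite_ring conifold\<^esub> \<longleftrightarrow> p \<in> conifold_ideal" for p
    using rev_alg_ideal[of p] rev_alg_ideal[of "rev_alg p"]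
    by (auto simp: opposite_ring_def conifold.cl_eq_zero_iff rev_alg_rev_alg)
  have "rev_alg 1 = 1"
    by (simp add: rev_alg_single rev_word_def zero_word_def flip: single_one)
  then show "conifold_class (rev_alg 1) = \<one>\<^bsub>opposite_ring conifold\<^esub>"
    by (simp add: opposite_ring_def conifold.cl_one)
qed (simp_all add: opposite_ring_def rev_alg_add rev_alg_mult conifold.cl_add conifold.cl_mult)

lemma global_dimension_conifold:
  "left_global_dimension TYPE('m) conifold = 3" "right_global_dimension TYPE('m) conifold = 3"
  unfolding right_global_dimension_def
  by (rule conifold.left_global_dimension_eq_3 opposite.left_global_dimension_eq_3)+

section \<open>The center and the basis\<close>

context conifold_module
begin

lemma central_homs:
  "conifold_hom sc Zo Xo Yo sc Zo Xo Yo (\<lambda>w. Xo (Xo w))"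
  "conifold_hom sc Zo Xo Yo sc Zo Xo Yo (\<lambda>w. Yo (Yo w))"
  "conifold_hom sc Zo Xo Yo sc Zo Xo Yo zop"
  "conifold_hom sc Zo Xo Yo sc Zo Xo Yo (sc c)"
proof -
  show "conifold_hom sc Zo Xo Yo sc Zo Xo Yo (\<lambda>w. Xo (Xo w))"
    by unfold_locales (simp_all add: additive_def X_add X_sc X_Z X_minus XXY)
  show "conifold_hom sc Zo Xo Yo sc Zo Xo Yo (\<lambda>w. Yo (Yo w))"
    by unfold_locales (simp_all add: additive_def Y_add Y_sc Y_Z Y_minus YYX)
  show "conifold_hom sc Zo Xo Yo sc Zo Xo Yo zop"
    by unfold_locales (simp_all add: additive.add[OF additive_zop] zop_sc zop_Z zop_X zop_Y)
  have "sc a (sc b w) = sc b (sc a w)" for a b w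
    by (metis mult.commute sc_mult)
  then show "conifold_hom sc Zo Xo Yo sc Zo Xo Yo (sc c)"
    by unfold_locales (simp_all add: sc_add Z_sc X_sc Y_sc)
qed

end

context conifold_quotient
begin

lemma cl_power: "cl (p ^ n) = cl p [^]\<^bsub>R\<^esub> n"
proof (induction n)
  case (Suc n)
  have "cl (p ^ Suc n) = cl (p ^ n) \<otimes>\<^bsub>R\<^esub> cl p"
    unfolding power_Suc2 by (rule cl_mult)
  then show ?case
    by (simp add: Suc)
qed (simp add: cl_one)

lemma cl_finsum: "finite A \<Longrightarrow> finsum R (\<lambda>i. cl (F i)) A = cl (sum F A)"
  by (induction A rule: finite_induct) (simp_all add: cl_zero cl_add)

text \<open>If c acts linearly over the algebra, then c (p 1) = p (c 1), so c p and p c have the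
  same normal form.\<close>

lemma central_if_hom:
  assumes "conifold_hom group_alg.sc3 group_alg.Z3 left_X left_Y group_alg.sc3 group_alg.Z3 left_X left_Y
    (nf.free_op c)"
  shows "cl c \<in> ring_center R"
proof -
  interpret h: conifold_hom group_alg.sc3 group_alg.Z3 left_X left_Y group_alg.sc3 group_alg.Z3
    left_X left_Y "nf.free_op c"
    by fact
  have "nf (c * p) = nf (p * c)" for p
    unfolding nf_mult by (simp add: nf_def h.hom_free_op)
  then show ?thesis
    by (auto simp: ring_center_def cl_eq_iff_nf simp flip: cl_mult elim!: carrier_cases)
qed

lemma central_generators:
  "cl (free_X ^ 2) \<in> ring_center R" "cl (free_Y ^ 2) \<in> ring_center R"
  "cl free_z \<in> ring_center R" "cl (Poly_Mapping.single 0 c) \<in> ring_center R"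
proof -
  have "nf.free_op (free_X ^ 2) = (\<lambda>f. left_X (left_X f))" "nf.free_op (free_Y ^ 2) = (\<lambda>f. left_Y (left_Y f))"
    "nf.free_op free_z = nf.zop" "nf.free_op (Poly_Mapping.single 0 c) = group_alg.sc3 c"
    by (simp_all add: fun_eq_iff power2_eq_square nf.free_op_simps nf.free_op_z)
  then show "cl (free_X ^ 2) \<in> ring_center R" "cl (free_Y ^ 2) \<in> ring_center R"
    "cl free_z \<in> ring_center R" "cl (Poly_Mapping.single 0 c) \<in> ring_center R"
    by (auto intro!: central_if_hom simp: nf.central_homs)
qed

end

lemma (in ring) generate_ring_central:
  assumes "S \<subseteq> ring_center R"
  shows "generate_ring R S \<subseteq> ring_center R"
proof
  fix a assume "a \<in> generate_ring R S"
  then show "a \<in> ring_center R"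
  proof induction
    case one
    then show ?case by (simp add: ring_center_def)
  next
    case (incl h)
    then show ?case using assms by auto
  next
    case (a_inv h)
    then show ?case by (simp add: ring_center_def l_minus r_minus)
  next
    case (eng_add a b)
    then show ?case by (simp add: ring_center_def l_distr r_distr)
  next
    case (eng_mult a b)
    have mem: "a \<in> carrier R" "b \<in> carrier R"
      and com: "\<And>c. c \<in> carrier R \<Longrightarrow> a \<otimes> c = c \<otimes> a" "\<And>c. c \<in> carrier R \<Longrightarrow> b \<otimes> c = c \<otimes> b"
      using eng_mult.IH unfolding ring_center_def by blast+
    have "a \<otimes> b \<otimes> c = c \<otimes> (a \<otimes> b)" if c: "c \<in> carrier R" for c
      by (metis c com mem m_assoc)
    then show ?case
      using mem by (simp add: ring_center_def)
  qed
qed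

lemma conifold_generators:
  "conifold_X = conifold_class free_X" "conifold_Y = conifold_class free_Y" "conifold_Z = conifold_class free_Z"
  "conifold_x = conifold_class (free_X ^ 2)" "conifold_y = conifold_class (free_Y ^ 2)"
  "conifold_z = conifold_class free_z" "conifold_scal c = conifold_class (Poly_Mapping.single 0 c)"
  by (simp_all add: conifold_X_def conifold_Y_def conifold_Z_def conifold_x_def conifold_y_def conifold_z_def
      conifold_scal_def free_z_def conifold.cl_power conifold.cl_mult conifold.cl_add)

lemma conifold_C_central: "conifold_C \<subseteq> ring_center conifold"
  unfolding conifold_C_def conifold_generators
  by (rule conifold.generate_ring_central) (auto simp: conifold_generators conifold.central_generators)

lemma subring_conifold_C: "subring conifold_C conifold"
  unfolding conifold_C_def
  by (rule conifold.generate_ring_is_subring) (auto simp: conifold_generators)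

lemma conifold_C_module: "Module.module (conifold\<lparr>carrier := conifold_C\<rparr>) (regular_module conifold)"
proof -
  have sub: "conifold_C \<subseteq> carrier conifold"
    using subring_conifold_C by (rule subringE)
  interpret M: left_module conifold "regular_module conifold"
    by (rule left_module_regular) (rule conifold.ring_axioms)
  have "cring (conifold\<lparr>carrier := conifold_C\<rparr>)"
    using subring_conifold_C conifold_C_central
    by (intro conifold.subcring_iff[OF sub, THEN iffD1] conifold.subcringI)
      (auto simp: ring_center_def)
  then show ?thesis
    using sub M.M.abelian_group_axioms
    by (intro Module.moduleI)
      (auto simp: regular_module_def subset_iff conifold.l_distr conifold.r_distr conifold.m_assoc)
qed

section \<open>Polynomials in x, y, z acting on normal forms\<close>

definition central_poly :: "(nat \<times> nat \<times> nat \<Rightarrow>\<^sub>0 complex) \<Rightarrow> free_alg" where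
  "central_poly p = (\<Sum>m\<in>Poly_Mapping.keys p. case m of (i, j, k) \<Rightarrow>
     Poly_Mapping.single 0 (Poly_Mapping.lookup p m) * ((free_X ^ 2) ^ i * (free_Y ^ 2) ^ j * free_z ^ k))"

lemma central_poly_add: "central_poly (p + q) = central_poly p + central_poly q"
  unfolding central_poly_def
  by (rule sum_keys_add[where g = "\<lambda>m c. case m of (i, j, k) \<Rightarrow>
     Poly_Mapping.single 0 c * ((free_X ^ 2) ^ i * (free_Y ^ 2) ^ j * free_z ^ k)"])
    (auto simp: additive_def single_add distrib_right)

lemma central_poly_single: "central_poly (Poly_Mapping.single (i, j, k) c) =
    Poly_Mapping.single 0 c * ((free_X ^ 2) ^ i * (free_Y ^ 2) ^ j * free_z ^ k)"
  by (simp add: central_poly_def)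

lemma poly3_eval_conifold:
  "poly3_eval conifold conifold_scal conifold_x conifold_y conifold_z p = conifold_class (central_poly p)"
  unfolding poly3_eval_def central_poly_def conifold_generators
  by (simp add: conifold.cl_finsum[symmetric] split_def flip: conifold.cl_power conifold.cl_mult)

lemma free_op_power: "nf.free_op (p ^ n) f = (nf.free_op p ^^ n) f"
  by (induction n arbitrary: f) (simp_all add: nf.free_op_simps)

text \<open>X^2 and Y^2 commute with X and Y, so x, y and z act as plain shifts of the exponents of
  X, Y and z, by 2, 2 and 1.\<close>

lemma central_monomial_mono3:
  "nf.free_op (central_poly (Poly_Mapping.single (i, j, k) c)) (mono3 u b a l) =
     mono3 (pair_scale c u) (b + 2 * j) (a + 2 * i) (l + k)"
proof -
  have z: "(nf.free_op free_z ^^ n) (mono3 u b a l) = mono3 u b a (l + n)" for n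
    by (induction n) (simp_all add: nf.free_op_z group_alg.zop_induced left_z_mono3)
  have YY: "nf.free_op (free_Y ^ 2) (mono3 u b a l) = mono3 u (b + 2) a l" for a b l u
    unfolding power2_eq_square nf.free_op_mult nf.free_op_Y
    by (rule poly3_eqI) (auto simp: c3_left_Y c3_mono3 split: nat.split)
  have y: "(nf.free_op (free_Y ^ 2) ^^ n) (mono3 u b a l) = mono3 u (b + 2 * n) a l" for n l
    by (induction n) (simp_all add: YY)
  have x: "(nf.free_op (free_X ^ 2) ^^ n) (mono3 u b a l) = mono3 u b (a + 2 * n) l" for n b l
    by (induction n) (simp_all add: power2_eq_square nf.free_op_simps left_X_mono3)
  have "group_alg.sc3 c (mono3 u b a l) = mono3 (pair_scale c u) b a l" for a b l
    by (rule poly3_eqI) (auto simp: c3_lift3 c3_mono3 group_alg.sc_zero)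
  then show ?thesis
    by (simp add: central_poly_single nf.free_op_simps free_op_power z y x)
qed

text \<open>In the free algebra the lifts of x, y and z do not commute, so this is a statement about
  classes; on monomials it is the addition of exponents.\<close>

lemma central_poly_mult:
  "conifold_class (central_poly (p * q)) = conifold_class (central_poly p) \<otimes>\<^bsub>conifold\<^esub> conifold_class (central_poly q)"
proof -
  have single: "nf (central_poly (Poly_Mapping.single m c * Poly_Mapping.single n d)) =
      nf (central_poly (Poly_Mapping.single m c) * central_poly (Poly_Mapping.single n d))" for m n c d
  proof -
    obtain i j k i' j' k' where mn: "m = (i, j, k)" "n = (i', j', k')"
      by (cases m; cases n)
    have "nf (central_poly (Poly_Mapping.single (i, j, k) c)) = mono3 (c, 0) (2 * j) (2 * i) k" for i j k c
      by (simp add: nf_def nf_one_def const3_eq_mono3 central_monomial_mono3)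
    then show ?thesis
      unfolding mn mult_single nf_mult
      by (simp add: central_monomial_mono3 add_mult_distrib2 add.commute)
  qed
  have *: "nf (central_poly (Poly_Mapping.single m c * q)) =
      nf (central_poly (Poly_Mapping.single m c) * central_poly q)" for m c
    by (rule additive_eqI_single[where p = q and f = "\<lambda>q. nf (central_poly (Poly_Mapping.single m c * q))"
          and g = "\<lambda>q. nf (central_poly (Poly_Mapping.single m c) * central_poly q)"])
      (unfold additive_def distrib_left central_poly_add nf_add single, simp_all)
  have "nf (central_poly (p * q)) = nf (central_poly p * central_poly q)"
    by (rule additive_eqI_single[where p = p and f = "\<lambda>p. nf (central_poly (p * q))"
          and g = "\<lambda>p. nf (central_poly p * central_poly q)"])
      (unfold additive_def distrib_right central_poly_add nf_add *, simp_all)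
  then show ?thesis
    by (simp add: conifold.cl_eq_iff_nf flip: conifold.cl_mult)
qed

text \<open>The parities of the exponents of X and Y show from which X^a Y^b a term comes, and their
  halves are its exponents in x and y.\<close>

lemma c3_central_act:
  assumes "a < 2" "b < 2"
  shows "c3 (nf.free_op (central_poly p) (mono3 u b a 0)) K J I =
    (if K mod 2 = b \<and> J mod 2 = a then pair_scale (Poly_Mapping.lookup p (J div 2, K div 2, I)) u else 0)"
proof (rule additive_eqI_single[where p = p and f = "\<lambda>p. c3 (nf.free_op (central_poly p) (mono3 u b a 0)) K J I"
      and g = "\<lambda>p. if K mod 2 = b \<and> J mod 2 = a then pair_scale (Poly_Mapping.lookup p (J div 2, K div 2, I)) u else 0"])
  show "additive (\<lambda>p. c3 (nf.free_op (central_poly p) (mono3 u b a 0)) K J I)"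
    by (simp add: additive_def central_poly_add nf.free_op_add)
  show "additive (\<lambda>p. if K mod 2 = b \<and> J mod 2 = a then pair_scale (Poly_Mapping.lookup p (J div 2, K div 2, I)) u else 0)"
    by (cases "K mod 2 = b \<and> J mod 2 = a") (auto simp: additive_def lookup_add group_alg.sc_add_left)
  fix m :: "nat \<times> nat \<times> nat" and c
  obtain i j k where m: "m = (i, j, k)" by (cases m)
  have div: "(J = a + 2 * i) \<longleftrightarrow> J mod 2 = a \<and> J div 2 = i" if "a < 2" for J a i :: nat
    using that by presburger
  show "c3 (nf.free_op (central_poly (Poly_Mapping.single m c)) (mono3 u b a 0)) K J I =
    (if K mod 2 = b \<and> J mod 2 = a
     then pair_scale (Poly_Mapping.lookup (Poly_Mapping.single m c) (J div 2, K div 2, I)) u else 0)"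
    unfolding m central_monomial_mono3 c3_mono3 div[OF assms(1)] div[OF assms(2)]
    by (auto simp: lookup_single when_def group_alg.sc_zero_left)
qed

lemma conifold_C_eq: "conifold_C = range (\<lambda>p. conifold_class (central_poly p))"
proof (intro equalityI subsetI)
  fix a assume "a \<in> conifold_C"
  then have "a \<in> generate_ring conifold (range conifold_scal \<union> {conifold_x, conifold_y, conifold_z})"
    by (simp add: conifold_C_def)
  then show "a \<in> range (\<lambda>p. conifold_class (central_poly p))"
  proof induction
    case one
    have "\<one>\<^bsub>conifold\<^esub> = conifold_class (central_poly (Poly_Mapping.single (0, 0, 0) 1))"
      by (simp add: central_poly_single conifold.cl_one)
    then show ?case by blast
  next
    case (incl h)
    have "conifold_scal c \<in> range (\<lambda>p. conifold_class (central_poly p))" for c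
      by (rule range_eqI[where x = "Poly_Mapping.single (0, 0, 0) c"])
        (simp add: central_poly_single conifold_generators)
    moreover have "conifold_x \<in> range (\<lambda>p. conifold_class (central_poly p))"
      by (rule range_eqI[where x = "Poly_Mapping.single (1, 0, 0) 1"])
        (simp add: central_poly_single conifold_generators)
    moreover have "conifold_y \<in> range (\<lambda>p. conifold_class (central_poly p))"
      by (rule range_eqI[where x = "Poly_Mapping.single (0, 1, 0) 1"])
        (simp add: central_poly_single conifold_generators)
    moreover have "conifold_z \<in> range (\<lambda>p. conifold_class (central_poly p))"
      by (rule range_eqI[where x = "Poly_Mapping.single (0, 0, 1) 1"])
        (simp add: central_poly_single conifold_generators)
    ultimately show ?case
      using incl by blast
  next
    case (a_inv h)
    then obtain p where "h = conifold_class (central_poly p)" by blast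
    then have "\<ominus>\<^bsub>conifold\<^esub> h = conifold_class (central_poly (- p))"
      using additive.minus[of central_poly p] by (simp add: additive_def central_poly_add conifold.cl_minus)
    then show ?case by blast
  next
    case (eng_add a b)
    then show ?case
      by (auto simp flip: conifold.cl_add central_poly_add)
  next
    case (eng_mult a b)
    then show ?case
      by (auto simp flip: central_poly_mult)
  qed
next
  fix a assume "a \<in> range (\<lambda>p. conifold_class (central_poly p))"
  then obtain p where a: "a = conifold_class (central_poly p)" by blast
  note subr = subringE[OF subring_conifold_C]
  have gens: "conifold_scal c \<in> conifold_C" "conifold_x \<in> conifold_C" "conifold_y \<in> conifold_C"
    "conifold_z \<in> conifold_C" for c
    unfolding conifold_C_def by (auto intro: generate_ring.incl)
  have pow: "b [^]\<^bsub>conifold\<^esub> (n :: nat) \<in> conifold_C" if "b \<in> conifold_C" for b n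
    by (induction n) (simp_all add: subr that)
  have single: "conifold_class (central_poly (Poly_Mapping.single m c)) \<in> conifold_C" for m c
    using gens pow
    by (cases m) (simp add: central_poly_single conifold_generators conifold.cl_mult conifold.cl_power subr)
  have zero: "conifold_class (central_poly 0) \<in> conifold_C"
    using subr(2) by (simp add: central_poly_def conifold.cl_zero)
  have sum: "conifold_class (central_poly (\<Sum>m\<in>A. Poly_Mapping.single m (F m))) \<in> conifold_C"
    if "finite A" for A F
    using that
    by (induction A rule: finite_induct) (simp_all add: single zero central_poly_add conifold.cl_add subr)
  show "a \<in> conifold_C"
    unfolding a by (subst poly_mapping_eq_sum_single) (simp add: sum)
qed

lemma conifold_alg_independent:
  "algebraically_independent3 conifold conifold_scal conifold_x conifold_y conifold_z"
  unfolding algebraically_independent3_def poly3_eval_conifold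
proof (intro allI impI)
  fix p assume "conifold_class (central_poly p) = \<zero>\<^bsub>conifold\<^esub>"
  then have "nf (central_poly p) = 0"
    by (simp add: nf_eq_zero_iff conifold.cl_eq_zero_iff)
  then have zero: "c3 (nf.free_op (central_poly p) (mono3 (1, 0) 0 0 0)) K J I = 0" for K J I
    by (simp add: nf_def nf_one_def const3_eq_mono3)
  show "p = 0"
  proof (rule poly_mapping_eqI)
    fix m :: "nat \<times> nat \<times> nat"
    obtain i j k where m: "m = (i, j, k)" by (cases m)
    show "Poly_Mapping.lookup p m = Poly_Mapping.lookup 0 m"
      using zero[of "2 * j" "2 * i" k] by (simp add: c3_central_act m zero_prod_def)
  qed
qed

text \<open>An entry (a, b, u, v) stands for X^a Y^b (u + v Z).\<close>

definition basis_words :: "(nat \<times> nat \<times> complex \<times> complex) list" where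
  "basis_words = [(0, 0, 1, 0), (1, 0, 1, 0), (0, 1, 1, 0), (0, 0, 0, 1),
     (1, 1, 1, 0), (1, 0, 0, 1), (0, 1, 0, 1), (1, 1, 0, 1)]"

definition basis_list :: "free_alg set list" where
  "basis_list = [\<one>\<^bsub>conifold\<^esub>, conifold_X, conifold_Y, conifold_Z,
        conifold_X \<otimes>\<^bsub>conifold\<^esub> conifold_Y,
        conifold_X \<otimes>\<^bsub>conifold\<^esub> conifold_Z,
        conifold_Y \<otimes>\<^bsub>conifold\<^esub> conifold_Z,
        conifold_X \<otimes>\<^bsub>conifold\<^esub> conifold_Y \<otimes>\<^bsub>conifold\<^esub> conifold_Z]"

definition basis_coord :: "nat \<Rightarrow> (complex \<times> complex) poly3" where
  "basis_coord t = (case basis_words ! t of (a, b, u) \<Rightarrow> mono3 u b a 0)"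

lemma less_8_cases: "t < 8 \<Longrightarrow> t \<in> {0, 1, 2, 3, 4, 5, 6, 7 :: nat}"
  by (simp add: less_Suc_eq eval_nat_numeral)

lemma basis_list_coords:
  assumes "t < 8"
  shows "basis_list ! t \<in> carrier conifold" "conifold.coords (basis_list ! t) = basis_coord t"
proof -
  have Z: "group_alg.Z3 (mono3 (1, 0) 0 0 0) = mono3 (0, 1) 0 0 0"
    by (rule poly3_eqI) (auto simp: c3_flip_XY c3_lift3 c3_mono3 zero_prod_def)
  have Y: "left_Y (mono3 u 0 0 0) = mono3 u 1 0 0" for u :: "complex \<times> complex"
    using left_Y_mono3[of u 0] by simp
  define ws where "ws = [1, free_X, free_Y, free_Z, free_X * free_Y, free_X * free_Z, free_Y * free_Z,
    free_X * free_Y * free_Z]"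
  have list: "basis_list = map conifold_class ws"
    by (simp add: basis_list_def ws_def conifold_generators conifold.cl_mult conifold.cl_one)
  have len: "length ws = 8"
    by (simp add: ws_def)
  have one: "nf 1 = mono3 (1, 0) 0 0 0"
    by (simp add: nf_1 nf_one_def const3_eq_mono3)
  have gens: "nf (free_X * p) = left_X (nf p)" "nf (free_Y * p) = left_Y (nf p)"
    "nf (free_Z * p) = group_alg.Z3 (nf p)" for p
    by (simp_all only: nf_mult nf.free_op_X nf.free_op_Y nf.free_op_Z)
  have "nf (ws ! t) = basis_coord t"
    using less_8_cases[OF assms]
  proof (elim insertE)
    assume "t \<in> {}"
    then show ?thesis by simp
  qed (use gens(1)[of 1] gens(2)[of 1] gens(3)[of 1] in
      \<open>simp_all add: ws_def basis_coord_def basis_words_def one gens Z Y left_X_mono3 mult.assoc\<close>)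
  then show "basis_list ! t \<in> carrier conifold" "conifold.coords (basis_list ! t) = basis_coord t"
    using assms by (simp_all add: list len)
qed

lemma c3_basis_act:
  assumes "t < 8"
  shows "c3 (nf.free_op (central_poly p) (basis_coord t)) K J I = (case basis_words ! t of (a, b, u) \<Rightarrow>
    if K mod 2 = b \<and> J mod 2 = a then pair_scale (Poly_Mapping.lookup p (J div 2, K div 2, I)) u else 0)"
  using less_8_cases[OF assms] by (auto simp: basis_coord_def basis_words_def c3_central_act)

lemma regular_module_simps:
  "carrier (regular_module R) = carrier R" "\<zero>\<^bsub>regular_module R\<^esub> = \<zero>\<^bsub>R\<^esub>"
  "x \<oplus>\<^bsub>regular_module R\<^esub> y = x \<oplus>\<^bsub>R\<^esub> y" "x \<odot>\<^bsub>regular_module R\<^esub> y = x \<otimes>\<^bsub>R\<^esub> y"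
  by (simp_all add: regular_module_def)

lemma coords_combination:
  "conifold.coords (finsum (regular_module conifold)
      (\<lambda>t. conifold_class (central_poly (p t)) \<odot>\<^bsub>regular_module conifold\<^esub> basis_list ! t) {..<8}) =
    (\<Sum>t<8. nf.free_op (central_poly (p t)) (basis_coord t))"
  and combination_closed: "finsum (regular_module conifold)
      (\<lambda>t. conifold_class (central_poly (p t)) \<odot>\<^bsub>regular_module conifold\<^esub> basis_list ! t) {..<8} \<in> carrier conifold"
proof -
  interpret M: left_module conifold "regular_module conifold"
    by (rule left_module_regular) (rule conifold.ring_axioms)
  let ?S = "\<lambda>A. finsum (regular_module conifold)
      (\<lambda>t. conifold_class (central_poly (p t)) \<odot>\<^bsub>regular_module conifold\<^esub> basis_list ! t) A"
  have "?S A \<in> carrier conifold \<and> conifold.coords (?S A) =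
      (\<Sum>t\<in>A. nf.free_op (central_poly (p t)) (basis_coord t))" if "finite A" "A \<subseteq> {..<8}" for A
    using that
  proof (induction A rule: finite_induct)
    case empty
    then show ?case
      by (simp add: regular_module_simps conifold.coords_zero)
  next
    case (insert t A)
    have mem: "conifold_class (central_poly (p t)) \<otimes>\<^bsub>conifold\<^esub> basis_list ! t \<in> carrier conifold"
      if "t < 8" for t
      using basis_list_coords[OF that] by simp
    have "?S (insert t A) = conifold_class (central_poly (p t)) \<otimes>\<^bsub>conifold\<^esub> basis_list ! t \<oplus>\<^bsub>conifold\<^esub> ?S A"
      using insert.hyps insert.prems mem
      by (subst M.M.finsum_insert) (auto simp: regular_module_simps)
    then show ?case
      using insert mem[of t] basis_list_coords[of t]
      by (simp add: conifold.coords_add conifold.coords_mult)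
  qed
  from this[of "{..<8}"] show "conifold.coords (?S {..<8}) =
      (\<Sum>t<8. nf.free_op (central_poly (p t)) (basis_coord t))" "?S {..<8} \<in> carrier conifold"
    by simp_all
qed

lemma sum_8: "(\<Sum>t<8. F t) = F 0 + F 1 + F 2 + F 3 + F 4 + F 5 + F 6 + F (7 :: nat)"
  by (simp add: eval_nat_numeral add.assoc)

lemma combination_add:
  assumes "\<exists>p. f = (\<Sum>t<8. nf.free_op (central_poly (p t)) (basis_coord t))"
    and "\<exists>p. g = (\<Sum>t<8. nf.free_op (central_poly (p t)) (basis_coord t))"
  shows "\<exists>p. f + g = (\<Sum>t<8. nf.free_op (central_poly (p t)) (basis_coord t))"
proof -
  obtain p q where "f = (\<Sum>t<8. nf.free_op (central_poly (p t)) (basis_coord t))"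
    "g = (\<Sum>t<8. nf.free_op (central_poly (q t)) (basis_coord t))"
    using assms by blast
  then have "f + g = (\<Sum>t<8. nf.free_op (central_poly (p t + q t)) (basis_coord t))"
    by (simp add: central_poly_add nf.free_op_add sum.distrib)
  then show ?thesis
    by (rule exI[of _ "\<lambda>t. p t + q t"])
qed

lemma basis_spanning: "\<exists>p. f = (\<Sum>t<8. nf.free_op (central_poly (p t)) (basis_coord t))"
proof (induction f rule: poly3_mono_induct)
  case (1 w k j i)
  let ?P = "\<lambda>f. \<exists>p. f = (\<Sum>t<8. nf.free_op (central_poly (p t)) (basis_coord t))"
  have single: "?P (nf.free_op (central_poly s) (basis_coord t))" if "t < 8" for s t
  proof (rule exI[of _ "\<lambda>t'. if t' = t then s else 0"])
    have "nf.free_op (central_poly (if t' = t then s else 0)) (basis_coord t') =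
        (if t' = t then nf.free_op (central_poly s) (basis_coord t) else 0)" for t'
      by (simp add: central_poly_def nf.free_op_zero)
    then show "nf.free_op (central_poly s) (basis_coord t) =
        (\<Sum>t'<8. nf.free_op (central_poly (if t' = t then s else 0)) (basis_coord t'))"
      using that by simp
  qed
  have "\<exists>t<8. basis_words ! t = (a, b, 1, 0)" "\<exists>t<8. basis_words ! t = (a, b, 0, 1)"
    if "a < 2" "b < 2" for a b :: nat
  proof -
    have "a = 0 \<or> a = 1" "b = 0 \<or> b = 1"
      using that by auto
    moreover have "basis_words ! 0 = (0, 0, 1, 0)" "basis_words ! 1 = (1, 0, 1, 0)"
      "basis_words ! 2 = (0, 1, 1, 0)" "basis_words ! 3 = (0, 0, 0, 1)" "basis_words ! 4 = (1, 1, 1, 0)"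
      "basis_words ! 5 = (1, 0, 0, 1)" "basis_words ! 6 = (0, 1, 0, 1)" "basis_words ! 7 = (1, 1, 0, 1)"
      by (simp_all add: basis_words_def)
    moreover have "0 < (8::nat)" "1 < (8::nat)" "2 < (8::nat)" "3 < (8::nat)" "4 < (8::nat)" "5 < (8::nat)"
      "6 < (8::nat)" "7 < (8::nat)"
      by simp_all
    ultimately show "\<exists>t<8. basis_words ! t = (a, b, 1, 0)" "\<exists>t<8. basis_words ! t = (a, b, 0, 1)"
      by metis+
  qed
  \<comment> \<open>The parities of j and k select X^a Y^b; the two basis elements with these
    exponents differ by the factor Z, and each takes one component of w.\<close>
  from this[of "j mod 2" "k mod 2"] obtain t t' where t: "t < 8" "basis_words ! t = (j mod 2, k mod 2, 1, 0)"
    and t': "t' < 8" "basis_words ! t' = (j mod 2, k mod 2, 0, 1)"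
    by auto
  let ?s = "Poly_Mapping.single (j div 2, k div 2, i)"
  have div: "n mod 2 + 2 * (n div 2) = n" for n :: nat
    by (rule mod_mult_div_eq)
  have "mono3 w k j i = mono3 (fst w, 0) k j i + mono3 (0, snd w) k j i"
    by (rule poly3_eqI) (cases w, simp add: c3_mono3)
  also have "\<dots> = nf.free_op (central_poly (?s (fst w))) (basis_coord t) +
      nf.free_op (central_poly (?s (snd w))) (basis_coord t')"
    by (simp add: basis_coord_def t t' central_monomial_mono3 div)
  finally show ?case
    using combination_add[OF single[OF t(1)] single[OF t'(1)]] by simp
next
  case (2 f g)
  then show ?case by (rule combination_add)
qed

lemma basis_unique:
  assumes "(\<Sum>t<8. nf.free_op (central_poly (p t)) (basis_coord t)) =
    (\<Sum>t<8. nf.free_op (central_poly (q t)) (basis_coord t))" and t: "t < 8"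
  shows "p t = q t"
proof (rule poly_mapping_eqI)
  fix m :: "nat \<times> nat \<times> nat"
  obtain i j k where m: "m = (i, j, k)" by (cases m)
  have eq: "c3 (\<Sum>t<8. nf.free_op (central_poly (p t)) (basis_coord t)) K J I =
      c3 (\<Sum>t<8. nf.free_op (central_poly (q t)) (basis_coord t)) K J I" for K J I
    using assms(1) by simp
  have "(2 * j + 1) div 2 = j" for j :: nat by simp
  \<comment> \<open>Coefficients are compared at exponents with the parities of the t-th basis
    element. Only this element and its partner with the other power of Z contribute there, in
    different components.\<close>
  then show "Poly_Mapping.lookup (p t) m = Poly_Mapping.lookup (q t) m"
    using less_8_cases[OF t] eq[of "2 * j + fst (snd (basis_words ! t))" "2 * i + fst (basis_words ! t)" k]
    unfolding c3_sum sum_8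
    by (auto simp: c3_basis_act basis_words_def m zero_prod_def)
qed

lemma conifold_basis: "module_basis (conifold\<lparr>carrier := conifold_C\<rparr>) (regular_module conifold) basis_list"
proof -
  let ?M = "regular_module conifold"
  let ?S = "\<lambda>c. finsum ?M (\<lambda>i. c i \<odot>\<^bsub>?M\<^esub> basis_list ! i) {..<8}"
  interpret M: left_module conifold ?M
    by (rule left_module_regular) (rule conifold.ring_axioms)
  have len: "length basis_list = 8"
    by (simp add: basis_list_def)
  have mem: "set basis_list \<subseteq> carrier ?M"
    using basis_list_coords(1) by (auto simp: in_set_conv_nth len regular_module_simps)
  have cong: "?S c = ?S (\<lambda>t. conifold_class (central_poly (p t)))"
    if "\<And>t. t < 8 \<Longrightarrow> c t = conifold_class (central_poly (p t))" for c p
  proof (rule M.M.finsum_cong'[OF refl])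
    show "(\<lambda>t. conifold_class (central_poly (p t)) \<odot>\<^bsub>?M\<^esub> basis_list ! t) \<in> {..<8} \<rightarrow> carrier ?M"
      using basis_list_coords(1) by (simp add: regular_module_simps)
  qed (simp add: that)
  have ex1: "\<exists>!c. c \<in> {..<8} \<rightarrow>\<^sub>E conifold_C \<and> m = ?S c" if m: "m \<in> carrier conifold" for m
  proof -
    obtain p where p: "conifold.coords m = (\<Sum>t<8. nf.free_op (central_poly (p t)) (basis_coord t))"
      using basis_spanning by blast
    let ?c = "\<lambda>t\<in>{..<8}. conifold_class (central_poly (p t))"
    have "?S ?c = ?S (\<lambda>t. conifold_class (central_poly (p t)))"
      by (rule cong) simp
    also have "\<dots> = m"
      using conifold.coords_eq_iff[OF combination_closed m, of p] unfolding coords_combination p by simp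
    finally have sum: "m = ?S ?c" ..
    show ?thesis
    proof (rule ex1I[of _ ?c])
      show "?c \<in> {..<8} \<rightarrow>\<^sub>E conifold_C \<and> m = ?S ?c"
      proof (rule conjI[OF _ sum])
        show "?c \<in> {..<8} \<rightarrow>\<^sub>E conifold_C"
          unfolding conifold_C_eq by auto
      qed
      fix c assume "c \<in> {..<8} \<rightarrow>\<^sub>E conifold_C \<and> m = ?S c"
      then have c: "c \<in> {..<8} \<rightarrow>\<^sub>E conifold_C" "m = ?S c"
        by blast+
      define q where "q t = (SOME q. c t = conifold_class (central_poly q))" for t
      have ex: "\<exists>q. c t = conifold_class (central_poly q)" if "t < 8" for t
      proof -
        have "c t \<in> conifold_C"
          using PiE_mem[OF c(1), of t] that by simp
        then show ?thesis
          unfolding conifold_C_eq by blast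
      qed
      have q: "c t = conifold_class (central_poly (q t))" if "t < 8" for t
        using someI_ex[OF ex[OF that]] by (simp only: q_def)
      have "m = ?S (\<lambda>t. conifold_class (central_poly (q t)))"
        by (rule trans[OF c(2) cong]) (rule q)
      then have "conifold.coords m = (\<Sum>t<8. nf.free_op (central_poly (q t)) (basis_coord t))"
        by (rule ssubst) (rule coords_combination)
      with p have "(\<Sum>t<8. nf.free_op (central_poly (p t)) (basis_coord t)) =
          (\<Sum>t<8. nf.free_op (central_poly (q t)) (basis_coord t))"
        by (rule trans[OF sym])
      then have pq: "p t = q t" if "t < 8" for t
        using basis_unique that by blast
      show "c = ?c"
      proof
        fix t
        show "c t = ?c t"
        proof (cases "t < 8")
          case True
          then show ?thesis using q[OF True] pq[OF True] by simp
        next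
          case False
          then show ?thesis using PiE_arb[OF c(1), of t] by simp
        qed
      qed
    qed
  qed
  show ?thesis
    unfolding module_basis_def len
  proof (intro conjI ballI mem)
    fix m assume "m \<in> carrier ?M"
    then show "\<exists>!c. c \<in> {..<8} \<rightarrow>\<^sub>E carrier (conifold\<lparr>carrier := conifold_C\<rparr>) \<and> m = ?S c"
      using ex1[of m] by (simp add: regular_module_simps(1))
  qed
qed

section \<open>The skew group algebra\<close>

lemma alternate_add: "alternate (p + q) = alternate p + alternate q"
  by (rule additive.add[OF additive_alternate])

lemma alternate_smult: "alternate (smult a q) = smult a (alternate (q :: 'a::comm_ring_1 poly))"
  by (rule poly_eqI) (simp add: coeff_alternate)

lemma alternate_mult: "alternate (p * q) = alternate p * alternate (q :: 'a::comm_ring_1 poly)"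
proof (induction p)
  case (pCons a p)
  then show ?case
    by (simp add: alternate_add alternate_smult alternate_pCons)
qed simp

lemma alternate_alternate: "alternate (alternate p) = p"
  by (rule poly_eqI) (simp add: coeff_alternate)

lemma alternate_1: "alternate 1 = (1 :: 'a::comm_ring_1 poly)"
  by (simp add: one_pCons alternate_pCons)

abbreviation delta :: "complex poly poly \<Rightarrow> complex poly poly" where
  "delta \<equiv> odd_shift twice_z"

lemma delta_add: "delta (p + q) = delta p + delta q"
  by (rule additive.add[OF additive_odd_shift[OF additive_twice_z]])

lemma twice_z_smult: "twice_z (a * b) = a * twice_z (b :: complex poly)"
  by (simp add: twice_z_def distrib_left)

lemma delta_smult: "delta (smult a q) = smult a (delta q)"
  by (rule poly_eqI) (simp add: coeff_odd_shift twice_z_smult)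

lemma map_poly_twice_z_eq: "map_poly twice_z p = smult [:0, 2:] (p :: complex poly poly)"
proof -
  have "c + c = smult 2 c" for c :: "complex poly"
    using smult_add_left[of 1 1 c] by simp
  then show ?thesis
    by (intro poly_eqI[where p = "map_poly twice_z p"]) (simp add: coeff_map_poly twice_z_def)
qed

lemma delta_pCons: "delta (pCons a p) = smult [:0, 2:] p - pCons 0 (delta p)"
  by (simp add: odd_shift_pCons additive_twice_z map_poly_twice_z_eq)

text \<open>Since \<open>delta\<close> is linear over the polynomials in z, induction on the degree
  in X reduces this to one factor X, which is \<open>delta_pCons\<close>.\<close>

lemma delta_mult: "delta (p * q) = alternate p * delta q + delta p * q"
proof (induction p)
  case (pCons a p)
  have "delta (pCons a p * q) = smult a (delta q) + (smult [:0, 2:] (p * q) - pCons 0 (delta (p * q)))"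
    by (simp add: delta_add delta_smult delta_pCons)
  also have "\<dots> = alternate (pCons a p) * delta q + delta (pCons a p) * q"
    by (simp add: pCons.IH alternate_pCons delta_pCons algebra_simps)
  finally show ?case .
qed simp

section \<open>The product of the Ore extension\<close>

definition ore_mult :: "complex poly3 \<Rightarrow> complex poly3 \<Rightarrow> complex poly3" where
  "ore_mult p q = (\<Sum>i\<le>degree p. smult (coeff p i) ((left_Y ^^ i) q))"

lemma ore_mult_bound:
  assumes "degree p \<le> n"
  shows "ore_mult p q = (\<Sum>i\<le>n. smult (coeff p i) ((left_Y ^^ i) q))"
  unfolding ore_mult_def using assms
  by (intro sum.mono_neutral_left) (auto simp: coeff_eq_0)

text \<open>(a + p Y) q = a q + p (Y q). The recursion changes q, hence q is kept arbitrary in the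
  inductions on p.\<close>

lemma ore_mult_pCons: "ore_mult (pCons a p) q = smult a q + ore_mult p (left_Y q)"
proof -
  have "ore_mult (pCons a p) q = (\<Sum>i\<le>Suc (degree p). smult (coeff (pCons a p) i) ((left_Y ^^ i) q))"
    by (rule ore_mult_bound) (simp add: degree_pCons_le)
  also have "\<dots> = smult a q + (\<Sum>i\<le>degree p. smult (coeff p i) ((left_Y ^^ Suc i) q))"
    by (subst sum.atMost_Suc_shift) simp
  finally show ?thesis
    by (simp add: ore_mult_def funpow_Suc_right del: funpow.simps)
qed

lemma ore_mult_0 [simp]: "ore_mult 0 q = 0"
  by (simp add: ore_mult_def)

lemma ore_mult_add_left: "ore_mult (p + p') q = ore_mult p q + ore_mult p' q"
  by (induction p p' arbitrary: q rule: poly_induct2) (simp_all add: ore_mult_pCons smult_add_left)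

lemma ore_mult_smult: "ore_mult (smult b p) q = smult b (ore_mult p q)"
  by (induction p arbitrary: q) (simp_all add: ore_mult_pCons smult_add_right)

lemma ore_mult_minus_left: "ore_mult (- p) q = - ore_mult p q"
  using ore_mult_add_left[of "- p" p q] by (simp add: eq_neg_iff_add_eq_0)

lemma ore_mult_minus_right: "ore_mult p (- q) = - ore_mult p q"
  by (induction p arbitrary: q) (simp_all add: ore_mult_pCons left_Y_minus)

lemma left_Y_smult: "left_Y (smult b q) = smult (alternate b) (left_Y q) + smult (delta b) q"
proof (rule poly_eqI)
  fix n
  show "coeff (left_Y (smult b q)) n = coeff (smult (alternate b) (left_Y q) + smult (delta b) q) n"
    by (cases n) (simp_all add: left_Y_def coeff_map_poly alternate_mult delta_mult algebra_simps)
qed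

lemma left_X_eq_smult: "left_X q = smult [:0, 1:] (q :: complex poly3)"
  by (rule poly_eqI) (simp add: left_X_def coeff_map_poly)

lemma sc3_eq_smult: "trivial.sc3 c q = smult [:[:c:]:] q"
  by (intro poly_eqI) (simp add: lift3_def coeff_map_poly)

lemma left_Y_pCons_0: "left_Y (pCons 0 q) = pCons 0 (left_Y (q :: complex poly3))"
  using right_Y_left_Y[of q] by (simp add: right_Y_def)

text \<open>(Y p) q = Y (p q). Together with \<open>ore_mult_smult\<close> for the coefficients this
  is the associativity that makes right multiplication by q linear.\<close>

lemma ore_mult_left_Y: "ore_mult (left_Y p) q = left_Y (ore_mult p q)"
proof (induction p arbitrary: q)
  case 0
  have "left_Y (0 :: complex poly3) = 0"
    by (simp add: left_Y_def)
  then show ?case by simp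
next
  case (pCons a p)
  have a: "left_Y [:a:] = [:delta a, alternate a:]"
    by (simp add: left_Y_def map_poly_pCons)
  have "left_Y (pCons a p) = left_Y ([:a:] + pCons 0 p)"
    by simp
  also have "\<dots> = [:delta a, alternate a:] + pCons 0 (left_Y p)"
    unfolding left_Y_add a left_Y_pCons_0 ..
  finally have "ore_mult (left_Y (pCons a p)) q =
      (smult (delta a) q + smult (alternate a) (left_Y q)) + left_Y (ore_mult p (left_Y q))"
    by (simp add: ore_mult_add_left ore_mult_pCons pCons.IH)
  also have "\<dots> = left_Y (ore_mult (pCons a p) q)"
    by (simp add: ore_mult_pCons left_Y_add left_Y_smult)
  finally show ?case .
qed

lemma flip_XY_smult: "flip_XY (smult b q) = smult (alternate b) (flip_XY (q :: complex poly3))"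
  by (rule poly_eqI) (simp add: flip_XY_def coeff_alternate coeff_map_poly alternate_mult)

lemma flip_XY_pCons: "flip_XY (pCons a p) = pCons (alternate a) (- flip_XY (p :: complex poly3))"
  by (simp add: flip_XY_def map_poly_pCons alternate_pCons)

lemma flip_XY_zero [simp]: "flip_XY 0 = (0 :: complex poly3)"
  by (simp add: flip_XY_def)

lemma ore_mult_flip: "ore_mult (flip_XY p) (flip_XY q) = flip_XY (ore_mult p q)"
proof (induction p arbitrary: q)
  case (pCons a p)
  have "ore_mult (flip_XY (pCons a p)) (flip_XY q) =
      smult (alternate a) (flip_XY q) + ore_mult (flip_XY p) (flip_XY (left_Y q))"
    by (simp add: flip_XY_pCons ore_mult_pCons flip_left_Y ore_mult_minus_left ore_mult_minus_right)
  then show ?case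
    by (simp add: pCons.IH ore_mult_pCons flip_XY_add flip_XY_smult)
qed simp

lemma ore_mult_1: "ore_mult 1 q = q"
  unfolding one_pCons[where 'a = "complex poly poly"] ore_mult_pCons by simp

type_synonym pair3 = "complex poly3 \<times> complex poly3"

text \<open>The pair (f, g) is f + g Z, and Z moves past f by turning it into
  \<open>flip_XY f\<close>; \<open>pair_mult\<close> follows the same rule.\<close>

definition pair_Z :: "pair3 \<Rightarrow> pair3" where
  "pair_Z f = (flip_XY (snd f), flip_XY (fst f))"

definition pair_mult :: "pair3 \<Rightarrow> pair3 \<Rightarrow> pair3" where
  "pair_mult f g = (ore_mult (fst f) (fst g) + ore_mult (snd f) (flip_XY (snd g)),
     ore_mult (fst f) (snd g) + ore_mult (snd f) (flip_XY (fst g)))"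

definition pair_sc :: "complex \<Rightarrow> pair3 \<Rightarrow> pair3" where
  "pair_sc c = map_prod (smult [:[:c:]:]) (smult [:[:c:]:])"

lemma smult_const_const: "smult [:[:c:]:] (left_X f) = left_X (smult [:[:c:]:] f)"
  "smult [:[:c:]:] (left_Y f) = left_Y (smult [:[:c:]:] f)"
  "smult [:[:c:]:] (flip_XY f) = flip_XY (smult [:[:c:]:] f)" for f :: "complex poly3"
proof -
  have "alternate [:[:c:]:] = [:[:c:]:]" "delta [:[:c:]:] = 0"
    by (simp_all add: alternate_pCons delta_pCons)
  then show "smult [:[:c:]:] (left_Y f) = left_Y (smult [:[:c:]:] f)"
    "smult [:[:c:]:] (flip_XY f) = flip_XY (smult [:[:c:]:] f)"
    "smult [:[:c:]:] (left_X f) = left_X (smult [:[:c:]:] f)"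
    by (simp_all add: left_Y_smult flip_XY_smult left_X_eq_smult mult.commute)
qed

interpretation pair: conifold_module pair_sc pair_Z "map_prod left_X left_X" "map_prod left_Y left_Y"
proof (unfold_locales, goal_cases)
  case (2 a b w)
  have "[:[:a + b:]:] = [:[:a:]:] + [:[:b:]:]" by simp
  then show ?case
    by (cases w) (simp only: pair_sc_def map_prod_simp smult_add_left add_Pair)
next
  case (3 a b w)
  then show ?case
    by (cases w) (simp add: pair_sc_def)
next
  case (4 w)
  then show ?case
    by (cases w) (simp add: pair_sc_def flip: one_pCons)
qed (auto simp: pair_sc_def pair_Z_def smult_add_right flip_XY_add smult_const_const flip_flip left_X_add
    left_Y_add flip_left_X flip_left_Y left_XXY left_YYX)

definition split_pair :: "(complex \<times> complex) poly3 \<Rightarrow> pair3" where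
  "split_pair f = (lift3 fst f, lift3 snd f)"

lemma additive_fst_snd: "additive (fst :: complex \<times> complex \<Rightarrow> complex)"
    "additive (snd :: complex \<times> complex \<Rightarrow> complex)"
  by (simp_all add: additive_def)

lemma split_pair_hom: "conifold_hom group_alg.sc3 group_alg.Z3 left_X left_Y
    pair_sc pair_Z (map_prod left_X left_X) (map_prod left_Y left_Y) split_pair"
proof -
  have "lift3 fst (group_alg.sc3 c f) = trivial.sc3 c (lift3 fst f)"
    "lift3 snd (group_alg.sc3 c f) = trivial.sc3 c (lift3 snd f)"
    "lift3 fst (lift3 prod.swap f) = lift3 snd f" "lift3 snd (lift3 prod.swap f) = lift3 fst f" for c f
    by (rule poly3_eqI; simp add: c3_lift3 pair_scale_def group_alg.sc_zero group_alg.Z_zero zero_prod_def)+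
  note simps = this
  show ?thesis
    by unfold_locales
      (simp_all add: split_pair_def pair_sc_def pair_Z_def simps sc3_eq_smult lift3_ops[OF additive_fst_snd(1)]
        lift3_ops[OF additive_fst_snd(2)])
qed

lemma bij_split_pair: "bij split_pair"
proof (rule o_bij)
  let ?join = "\<lambda>(f, g). lift3 (\<lambda>c. (c, 0)) f + lift3 (\<lambda>c. (0, c)) g"
  have add: "additive (\<lambda>c::complex. (c, 0 :: complex))" "additive (\<lambda>c::complex. (0 :: complex, c))"
    by (simp_all add: additive_def)
  show "?join \<circ> split_pair = id"
  proof
    fix f
    show "(?join \<circ> split_pair) f = id f"
      by (rule poly3_eqI) (simp add: split_pair_def c3_lift3 zero_prod_def)
  qed
  show "split_pair \<circ> ?join = id"
  proof
    fix p
    show "(split_pair \<circ> ?join) p = id p"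
      by (cases p) (auto simp: split_pair_def zero_prod_def c3_lift3 intro!: poly3_eqI)
  qed
qed

lemma pair_mult_hom: "conifold_hom pair_sc pair_Z (map_prod left_X left_X) (map_prod left_Y left_Y)
    pair_sc pair_Z (map_prod left_X left_X) (map_prod left_Y left_Y) (\<lambda>f. pair_mult f g)"
proof -
  have flip: "ore_mult (flip_XY p) q = flip_XY (ore_mult p (flip_XY q))" for p q
    using ore_mult_flip[of p "flip_XY q"] by (simp add: flip_flip)
  show ?thesis
    by unfold_locales
      (auto simp: pair_mult_def pair_sc_def pair_Z_def ore_mult_add_left ore_mult_smult left_X_eq_smult
        smult_add_right ore_mult_left_Y left_Y_add flip flip_flip flip_XY_add add_ac)
qed

text \<open>Right multiplication by g is linear over the algebra and sends 1 to g, hence it sends p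
  1, which is \<open>nf p\<close>, to p g.\<close>

lemma split_pair_act:
  "split_pair (nf.free_op p g) = pair_mult (split_pair (nf p)) (split_pair g)"
proof -
  interpret s: conifold_hom group_alg.sc3 group_alg.Z3 left_X left_Y
    pair_sc pair_Z "map_prod left_X left_X" "map_prod left_Y left_Y" split_pair
    by (rule split_pair_hom)
  interpret m: conifold_hom pair_sc pair_Z "map_prod left_X left_X" "map_prod left_Y left_Y"
    pair_sc pair_Z "map_prod left_X left_X" "map_prod left_Y left_Y" "\<lambda>f. pair_mult f (split_pair g)"
    by (rule pair_mult_hom)
  have "split_pair nf_one = (1, 0)"
    by (simp add: split_pair_def nf_one_def lift3_const[OF additive_fst_snd(1)] lift3_const[OF additive_fst_snd(2)])
      (simp add: const3_def one_pCons)
  then show ?thesis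
    by (simp add: nf_def s.hom_free_op m.hom_free_op) (simp add: pair_mult_def ore_mult_1)
qed

subsection \<open>The Ore extension\<close>

lemma zX_simps [simp]:
  "carrier (ring_of_type_algebra :: 'a::comm_ring_1 ring) = UNIV"
  "x \<oplus>\<^bsub>ring_of_type_algebra\<^esub> y = x + y" "x \<otimes>\<^bsub>ring_of_type_algebra\<^esub> y = x * y"
  "\<zero>\<^bsub>ring_of_type_algebra :: 'a ring\<^esub> = 0" "\<one>\<^bsub>ring_of_type_algebra :: 'a ring\<^esub> = 1"
  for x y :: "'a::comm_ring_1"
  by (simp_all add: ring_of_type_algebra_def)

lemma finsum_ring_of_type_algebra:
  fixes f :: "'i \<Rightarrow> 'a::comm_ring_1"
  shows "finite A \<Longrightarrow> finsum ring_of_type_algebra f A = sum f A"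
proof (induction A rule: finite_induct)
  interpret cring "ring_of_type_algebra :: 'a ring" by (rule cring_from_type_algebra)
  case empty
  show ?case using finsum_empty[of f] by simp
next
  interpret cring "ring_of_type_algebra :: 'a ring" by (rule cring_from_type_algebra)
  case (insert k A)
  then show ?case using finsum_insert[of A k f] by simp
qed

abbreviation ore :: "(complex poly poly, nat \<Rightarrow> complex poly poly) up_ring" where
  "ore \<equiv> ore_extension poly_zX alternate delta"

text \<open>The elements of \<open>UP\<close> are functions of bounded support. Identifying them
  with coefficient functions makes the calculus of the type \<open>poly\<close> available.\<close>

lemma up_zX: "up (ring_of_type_algebra :: complex poly poly ring) = range coeff"
proof (intro equalityI subsetI)
  fix f :: "nat \<Rightarrow> complex poly poly" assume "f \<in> up ring_of_type_algebra"
  then obtain n where "bound 0 n f"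
    by (auto simp: up_def)
  then have "coeff (Abs_poly f) = f"
    by (intro coeff_Abs_poly) (auto simp: bound_def)
  then show "f \<in> range coeff"
    by (metis rangeI)
next
  fix f :: "nat \<Rightarrow> complex poly poly" assume "f \<in> range coeff"
  then obtain p where "f = coeff p" by blast
  then have "bound 0 (degree p) f"
    by (auto simp: bound_def coeff_eq_0)
  then show "f \<in> up ring_of_type_algebra"
    by (auto simp: up_def)
qed

lemma ore_left_mult_Y_coeff: "(ore_left_mult_Y poly_zX alternate delta ^^ i) (coeff q) = coeff ((left_Y ^^ i) q)"
proof (induction i)
  case (Suc i)
  have "ore_left_mult_Y poly_zX alternate delta (coeff q) = coeff (left_Y q)" for q
    by (auto simp: ore_left_mult_Y_def left_Y_def coeff_map_poly coeff_pCons fun_eq_iff split: nat.split)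
  then show ?case
    by (simp add: Suc)
qed simp

lemma ore_simps:
  "carrier ore = range coeff" "coeff p \<oplus>\<^bsub>ore\<^esub> coeff q = coeff (p + q)"
  "\<zero>\<^bsub>ore\<^esub> = coeff 0" "\<one>\<^bsub>ore\<^esub> = coeff 1" "coeff p \<otimes>\<^bsub>ore\<^esub> coeff q = coeff (ore_mult p q)"
proof -
  show "carrier ore = range coeff" "coeff p \<oplus>\<^bsub>ore\<^esub> coeff q = coeff (p + q)"
    "\<zero>\<^bsub>ore\<^esub> = coeff 0" "\<one>\<^bsub>ore\<^esub> = coeff 1"
    by (auto simp: ore_extension_def UP_def up_zX fun_eq_iff one_pCons coeff_pCons split: nat.split)
  have "finsum poly_zX (\<lambda>i. coeff p i \<otimes>\<^bsub>poly_zX\<^esub> coeff ((left_Y ^^ i) q) n) {i. coeff p i \<noteq> 0} = coeff (ore_mult p q) n" for n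
  proof -
    have fin: "finite {i. coeff p i \<noteq> 0}"
      by (rule finite_subset[of _ "{..degree p}"]) (auto intro: le_degree)
    have "(\<Sum>i | coeff p i \<noteq> 0. coeff p i * coeff ((left_Y ^^ i) q) n) =
        (\<Sum>i\<le>degree p. coeff p i * coeff ((left_Y ^^ i) q) n)"
      by (rule sum.mono_neutral_left) (auto intro: le_degree)
    then show ?thesis
      by (simp add: finsum_ring_of_type_algebra fin ore_mult_def coeff_sum)
  qed
  moreover have "coeff p \<in> up poly_zX" "coeff q \<in> up poly_zX"
    unfolding up_zX by (rule rangeI)+
  ultimately show "coeff p \<otimes>\<^bsub>ore\<^esub> coeff q = coeff (ore_mult p q)"
    by (intro ext) (simp add: ore_extension_def ore_left_mult_Y_coeff)
qed

lemma abelian_group_ore: "abelian_group ore"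
proof (rule abelian_groupI)
  fix x assume "x \<in> carrier ore"
  then obtain p where "x = coeff p" by (auto simp: ore_simps)
  then show "\<exists>y\<in>carrier ore. y \<oplus>\<^bsub>ore\<^esub> x = \<zero>\<^bsub>ore\<^esub>"
    by (intro bexI[of _ "coeff (- p)"]) (simp_all only: ore_simps rangeI left_minus)
qed (auto simp: ore_simps(1-3) add_ac)

lemma ore_const_eq: "ore_const poly_zX b = coeff [:b:]"
  by (auto simp: ore_const_def UP_def fun_eq_iff coeff_pCons split: nat.split)

lemma ore_Y_eq: "ore_Y poly_zX = coeff [:0, 1:]"
  by (auto simp: ore_Y_def UP_def fun_eq_iff coeff_pCons split: nat.split)

section \<open>The action of the group of order two and the isomorphism\<close>

abbreviation (input) Z2 :: "int monoid" where
  "Z2 \<equiv> integer_mod_group 2"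

lemma carrier_Z2: "carrier Z2 = {0, 1}"
  by (auto simp: carrier_integer_mod_group)

text \<open>Restricted to \<open>range coeff\<close>, the carrier of the Ore extension, since
  \<open>BijGroup\<close> consists of extensional maps.\<close>

definition sign_action :: "int \<Rightarrow> (nat \<Rightarrow> complex poly poly) \<Rightarrow> nat \<Rightarrow> complex poly poly" where
  "sign_action g = (\<lambda>f\<in>range coeff. if g = 0 then f else coeff (flip_XY (Abs_poly f)))"

lemma sign_action_coeff: "sign_action g (coeff p) = coeff (if g = 0 then p else flip_XY p)"
  by (simp add: sign_action_def coeff_inverse)

lemma sign_action_iso: "sign_action g \<in> algebra_iso ore (\<lambda>c. ore_const poly_zX (zX_scal c)) ore (\<lambda>c. ore_const poly_zX (zX_scal c))"
proof -
  have "sign_action g \<in> ring_hom ore ore"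
    by (rule ring_hom_memI)
      (auto simp: ore_simps sign_action_coeff ore_mult_flip flip_XY_add one_pCons flip_XY_pCons alternate_pCons)
  moreover have "bij_betw (sign_action g) (carrier ore) (carrier ore)"
    by (rule bij_betw_byWitness[where f' = "sign_action g"])
      (auto simp: ore_simps(1) sign_action_coeff flip_flip)
  moreover have "sign_action g (ore_const poly_zX (zX_scal c)) = ore_const poly_zX (zX_scal c)" for c
    by (simp add: ore_const_eq sign_action_coeff flip_XY_pCons zX_scal_def alternate_pCons)
  ultimately show ?thesis
    by (simp add: algebra_iso_def ring_iso_def)
qed

lemma sign_algebra_action: "algebra_action Z2 ore (\<lambda>c. ore_const poly_zX (zX_scal c)) sign_action"
proof -
  have bij: "sign_action g \<in> Bij (carrier ore)" for g
    using sign_action_iso[of g]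
    by (auto simp: algebra_iso_def ring_iso_def Bij_def) (simp add: sign_action_def ore_simps(1))
  have "sign_action \<in> hom Z2 (BijGroup (carrier ore))"
  proof (rule homI)
    show "sign_action x \<in> carrier (BijGroup (carrier ore))" for x
      by (simp add: BijGroup_def bij)
    fix x y assume xy: "x \<in> carrier Z2" "y \<in> carrier Z2"
    have "sign_action (x \<otimes>\<^bsub>Z2\<^esub> y) = compose (carrier ore) (sign_action x) (sign_action y)"
    proof
      fix f
      show "sign_action (x \<otimes>\<^bsub>Z2\<^esub> y) f = compose (carrier ore) (sign_action x) (sign_action y) f"
      proof (cases "f \<in> range coeff")
        case True
        then obtain p where "f = coeff p" by blast
        then show ?thesis
          using xy by (auto simp: carrier_Z2 compose_def ore_simps(1) sign_action_coeff flip_flip)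
      next
        case False
        then show ?thesis
          by (simp add: sign_action_def compose_def ore_simps(1))
      qed
    qed
    then show "sign_action (x \<otimes>\<^bsub>Z2\<^esub> y) = sign_action x \<otimes>\<^bsub>BijGroup (carrier ore)\<^esub> sign_action y"
      by (simp add: BijGroup_def bij)
  qed
  then show ?thesis
    unfolding algebra_action_def group_action_def
    by (simp add: group_hom_def group_hom_axioms_def group_BijGroup sign_action_iso)
qed

abbreviation skew :: "(int \<Rightarrow> nat \<Rightarrow> complex poly poly) ring" where
  "skew \<equiv> skew_group_ring ore Z2 sign_action"

definition skew_elt :: "pair3 \<Rightarrow> int \<Rightarrow> nat \<Rightarrow> complex poly poly" where
  "skew_elt f = (\<lambda>k\<in>{0, 1}. coeff (if k = 0 then fst f else snd f))"

lemma skew_elt_simps [simp]: "skew_elt f 0 = coeff (fst f)" "skew_elt f 1 = coeff (snd f)"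
  by (simp_all add: skew_elt_def)

lemma skew_elt_add: "skew_elt f \<oplus>\<^bsub>skew\<^esub> skew_elt g = skew_elt (f + g)"
  unfolding skew_group_ring_def by (auto simp: carrier_Z2 ore_simps fun_eq_iff skew_elt_def)

lemma skew_elt_mult: "skew_elt f \<otimes>\<^bsub>skew\<^esub> skew_elt g = skew_elt (pair_mult f g)"
proof -
  interpret O: abelian_group ore by (rule abelian_group_ore)
  have sum: "finsum ore h (carrier Z2) = h 0 \<oplus>\<^bsub>ore\<^esub> h 1"
    if "h 0 \<in> carrier ore" "h 1 \<in> carrier ore" for h
    using that by (simp add: carrier_Z2 O.finsum_insert)
  have inv: "inv\<^bsub>Z2\<^esub> 0 = 0" "inv\<^bsub>Z2\<^esub> 1 = 1"
    by (simp_all add: carrier_Z2)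
  have "finsum ore (\<lambda>h. skew_elt f h \<otimes>\<^bsub>ore\<^esub> sign_action h (skew_elt g (inv\<^bsub>Z2\<^esub> h \<otimes>\<^bsub>Z2\<^esub> k))) (carrier Z2) =
      skew_elt (pair_mult f g) k" if "k \<in> {0, 1}" for k
    using that
    by (subst sum) (auto simp: inv sign_action_coeff ore_simps pair_mult_def)
  then show ?thesis
    unfolding skew_group_ring_def
    by (auto simp: carrier_Z2 fun_eq_iff) (auto simp: skew_elt_def)
qed

lemma bij_skew_elt: "bij_betw skew_elt UNIV (carrier skew)"
proof (rule bij_betw_byWitness[where f' = "\<lambda>a. (Abs_poly (a 0), Abs_poly (a 1))"])
  show "\<forall>f\<in>UNIV. (Abs_poly (skew_elt f 0), Abs_poly (skew_elt f 1)) = f"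
    by (simp add: coeff_inverse)
  show "\<forall>a\<in>carrier skew. skew_elt (Abs_poly (a 0), Abs_poly (a 1)) = a"
  proof
    fix a assume "a \<in> carrier skew"
    then have a: "a \<in> {0, 1} \<rightarrow>\<^sub>E range coeff"
      by (simp add: skew_group_ring_def carrier_Z2 ore_simps)
    then have "a 0 \<in> range coeff" "a 1 \<in> range coeff"
      by auto
    then have "coeff (Abs_poly (a 0)) = a 0" "coeff (Abs_poly (a 1)) = a 1"
      by (auto simp: coeff_inverse)
    then show "skew_elt (Abs_poly (a 0), Abs_poly (a 1)) = a"
      using PiE_arb[OF a] by (auto simp: skew_elt_def fun_eq_iff)
  qed
  show "skew_elt ` UNIV \<subseteq> carrier skew"
    by (auto simp: skew_group_ring_def carrier_Z2 ore_simps skew_elt_def)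
qed simp

lemma skew_incl_eq: "skew_incl ore Z2 (coeff p) = skew_elt (p, 0)"
  by (auto simp: skew_incl_def skew_elt_def carrier_Z2 ore_simps fun_eq_iff)

text \<open>The isomorphism is the passage to normal forms, with the coefficients of 1 and Z
  separated.\<close>

definition conifold_to_skew :: "free_alg set \<Rightarrow> int \<Rightarrow> nat \<Rightarrow> complex poly poly" where
  "conifold_to_skew a = skew_elt (split_pair (conifold.coords a))"

lemma conifold_to_skew_class: "conifold_to_skew (conifold_class p) = skew_elt (split_pair (nf p))"
  by (simp add: conifold_to_skew_def)

lemma split_pair_nf:
  "split_pair (nf (Poly_Mapping.single 0 c)) = ([:zX_scal c:], 0)" "split_pair (nf free_X) = ([:zX_X:], 0)"
  "split_pair (nf free_Y) = ([:0, 1:], 0)" "split_pair (nf free_z) = ([:zX_z:], 0)" "split_pair (nf 1) = (1, 0)"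
proof -
  have one: "split_pair nf_one = ([:1:], 0)"
    by (simp add: split_pair_def nf_one_def lift3_const[OF additive_fst_snd(1)] lift3_const[OF additive_fst_snd(2)])
      (simp add: const3_def one_pCons)
  interpret s: conifold_hom group_alg.sc3 group_alg.Z3 left_X left_Y
    pair_sc pair_Z "map_prod left_X left_X" "map_prod left_Y left_Y" split_pair
    by (rule split_pair_hom)
  have z: "split_pair (left_z f) = map_prod left_z left_z (split_pair f)" for f
    by (simp add: split_pair_def lift3_left_z[OF additive_fst_snd(1)] lift3_left_z[OF additive_fst_snd(2)])
  have zero: "left_X 0 = (0 :: complex poly3)" "left_Y 0 = (0 :: complex poly3)" "left_z 0 = (0 :: complex poly3)"
    by (simp_all add: left_X_def left_Y_def left_z_def)
  show "split_pair (nf (Poly_Mapping.single 0 c)) = ([:zX_scal c:], 0)"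
    by (simp add: nf_def nf.free_op_scalar s.hom_sc one pair_sc_def zX_scal_def)
  show "split_pair (nf free_X) = ([:zX_X:], 0)"
    by (simp add: nf_def nf.free_op_X s.hom_X one zero left_X_eq_smult zX_X_def)
  show "split_pair (nf free_Y) = ([:0, 1:], 0)"
  proof -
    have "split_pair (nf free_Y) = map_prod left_Y left_Y ([:1:], 0)"
      by (simp only: nf_def nf.free_op_Y s.hom_Y one)
    moreover have "delta 1 = 0"
      by (simp add: one_pCons delta_pCons)
    ultimately show ?thesis
      by (simp add: zero) (simp add: left_Y_def map_poly_pCons alternate_1)
  qed
  show "split_pair (nf free_z) = ([:zX_z:], 0)"
    by (simp add: nf_def nf.free_op_z group_alg.zop_induced z one zero)
      (simp add: left_z_def map_poly_pCons one_pCons zX_z_def)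
  show "split_pair (nf 1) = (1, 0)"
    by (simp add: nf_1 one one_pCons)
qed

lemma conifold_to_skew_iso:
  "conifold_to_skew \<in> algebra_iso conifold conifold_scal skew (\<lambda>c. skew_incl ore Z2 (ore_const poly_zX (zX_scal c)))"
proof -
  interpret s: conifold_hom group_alg.sc3 group_alg.Z3 left_X left_Y
    pair_sc pair_Z "map_prod left_X left_X" "map_prod left_Y left_Y" split_pair
    by (rule split_pair_hom)
  have bij: "bij_betw conifold_to_skew (carrier conifold) (carrier skew)"
  proof -
    have "bij_betw conifold.coords (carrier conifold) UNIV"
      by (rule bij_betw_byWitness[where f' = conifold.elt]) (auto simp: conifold.elt_coords)
    then have "bij_betw (skew_elt \<circ> (split_pair \<circ> conifold.coords)) (carrier conifold) (carrier skew)"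
      using bij_split_pair bij_skew_elt by (intro bij_betw_trans)
    then show ?thesis
      by (simp add: conifold_to_skew_def[abs_def] comp_def)
  qed
  have "conifold_to_skew \<in> ring_hom conifold skew"
  proof (rule ring_hom_memI)
    show "conifold_to_skew a \<in> carrier skew" if "a \<in> carrier conifold" for a
      using bij that by (auto simp: bij_betw_def)
    show "conifold_to_skew (a \<otimes>\<^bsub>conifold\<^esub> b) = conifold_to_skew a \<otimes>\<^bsub>skew\<^esub> conifold_to_skew b"
      if "a \<in> carrier conifold" "b \<in> carrier conifold" for a b
    proof -
      obtain p where a: "a = conifold_class p"
        using \<open>a \<in> carrier conifold\<close> by (rule conifold.carrier_cases)
      show ?thesis
        using that(2) by (simp add: a conifold_to_skew_def conifold.coords_mult split_pair_act skew_elt_mult)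
    qed
    show "conifold_to_skew (a \<oplus>\<^bsub>conifold\<^esub> b) = conifold_to_skew a \<oplus>\<^bsub>skew\<^esub> conifold_to_skew b"
      if "a \<in> carrier conifold" "b \<in> carrier conifold" for a b
      using that by (simp add: conifold_to_skew_def conifold.coords_add additive.add[OF s.additive_hom] skew_elt_add)
    have "\<one>\<^bsub>skew\<^esub> = skew_incl ore Z2 (coeff 1)"
      by (simp add: skew_group_ring_def skew_incl_def flip: ore_simps(4))
    then show "conifold_to_skew \<one>\<^bsub>conifold\<^esub> = \<one>\<^bsub>skew\<^esub>"
      by (simp add: conifold_to_skew_class split_pair_nf skew_incl_eq flip: conifold.cl_one)
  qed
  then show ?thesis
    using bij
    by (simp add: algebra_iso_def ring_iso_def conifold_generators conifold_to_skew_class split_pair_nf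
        skew_incl_eq ore_const_eq)
qed

lemma conifold_to_skew_generators:
  "conifold_to_skew conifold_z = skew_incl ore Z2 (ore_const poly_zX zX_z)"
  "conifold_to_skew conifold_X = skew_incl ore Z2 (ore_const poly_zX zX_X)"
  "conifold_to_skew conifold_Y = skew_incl ore Z2 (ore_Y poly_zX)"
  by (simp_all add: conifold_generators conifold_to_skew_class split_pair_nf skew_incl_eq ore_const_eq ore_Y_eq)

lemma alternate_iso: "alternate \<in> algebra_iso poly_zX zX_scal poly_zX zX_scal"
proof -
  have "bij alternate"
    by (rule involuntory_imp_bij) (rule alternate_alternate)
  then show ?thesis
    by (auto simp: algebra_iso_def ring_iso_def zX_scal_def alternate_pCons
        intro!: ring_hom_memI alternate_mult alternate_add alternate_1)
qed

lemma delta_sigma_derivation: "sigma_derivation poly_zX zX_scal alternate delta"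
  by (auto simp: sigma_derivation_def delta_add delta_mult zX_scal_def delta_smult)

theorem proposition5p2:
  shows
    "{conifold_x, conifold_y, conifold_z} \<subseteq> ring_center conifold \<and>
     algebraically_independent3 conifold conifold_scal conifold_x conifold_y conifold_z \<and>
     conifold_C \<subseteq> ring_center conifold \<and>
     Module.module (conifold\<lparr>carrier := conifold_C\<rparr>) (regular_module conifold) \<and>
     module_basis (conifold\<lparr>carrier := conifold_C\<rparr>) (regular_module conifold)
       [\<one>\<^bsub>conifold\<^esub>, conifold_X, conifold_Y, conifold_Z,
        conifold_X \<otimes>\<^bsub>conifold\<^esub> conifold_Y,
        conifold_X \<otimes>\<^bsub>conifold\<^esub> conifold_Z,
        conifold_Y \<otimes>\<^bsub>conifold\<^esub> conifold_Z,
        conifold_X \<otimes>\<^bsub>conifold\<^esub> conifold_Y \<otimes>\<^bsub>conifold\<^esub> conifold_Z] \<and>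
     (\<exists>\<sigma> \<delta> \<alpha> \<phi>.
        \<sigma> \<in> algebra_iso poly_zX zX_scal poly_zX zX_scal \<and>
        sigma_derivation poly_zX zX_scal \<sigma> \<delta> \<and>
        (let S = ore_extension poly_zX \<sigma> \<delta>;
             s = (\<lambda>c. ore_const poly_zX (zX_scal c));
             G = integer_mod_group 2
         in algebra_action G S s \<alpha> \<and>
            \<phi> \<in> algebra_iso conifold conifold_scal
                   (skew_group_ring S G \<alpha>) (\<lambda>c. skew_incl S G (s c)) \<and>
            \<phi> conifold_z = skew_incl S G (ore_const poly_zX zX_z) \<and>
            \<phi> conifold_X = skew_incl S G (ore_const poly_zX zX_X) \<and>
            \<phi> conifold_Y = skew_incl S G (ore_Y poly_zX))) \<and>
     left_global_dimension TYPE('m) conifold = 3 \<and>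
     right_global_dimension TYPE('m) conifold = 3"
proof (intro conjI)
  have "conifold_x \<in> ring_center conifold" "conifold_y \<in> ring_center conifold"
    "conifold_z \<in> ring_center conifold"
    unfolding conifold_generators by (rule conifold.central_generators)+
  then show "{conifold_x, conifold_y, conifold_z} \<subseteq> ring_center conifold"
    by simp
  show "\<exists>\<sigma> \<delta> \<alpha> \<phi>.
        \<sigma> \<in> algebra_iso poly_zX zX_scal poly_zX zX_scal \<and>
        sigma_derivation poly_zX zX_scal \<sigma> \<delta> \<and>
        (let S = ore_extension poly_zX \<sigma> \<delta>;
             s = (\<lambda>c. ore_const poly_zX (zX_scal c));
             G = integer_mod_group 2
         in algebra_action G S s \<alpha> \<and>
            \<phi> \<in> algebra_iso conifold conifold_scal
                   (skew_group_ring S G \<alpha>) (\<lambda>c. skew_incl S G (s c)) \<and>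
            \<phi> conifold_z = skew_incl S G (ore_const poly_zX zX_z) \<and>
            \<phi> conifold_X = skew_incl S G (ore_const poly_zX zX_X) \<and>
            \<phi> conifold_Y = skew_incl S G (ore_Y poly_zX))"
    unfolding Let_def
    by (intro exI[of _ alternate] exI[of _ delta] exI[of _ sign_action] exI[of _ conifold_to_skew] conjI
        alternate_iso delta_sigma_derivation sign_algebra_action conifold_to_skew_iso
        conifold_to_skew_generators)
qed (fact conifold_alg_independent conifold_C_central conifold_C_module conifold_basis[unfolded basis_list_def]
    global_dimension_conifold)+

end
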